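(* For every integer $m \geq 2$ we have $\mathbf{R}_m \vee \mathbf{L}_m = \mathbf{W}_m$.
   Context: A variety is a class of finite monoids closed under submonoids, homomorphic images and finite direct products. The join $\mathbf{V} \vee \mathbf{W}$ of two varieties is the smallest variety containing both. Omega-terms over a set of variables $\Sigma$ are defined inductively: $1$ and every $x \in \Sigma$ are omega-terms, and if $u,v$ are omega-terms then so are $uv$ and $(u)^\omega$. A homomorphism $\varphi : \Sigma^* \to M$ to a finite monoid $M$ extends to omega-terms by letting $\varphi(u^\omega)$ be the unique idempotent that is a positive power of $\varphi(u)$. A finite monoid $M$ satisfies $u = v$ if $\varphi(u) = \varphi(v)$ for every homomorphism $\varphi : \Sigma^* \to M$; the class of all finite monoids satisfying $u=v$ is denoted $[\![u = v]\!]$ and is a variety. For a finite monoid $M$ and $x,y\in M$: $x \mathrel{\mathcal{R}} y$ iff $xM = yM$, and $x \mathrel{\mathcal{L}} y$ iff $Mx = My$. Define congruences on $M$: $x \sim_K y$ iff for all idempotents $e$ of $M$, if $ex \mathrel{\mathcal{R}} e$ or $ey \mathrel{\mathcal{R}} e$, then $ex = ey$; and $x \sim_D y$ iff for all idempotents $e$ of $M$, if $xe \mathrel{\mathcal{L}} e$ or $ye \mathrel{\mathcal{L}} e$, then $xe = ye$. For a variety $\mathbf{V}$, let $\mathbf{K} ⓜ \mathbf{V}$ be the class of all finite monoids $M$ with $M/{\sim_K} \in \mathbf{V}$, and $\mathbf{D} ⓜ \mathbf{V}$ the class of all finite monoids $M$ with $M/{\sim_D} \in \mathbf{V}$. The Trotter-Weil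 hierarchy: $\mathbf{R}_2 = [\![(zx)^\omega z = (zx)^\omega]\!]$ (the $\mathcal{R}$-trivial finite monoids), $\mathbf{L}_2 = [\![z(yz)^\omega = (yz)^\omega]\!]$ (the $\mathcal{L}$-trivial finite monoids), and for $m \geq 2$, $\mathbf{R}_{m+1} = \mathbf{K} ⓜ \mathbf{L}_m$ and $\mathbf{L}_{m+1} = \mathbf{D} ⓜ \mathbf{R}_m$. Each of these is a variety. The varieties $\mathbf{W}_m$: in variables $z, x_1, x_2,\ldots, y_1, y_2, \ldots$ put $e_1 = f_1 = 1$ and, for $i \geq 1$, $e_{i+1} = (e_i \cdots e_1 z f_1 \cdots f_i x_i)^\omega$ and $f_{i+1} = (y_i e_i \cdots e_1 z f_1 \cdots f_i)^\omega$. Then $\mathbf{W}_m = [\![e_m \cdots e_1 z f_1 \cdots f_m = e_m \cdots e_1 f_1 \cdots f_m]\!]$. *)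

theory Defs
  imports "HOL-Algebra.Algebra"
begin

section \<open>Varieties of finite monoids\<close>

text \<open>
  Every finite monoid has an isomorphic copy on a set of natural numbers, so a class of finite
  monoids closed under isomorphism is represented by the set of its members carried by sets of
  naturals.  A finite monoid over any other type belongs to such a class iff some isomorphic copy
  does (\<open>belongs_to\<close>).
\<close>

definition finite_monoids :: "nat monoid set" where
  "finite_monoids = {M. monoid M \<and> finite (carrier M)}"

definition belongs_to :: "'a monoid \<Rightarrow> nat monoid set \<Rightarrow> bool" where
  "belongs_to Q V \<longleftrightarrow> (\<exists>N\<in>V. Q \<cong> N)"

text \<open>In contrast to \<^const>\<open>hom\<close>, preservation of the unit is required.\<close>

definition monoid_homs :: "('a, 'c) monoid_scheme \<Rightarrow> ('b, 'd) monoid_scheme \<Rightarrow> ('a \<Rightarrow> 'b) set" where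
  "monoid_homs M N = {h \<in> hom M N. h \<one>\<^bsub>M\<^esub> = \<one>\<^bsub>N\<^esub>}"

text \<open>
  \<^const>\<open>product_group\<close> is the componentwise product of any family of structures; the index set
  may be empty, so a variety contains the one-element monoids.  Closure under isomorphism is a
  special case of closure under homomorphic images.
\<close>

definition variety :: "nat monoid set \<Rightarrow> bool" where
  "variety V \<longleftrightarrow>
     V \<subseteq> finite_monoids \<and>
     (\<forall>M\<in>V. \<forall>H. submonoid H M \<longrightarrow> M\<lparr>carrier := H\<rparr> \<in> V) \<and>
     (\<forall>M\<in>V. \<forall>N\<in>finite_monoids. \<forall>h\<in>monoid_homs M N. h ` carrier M = carrier N \<longrightarrow> N \<in> V) \<and>
     (\<forall>(I :: nat set) G. finite I \<longrightarrow> (\<forall>i\<in>I. G i \<in> V) \<longrightarrow>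
        (\<forall>N\<in>finite_monoids. product_group I G \<cong> N \<longrightarrow> N \<in> V))"

definition variety_join :: "nat monoid set \<Rightarrow> nat monoid set \<Rightarrow> nat monoid set" where
  "variety_join V W = variety hull (V \<union> W)"

lemma variety_finite_monoids: "variety finite_monoids"
  unfolding variety_def
proof (intro conjI ballI allI impI)
  fix M H assume "M \<in> finite_monoids" "submonoid H M"
  then show "M\<lparr>carrier := H\<rparr> \<in> finite_monoids"
    unfolding finite_monoids_def
    by (simp add: submonoid.submonoid_is_monoid finite_subset[OF submonoid.subset])
qed simp_all

lemma variety_Inter:
  assumes V: "\<And>V. V \<in> \<V> \<Longrightarrow> variety V" and "\<V> \<noteq> {}"
  shows "variety (\<Inter>\<V>)"
proof -
  obtain V0 where V0: "V0 \<in> \<V>" using \<open>\<V> \<noteq> {}\<close> by blast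
  show ?thesis
    unfolding variety_def
  proof (intro conjI ballI allI impI)
    show "\<Inter>\<V> \<subseteq> finite_monoids"
      using V[OF V0] V0 unfolding variety_def by (meson Inter_lower order_trans)
  next
    fix M H assume A: "M \<in> \<Inter>\<V>" "submonoid H M"
    show "M\<lparr>carrier := H\<rparr> \<in> \<Inter>\<V>"
    proof
      fix V assume "V \<in> \<V>"
      then have "M \<in> V" "variety V" using A V by (simp_all only: Inter_iff)
      with A(2) show "M\<lparr>carrier := H\<rparr> \<in> V" by (simp only: variety_def)
    qed
  next
    fix M N h
    assume A: "M \<in> \<Inter>\<V>" "N \<in> finite_monoids" "h \<in> monoid_homs M N" "h ` carrier M = carrier N"
    show "N \<in> \<Inter>\<V>"
    proof
      fix V assume "V \<in> \<V>"
      then have "M \<in> V" "variety V" using A V by (simp_all only: Inter_iff)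
      with A(2-4) show "N \<in> V" unfolding variety_def by meson
    qed
  next
    fix I :: "nat set" and G N
    assume A: "finite I" "\<forall>i\<in>I. G i \<in> \<Inter>\<V>" "N \<in> finite_monoids" "product_group I G \<cong> N"
    show "N \<in> \<Inter>\<V>"
    proof
      fix V assume "V \<in> \<V>"
      then have "\<forall>i\<in>I. G i \<in> V" "variety V" using A(2) V by auto
      with A show "N \<in> V" unfolding variety_def by meson
    qed
  qed
qed

lemma variety_variety_join:
  assumes "V \<subseteq> finite_monoids" "W \<subseteq> finite_monoids"
  shows "variety (variety_join V W)"
  unfolding variety_join_def hull_def
proof (rule variety_Inter)
  have "finite_monoids \<in> {U. variety U \<and> V \<union> W \<subseteq> U}"
    using assms variety_finite_monoids by simp
  then show "{U. variety U \<and> V \<union> W \<subseteq> U} \<noteq> {}" by blast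
qed simp


section \<open>Omega-terms\<close>

datatype 'v omega_term =
    TOne
  | TVar 'v
  | TMul "'v omega_term" "'v omega_term"  (infixl \<open>\<star>\<close> 70)
  | TOmega "'v omega_term"

definition free_monoid :: "'v list monoid" where
  "free_monoid = \<lparr>carrier = UNIV, monoid.mult = (@), one = []\<rparr>"

definition idempotent :: "('a, 'c) monoid_scheme \<Rightarrow> 'a \<Rightarrow> bool" where
  "idempotent M e \<longleftrightarrow> e \<in> carrier M \<and> e \<otimes>\<^bsub>M\<^esub> e = e"

definition omega_power :: "('a, 'c) monoid_scheme \<Rightarrow> 'a \<Rightarrow> 'a" where
  "omega_power M x = (THE e. idempotent M e \<and> (\<exists>k::nat. k > 0 \<and> e = x [^]\<^bsub>M\<^esub> k))"

primrec omega_ext :: "('a, 'c) monoid_scheme \<Rightarrow> ('v list \<Rightarrow> 'a) \<Rightarrow> 'v omega_term \<Rightarrow> 'a" where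
  "omega_ext M \<phi> TOne = \<phi> []"
| "omega_ext M \<phi> (TVar x) = \<phi> [x]"
| "omega_ext M \<phi> (u \<star> v) = omega_ext M \<phi> u \<otimes>\<^bsub>M\<^esub> omega_ext M \<phi> v"
| "omega_ext M \<phi> (TOmega u) = omega_power M (omega_ext M \<phi> u)"

definition satisfies :: "('a, 'c) monoid_scheme \<Rightarrow> 'v omega_term \<Rightarrow> 'v omega_term \<Rightarrow> bool" where
  "satisfies M u v \<longleftrightarrow> (\<forall>\<phi>\<in>monoid_homs free_monoid M. omega_ext M \<phi> u = omega_ext M \<phi> v)"

definition equational_class :: "'v omega_term \<Rightarrow> 'v omega_term \<Rightarrow> nat monoid set" where
  "equational_class u v = {M \<in> finite_monoids. satisfies M u v}"


section \<open>The Trotter-Weil hierarchy\<close>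

definition green_R :: "('a, 'c) monoid_scheme \<Rightarrow> 'a \<Rightarrow> 'a \<Rightarrow> bool" where
  "green_R M x y \<longleftrightarrow> x <#\<^bsub>M\<^esub> carrier M = y <#\<^bsub>M\<^esub> carrier M"

definition green_L :: "('a, 'c) monoid_scheme \<Rightarrow> 'a \<Rightarrow> 'a \<Rightarrow> bool" where
  "green_L M x y \<longleftrightarrow> carrier M #>\<^bsub>M\<^esub> x = carrier M #>\<^bsub>M\<^esub> y"

definition sim_K :: "('a, 'c) monoid_scheme \<Rightarrow> ('a \<times> 'a) set" where
  "sim_K M = {(x, y). x \<in> carrier M \<and> y \<in> carrier M \<and>
     (\<forall>e. idempotent M e \<longrightarrow>
        green_R M (e \<otimes>\<^bsub>M\<^esub> x) e \<or> green_R M (e \<otimes>\<^bsub>M\<^esub> y) e \<longrightarrow>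
        e \<otimes>\<^bsub>M\<^esub> x = e \<otimes>\<^bsub>M\<^esub> y)}"

definition sim_D :: "('a, 'c) monoid_scheme \<Rightarrow> ('a \<times> 'a) set" where
  "sim_D M = {(x, y). x \<in> carrier M \<and> y \<in> carrier M \<and>
     (\<forall>e. idempotent M e \<longrightarrow>
        green_L M (x \<otimes>\<^bsub>M\<^esub> e) e \<or> green_L M (y \<otimes>\<^bsub>M\<^esub> e) e \<longrightarrow>
        x \<otimes>\<^bsub>M\<^esub> e = y \<otimes>\<^bsub>M\<^esub> e)}"

text \<open>For a congruence \<open>r\<close> on \<open>M\<close>, the union below is the single class of \<open>a \<otimes> b\<close>.\<close>

definition quotient_monoid :: "('a, 'c) monoid_scheme \<Rightarrow> ('a \<times> 'a) set \<Rightarrow> 'a set monoid" where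
  "quotient_monoid M r =
     \<lparr>carrier = carrier M // r,
      monoid.mult = (\<lambda>A B. \<Union>a\<in>A. \<Union>b\<in>B. r `` {a \<otimes>\<^bsub>M\<^esub> b}),
      one = r `` {\<one>\<^bsub>M\<^esub>}\<rparr>"

definition K_malcev :: "nat monoid set \<Rightarrow> nat monoid set" where
  "K_malcev V = {M \<in> finite_monoids. belongs_to (quotient_monoid M (sim_K M)) V}"

definition D_malcev :: "nat monoid set \<Rightarrow> nat monoid set" where
  "D_malcev V = {M \<in> finite_monoids. belongs_to (quotient_monoid M (sim_D M)) V}"

datatype variable = Var_z | Var_x nat | Var_y nat

abbreviation zt :: "variable omega_term" where "zt \<equiv> TVar Var_z"
abbreviation xt :: "nat \<Rightarrow> variable omega_term" where "xt i \<equiv> TVar (Var_x i)"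
abbreviation yt :: "nat \<Rightarrow> variable omega_term" where "yt i \<equiv> TVar (Var_y i)"

text \<open>The levels \<open>0\<close> and \<open>1\<close> are left unspecified.\<close>

fun R_level :: "nat \<Rightarrow> nat monoid set" and L_level :: "nat \<Rightarrow> nat monoid set" where
  "R_level (Suc (Suc 0)) = equational_class (TOmega (zt \<star> xt 1) \<star> zt) (TOmega (zt \<star> xt 1))"
| "R_level (Suc (Suc (Suc n))) = K_malcev (L_level (Suc (Suc n)))"
| "L_level (Suc (Suc 0)) = equational_class (zt \<star> TOmega (yt 1 \<star> zt)) (TOmega (yt 1 \<star> zt))"
| "L_level (Suc (Suc (Suc n))) = D_malcev (R_level (Suc (Suc n)))"


section \<open>The varieties W\<close>

text \<open>
  \<open>e_prod n\<close> is the product \<open>e\<^sub>n \<cdots> e\<^sub>1\<close> and \<open>f_prod n\<close> is \<open>f\<^sub>1 \<cdots> f\<^sub>n\<close>; the terms \<open>e\<^sub>0\<close> and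
  \<open>f\<^sub>0\<close> are left unspecified and never used.
\<close>

fun e_term :: "nat \<Rightarrow> variable omega_term" and f_term :: "nat \<Rightarrow> variable omega_term"
  and e_prod :: "nat \<Rightarrow> variable omega_term" and f_prod :: "nat \<Rightarrow> variable omega_term" where
  "e_term (Suc 0) = TOne"
| "e_term (Suc (Suc i)) = TOmega (e_prod (Suc i) \<star> zt \<star> f_prod (Suc i) \<star> xt (Suc i))"
| "f_term (Suc 0) = TOne"
| "f_term (Suc (Suc i)) = TOmega (yt (Suc i) \<star> e_prod (Suc i) \<star> zt \<star> f_prod (Suc i))"
| "e_prod 0 = TOne"
| "e_prod (Suc n) = e_term (Suc n) \<star> e_prod n"
| "f_prod 0 = TOne"
| "f_prod (Suc n) = f_prod n \<star> f_term (Suc n)"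

definition W_level :: "nat \<Rightarrow> nat monoid set" where
  "W_level m = equational_class (e_prod m \<star> zt \<star> f_prod m) (e_prod m \<star> f_prod m)"

end

theory Submission
  imports Defs "HOL-Library.Sublist"
begin

text \<open>
  Words over an alphabet carry congruences \<open>R_rel m n\<close> and \<open>L_rel m n\<close>, defined by cutting words at
  the first (last) occurrences of letters, whose quotients lie in \<open>\<^bold>R\<^sub>m\<^sub>+\<^sub>1\<close> and \<open>\<^bold>L\<^sub>m\<^sub>+\<^sub>1\<close>.  The inclusion
  of the join in \<open>\<^bold>W\<^sub>m\<close> is an induction on \<open>m\<close>.  Conversely, let \<open>M \<in> \<^bold>W\<^sub>m\<^sub>+\<^sub>1\<close>, with word problem \<open>\<rho>\<close>.
  For \<open>m \<ge> 2\<close> the relation ``\<open>p u q = p v q\<close> whenever \<open>p u \<R> p\<close> and \<open>u q \<L> q\<close>'' is a congruence with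
  quotient in \<open>\<^bold>W\<^sub>m\<close>, so by induction it contains \<open>R_rel (m - 1) n \<inter> L_rel (m - 1) n\<close> for some \<open>n\<close>;
  for \<open>m = 1\<close> it relates all words.  If \<open>u\<close> and \<open>v\<close> are related by \<open>R_rel m n\<close> and \<open>L_rel m n\<close> for large \<open>n\<close>, the
  letters at which the \<open>\<R>\<close>-class of a prefix of \<open>u\<close> or the \<open>\<L>\<close>-class of a suffix of \<open>v\<close> drops cut both
  words into corresponding blocks, and the blocks of \<open>u\<close> can be replaced by those of \<open>v\<close> one at a time.
  Hence \<open>M\<close> divides the product of the two quotients of the words over \<open>M\<close>.
\<close>

section \<open>Congruences defined by first and last occurrences\<close>

text \<open>In DA, whether a factor preserves the \<R>-class of a prefix depends only on its
  letters. Hence a letter at which the class drops is absent from the stable block before it, and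
  cuts at first and last occurrences find the drops. The identity of \<open>W_level (m + 1)\<close>
  with \<open>m \<ge> 1\<close> yields this property when \<open>z\<close> is sent to one word and
  all other variables to another.

  The relation with contexts \<open>p\<close> and \<open>q\<close> arises from the last variables:
  let \<open>x_m\<close> and \<open>y_m\<close> lead back to \<open>p\<close> and to
  \<open>q\<close>, and the outermost omega-powers are absorbed, leaving the identity of level
  \<open>m\<close>. If only the right side of that identity is known to be stable, equal alphabets
  pass stability to the left side. At level 1 the sides are \<open>z\<close> and \<open>1\<close>,
  which is why \<open>m = 1\<close> is separate.

  Drops of \<R>-classes are read off \<open>u\<close> and drops of \<L>-classes off \<open>v\<close>
  because blocks are exchanged from right to left: the left context is then always a prefix of
  \<open>u\<close> and the right context a suffix of \<open>v\<close>. Every cut costs one unit of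
  \<open>n\<close>, and the index of \<rho> bounds the cuts of either kind.\<close>

primrec refine :: "('a list \<Rightarrow> 'a list \<Rightarrow> bool) \<Rightarrow> nat \<Rightarrow> 'a list \<Rightarrow> 'a list \<Rightarrow> bool" where
  "refine C 0 u v \<longleftrightarrow> C u v \<and> set u = set v"
| "refine C (Suc n) u v \<longleftrightarrow> C u v \<and> set u = set v \<and>
     (\<forall>a u0 u1 v0 v1. u = u0 @ a # u1 \<longrightarrow> v = v0 @ a # v1 \<longrightarrow> a \<notin> set u0 \<longrightarrow> a \<notin> set v0 \<longrightarrow>
        C u0 v0 \<and> set u0 = set v0 \<and> refine C n u1 v1)"

primrec R_rel :: "nat \<Rightarrow> nat \<Rightarrow> 'a list \<Rightarrow> 'a list \<Rightarrow> bool" where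
  "R_rel 0 n u v \<longleftrightarrow> True"
| "R_rel (Suc m) n u v \<longleftrightarrow> refine (\<lambda>u v. R_rel m n (rev u) (rev v)) n u v"

definition L_rel :: "nat \<Rightarrow> nat \<Rightarrow> 'a list \<Rightarrow> 'a list \<Rightarrow> bool" where
  "L_rel m n u v \<longleftrightarrow> R_rel m n (rev u) (rev v)"

lemma R_rel_Suc: "R_rel (Suc m) n = refine (L_rel m n) n"
  by (intro ext) (simp add: L_rel_def[abs_def])

declare R_rel.simps(2) [simp del]

lemma refineD: "refine C n u v \<Longrightarrow> C u v \<and> set u = set v"
  by (cases n) (auto simp: refine.simps)

lemma refine_cut:
  assumes "refine C (Suc n) (u0 @ a # u1) (v0 @ a # v1)" "a \<notin> set u0" "a \<notin> set v0"
  shows "C u0 v0" "set u0 = set v0" "refine C n u1 v1"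
  using assms by auto

lemma refine_SucI:
  assumes "C u v" "set u = set v"
    "\<And>a u0 u1 v0 v1. u = u0 @ a # u1 \<Longrightarrow> v = v0 @ a # v1 \<Longrightarrow> a \<notin> set u0 \<Longrightarrow> a \<notin> set v0 \<Longrightarrow>
        C u0 v0 \<and> set u0 = set v0 \<and> refine C n u1 v1"
  shows "refine C (Suc n) u v"
  using assms by simp

declare refine.simps(2) [simp del]

lemma refine_mono:
  assumes "refine C n u v" "k \<le> n" "\<And>u v. C u v \<Longrightarrow> C' u v"
  shows "refine C' k u v"
  using assms(1,2)
proof (induction k arbitrary: n u v)
  case 0
  then show ?case using refineD assms(3) by fastforce
next
  case (Suc k)
  then obtain n' where n: "n = Suc n'" "k \<le> n'" by (cases n) auto
  show ?case
  proof (rule refine_SucI)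
    show "C' u v" "set u = set v" using refineD[OF Suc.prems(1)] assms(3) by auto
  next
    fix a u0 u1 v0 v1
    assume "u = u0 @ a # u1" "v = v0 @ a # v1" "a \<notin> set u0" "a \<notin> set v0"
    with refine_cut[of C n' u0 a u1 v0 v1] Suc.prems(1) n Suc.IH[of n' u1 v1] assms(3)
    show "C' u0 v0 \<and> set u0 = set v0 \<and> refine C' k u1 v1" by blast
  qed
qed

text \<open>By definition a cut refines only the suffixes. But a first occurrence in
  \<open>t\<close> is also one in the whole word, and after that cut the rest of \<open>t\<close> is
  again followed by the first \<open>a\<close>, so the induction hypothesis applies to it.\<close>

lemma refine_cut_prefix:
  assumes "refine C (Suc n) (t @ a # r) (t' @ a # r')" "a \<notin> set t" "a \<notin> set t'"
  shows "refine C n t t'"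
  using assms
proof (induction n arbitrary: t r t' r')
  case 0
  then show ?case using refine_cut by fastforce
next
  case (Suc n)
  note cut = refine_cut[OF Suc.prems]
  show ?case
  proof (rule refine_SucI)
    show "C t t'" "set t = set t'" using cut by auto
  next
    fix c u0 u1 v0 v1
    assume *: "t = u0 @ c # u1" "t' = v0 @ c # v1" "c \<notin> set u0" "c \<notin> set v0"
    have 1: "refine C (Suc (Suc n)) (u0 @ c # (u1 @ a # r)) (v0 @ c # (v1 @ a # r'))"
      using Suc.prems(1) * by simp
    note cut1 = refine_cut[OF 1 *(3,4)]
    have "refine C n u1 v1"
      by (rule Suc.IH[OF cut1(3)]) (use * Suc.prems in auto)
    then show "C u0 v0 \<and> set u0 = set v0 \<and> refine C n u1 v1" using cut1 by blast
  qed
qed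

lemma first_split_eq:
  "a \<notin> set u0 \<Longrightarrow> a \<notin> set v0 \<Longrightarrow> u0 @ a # u1 = v0 @ a # v1 \<longleftrightarrow> u0 = v0 \<and> u1 = v1"
  by (auto simp: append_eq_append_conv2 append_eq_Cons_conv Cons_eq_append_conv)

lemma refine_refl: "(\<And>u. C u u) \<Longrightarrow> refine C n u u"
proof (induction n arbitrary: u)
  case (Suc n)
  show ?case
  proof (rule refine_SucI)
    fix a u0 u1 v0 v1
    assume "u = u0 @ a # u1" "u = v0 @ a # v1" "a \<notin> set u0" "a \<notin> set v0"
    then have "u0 = v0 \<and> u1 = v1" by (simp add: first_split_eq)
    then show "C u0 v0 \<and> set u0 = set v0 \<and> refine C n u1 v1" using Suc by auto
  qed (use Suc in auto)
qed auto

lemma refine_sym: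
  assumes "\<And>u v. C u v \<Longrightarrow> C v u"
  shows "refine C n u v \<Longrightarrow> refine C n v u"
proof (induction n arbitrary: u v)
  case (Suc n)
  note D = refineD[OF Suc.prems]
  show ?case
  proof (rule refine_SucI)
    show "C v u" "set v = set u" using D assms by auto
  next
    fix a u0 u1 v0 v1
    assume *: "v = u0 @ a # u1" "u = v0 @ a # v1" "a \<notin> set u0" "a \<notin> set v0"
    from refine_cut[OF Suc.prems[unfolded *(1,2)] *(4,3)]
    show "C u0 v0 \<and> set u0 = set v0 \<and> refine C n u1 v1" using Suc.IH assms by blast
  qed
qed (use assms in auto)

lemma refine_trans:
  assumes "\<And>u v w. C u v \<Longrightarrow> C v w \<Longrightarrow> C u w"
  shows "refine C n u v \<Longrightarrow> refine C n v w \<Longrightarrow> refine C n u w"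
proof (induction n arbitrary: u v w)
  case 0
  then show ?case using assms by auto
next
  case (Suc n)
  note D = refineD[OF Suc.prems(1)] refineD[OF Suc.prems(2)]
  show ?case
  proof (rule refine_SucI)
    show "C u w" "set u = set w" using D assms by blast+
  next
    fix a u0 u1 w0 w1
    assume *: "u = u0 @ a # u1" "w = w0 @ a # w1" "a \<notin> set u0" "a \<notin> set w0"
    then have "a \<in> set v" using D by auto
    then obtain v0 v1 where v: "v = v0 @ a # v1" "a \<notin> set v0" by (meson split_list_first)
    note c = refine_cut[OF Suc.prems(1)[unfolded * v] *(3) v(2)]
      refine_cut[OF Suc.prems(2)[unfolded * v] v(2) *(4)]
    show "C u0 w0 \<and> set u0 = set w0 \<and> refine C n u1 w1"
      using c(1,2,4,5) assms[of u0 v0 w0] Suc.IH[OF c(3,6)] by simp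
  qed
qed

lemma first_split_append:
  assumes "u @ w = u0 @ a # u1" "a \<notin> set u0"
  obtains (left) p where "u = u0 @ a # p" "u1 = p @ w"
  | (right) p where "a \<notin> set u" "w = p @ a # u1" "u0 = u @ p"
  using assms by (auto simp: append_eq_append_conv2 append_eq_Cons_conv Cons_eq_append_conv)

text \<open>The letters of \<open>u\<close> and \<open>v\<close> agree, so a first occurrence lies
  in both of them or in neither. In the second case both cuts hit the same place of \<open>w\<close>
  and leave equal remainders; the premise on \<open>w\<close> supplies reflexivity for
  these.\<close>

lemma refine_append_right:
  assumes C: "\<And>u v w. C u v \<Longrightarrow> C (u @ w) (v @ w)"
  shows "refine C n u v \<Longrightarrow> refine C n w w \<Longrightarrow> refine C n (u @ w) (v @ w)"
proof (induction n arbitrary: u v)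
  case 0
  then show ?case using C by auto
next
  case (Suc n)
  note D = refineD[OF Suc.prems(1)]
  show ?case
  proof (rule refine_SucI)
    show "C (u @ w) (v @ w)" "set (u @ w) = set (v @ w)" using D C by auto
  next
    fix a u0 u1 v0 v1
    assume *: "u @ w = u0 @ a # u1" "v @ w = v0 @ a # v1" "a \<notin> set u0" "a \<notin> set v0"
    have w: "refine C n w w" by (rule refine_mono[OF Suc.prems(2)]) auto
    from *(1,3) show "C u0 v0 \<and> set u0 = set v0 \<and> refine C n u1 v1"
    proof (cases rule: first_split_append)
      case (left p)
      note p = this
      from *(2,4) show ?thesis
      proof (cases rule: first_split_append)
        case (left q)
        from refine_cut[OF Suc.prems(1)[unfolded p left] *(3,4)] show ?thesis
          using Suc.IH[OF _ w] p left by auto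
      next
        case (right q)
        then show ?thesis using D p by auto
      qed
    next
      case (right p)
      note p = this
      from *(2,4) show ?thesis
      proof (cases rule: first_split_append)
        case (left q)
        then show ?thesis using D p by auto
      next
        case (right q)
        have "p = q" "u1 = v1"
          using p(2) right(2) p(3) right(3) *(3,4) first_split_eq[of a p q u1 v1] by auto
        have "refine C n u1 u1"
          by (rule refine_cut(3)[OF Suc.prems(2)[unfolded p(2)] ]) (use p *(3) in auto)
        moreover have "C u0 v0" "set u0 = set v0"
          using D C p(3) right(3) \<open>p = q\<close> by auto
        ultimately show ?thesis using \<open>u1 = v1\<close> by blast
      qed
    qed
  qed
qed

lemma refine_append_left:
  assumes C: "\<And>u v w. C u v \<Longrightarrow> C (w @ u) (w @ v)" and refl: "\<And>u. C u u"
  shows "refine C n u v \<Longrightarrow> refine C n (w @ u) (w @ v)"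
proof (induction n arbitrary: u v w)
  case 0
  then show ?case using C by auto
next
  case (Suc n)
  note D = refineD[OF Suc.prems(1)]
  have uv: "refine C n u v" by (rule refine_mono[OF Suc.prems]) auto
  show ?case
  proof (rule refine_SucI)
    show "C (w @ u) (w @ v)" "set (w @ u) = set (w @ v)" using D C by auto
  next
    fix a u0 u1 v0 v1
    assume *: "w @ u = u0 @ a # u1" "w @ v = v0 @ a # v1" "a \<notin> set u0" "a \<notin> set v0"
    from *(1,3) show "C u0 v0 \<and> set u0 = set v0 \<and> refine C n u1 v1"
    proof (cases rule: first_split_append)
      case (left p)
      note p = this
      from *(2,4) show ?thesis
      proof (cases rule: first_split_append)
        case (left q)
        have "u0 = v0" "p = q"
          using p(1) left(1) *(3,4) first_split_eq[of a u0 v0 p q] by auto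
        then show ?thesis using refl Suc.IH[OF uv] p left by auto
      next
        case (right q)
        then show ?thesis using p by auto
      qed
    next
      case (right p)
      note p = this
      from *(2,4) show ?thesis
      proof (cases rule: first_split_append)
        case (left q)
        then show ?thesis using p by auto
      next
        case (right q)
        from refine_cut[OF Suc.prems(1)[unfolded p right]] show ?thesis
          using p right *(3,4) C by auto
      qed
    qed
  qed
qed

section \<open>The relations of both hierarchies are congruences and can be cut\<close>

lemma R_rel_refl: "R_rel m n u u"
  by (induction m arbitrary: n u) (simp_all add: R_rel.simps(2) refine_refl)

lemma R_rel_sym: "R_rel m n u v \<Longrightarrow> R_rel m n v u"
proof (induction m arbitrary: n u v)
  case (Suc m)
  then show ?case
    by (auto simp: R_rel.simps(2) intro: refine_sym[where C = "\<lambda>u v. R_rel m n (rev u) (rev v)"])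
qed simp

lemma R_rel_trans: "R_rel m n u v \<Longrightarrow> R_rel m n v w \<Longrightarrow> R_rel m n u w"
proof (induction m arbitrary: n u v w)
  case (Suc m)
  let ?C = "\<lambda>u v :: 'a list. R_rel m n (rev u) (rev v)"
  have "?C u w" if "?C u v" "?C v w" for u v w :: "'a list" using Suc.IH that by blast
  then show ?case using refine_trans[of ?C n u v w] Suc.prems by (simp add: R_rel.simps(2))
qed simp

lemma R_rel_cong: "R_rel m n u v \<Longrightarrow> R_rel m n (x @ u @ y) (x @ v @ y)"
proof (induction m arbitrary: n u v x y)
  case (Suc m)
  let ?C = "\<lambda>u v :: 'a list. R_rel m n (rev u) (rev v)"
  have C: "?C (u @ w) (v @ w)" "?C (w @ u) (w @ v)" if "?C u v" for u v w :: "'a list"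
    using Suc.IH[OF that, of "[]" "rev w"] Suc.IH[OF that, of "rev w" "[]"] by auto
  have "refine ?C n (x @ (u @ y)) (x @ (v @ y))"
    by (rule refine_append_left[of ?C, OF C(2) R_rel_refl
        refine_append_right[of ?C, OF C(1)]])
      (use Suc.prems in \<open>auto simp: R_rel.simps(2) refine_refl R_rel_refl\<close>)
  then show ?case by (simp only: R_rel.simps(2))
qed simp

lemma R_rel_mono: "R_rel m n u v \<Longrightarrow> k \<le> n \<Longrightarrow> R_rel m k u v"
proof (induction m arbitrary: n k u v)
  case (Suc m)
  let ?C = "\<lambda>n (u :: 'a list) v. R_rel m n (rev u) (rev v)"
  have "refine (?C k) k u v"
    by (rule refine_mono[of "?C n" n]) (use Suc in \<open>auto simp: R_rel.simps(2)\<close>)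
  then show ?case by (simp only: R_rel.simps(2))
qed simp

text \<open>Since \<open>n\<close> is both the depth of cutting and the parameter of the lower
  congruence, one unit of it pays for keeping the full relation on both sides of a cut; the prefix
  is due to \<open>refine_cut_prefix\<close>.\<close>

lemma R_rel_cut:
  assumes "R_rel m (Suc n) (u0 @ a # u1) (v0 @ a # v1)" "a \<notin> set u0" "a \<notin> set v0"
  shows "R_rel m n u0 v0" "R_rel m n u1 v1"
proof -
  have *: "R_rel m n u0 v0 \<and> R_rel m n u1 v1"
  proof (cases m)
    case (Suc k)
    let ?C = "\<lambda>n (u :: 'a list) v. R_rel k n (rev u) (rev v)"
    have r: "refine (?C (Suc n)) (Suc n) (u0 @ a # u1) (v0 @ a # v1)"
      using assms Suc by (simp only: R_rel.simps)
    have "refine (?C (Suc n)) n u0 v0" "refine (?C (Suc n)) n u1 v1"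
      using refine_cut_prefix[OF r assms(2,3)] refine_cut[OF r assms(2,3)] by auto
    then show ?thesis
      unfolding Suc R_rel.simps(2) by (auto elim!: refine_mono R_rel_mono)
  qed simp
  then show "R_rel m n u0 v0" "R_rel m n u1 v1" by auto
qed

lemma L_rel_cut:
  assumes "L_rel m (Suc n) (u0 @ a # u1) (v0 @ a # v1)" "a \<notin> set u1" "a \<notin> set v1"
  shows "L_rel m n u0 v0" "L_rel m n u1 v1"
  using R_rel_cut[of m n "rev u1" a "rev u0" "rev v1" "rev v0"] assms
  unfolding L_rel_def by auto

lemma R_rel_set: "R_rel (Suc m) n u v \<Longrightarrow> set u = set v"
  unfolding R_rel_Suc using refineD by blast

lemma L_rel_set: "L_rel (Suc m) n u v \<Longrightarrow> set u = set v"
  unfolding L_rel_def using R_rel_set by fastforce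

lemma R_rel_L_rel: "R_rel (Suc m) n u v \<Longrightarrow> L_rel m n u v"
  unfolding R_rel_Suc using refineD by blast

lemma L_rel_R_rel: "L_rel (Suc m) n u v \<Longrightarrow> R_rel m n u v"
  unfolding L_rel_def using R_rel_L_rel[of m n "rev u" "rev v"] by (simp add: L_rel_def)

text \<open>Keeps the alphabets of two words equal while they are being cut. The congruence on the
  blocks cannot do this, as \<open>R_rel 0\<close> relates all words. The condition is obtained from
  \<open>L_rel\<close>, which is cut at last occurrences, but it is also inherited by the parts
  after a first occurrence.\<close>

definition same_subseqs :: "nat \<Rightarrow> 'a list \<Rightarrow> 'a list \<Rightarrow> bool" where
  "same_subseqs n u v \<longleftrightarrow> (\<forall>w. length w \<le> n \<longrightarrow> subseq w u = subseq w v)"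

lemma same_subseqs_mono: "same_subseqs n u v \<Longrightarrow> k \<le> n \<Longrightarrow> same_subseqs k u v"
  unfolding same_subseqs_def by auto

lemma subseq_first: "a \<notin> set u \<Longrightarrow> subseq (a # w) (u @ a # x) = subseq w x"
  by (induction u) auto

lemma same_subseqs_cut:
  assumes "same_subseqs (Suc n) (u0 @ a # u1) (v0 @ a # v1)" "a \<notin> set u0" "a \<notin> set v0"
  shows "same_subseqs n u1 v1"
  unfolding same_subseqs_def
proof (intro allI impI)
  fix w :: "'a list" assume "length w \<le> n"
  then show "subseq w u1 = subseq w v1"
    using assms subseq_first[of a u0 w u1] subseq_first[of a v0 w v1]
    unfolding same_subseqs_def by (metis length_Cons Suc_le_mono)
qed

lemma same_subseqs_set: "same_subseqs (Suc n) u v \<Longrightarrow> set u = set v"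
  unfolding same_subseqs_def using subseq_singleton_left
  by (metis (no_types, lifting) One_nat_def Suc_le_mono length_Cons list.size(3) subsetI subset_antisym zero_le)

text \<open>The first letter of a subsequence can be matched at its first occurrence, so each letter
  costs one cut.\<close>

lemma refine_same_subseqs: "refine C n u v \<Longrightarrow> same_subseqs n u v"
proof (induction n arbitrary: u v)
  case 0
  then show ?case by (auto simp: same_subseqs_def)
next
  case (Suc n)
  show ?case
    unfolding same_subseqs_def
  proof (intro allI impI)
    fix w :: "'a list" assume w: "length w \<le> Suc n"
    show "subseq w u = subseq w v"
    proof (cases w)
      case (Cons a x)
      show ?thesis
      proof (cases "a \<in> set u")
        case True
        then have "a \<in> set v" using refineD[OF Suc.prems] by auto
        with True obtain u0 u1 v0 v1
          where *: "u = u0 @ a # u1" "v = v0 @ a # v1" "a \<notin> set u0" "a \<notin> set v0"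
          by (meson split_list_first)
        from refine_cut(3)[OF Suc.prems[unfolded *(1,2)] *(3,4)]
        have "same_subseqs n u1 v1" by (rule Suc.IH)
        then show ?thesis using * w Cons by (auto simp: subseq_first same_subseqs_def)
      next
        case False
        then have "a \<notin> set v" using refineD[OF Suc.prems] by auto
        with False show ?thesis using Cons by (auto dest: list_emb_set[where x = a])
      qed
    qed simp
  qed
qed

lemma subseq_rev: "subseq u v \<Longrightarrow> subseq (rev u) (rev v)"
  by (induction rule: list_emb.induct) (auto intro: list_emb_append_mono)

lemma L_rel_same_subseqs:
  assumes "L_rel (Suc m) n u v" shows "same_subseqs n u v"
proof -
  have *: "same_subseqs n (rev u) (rev v)"
    using assms unfolding L_rel_def R_rel_Suc by (rule refine_same_subseqs)
  show ?thesis
    unfolding same_subseqs_def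
  proof (intro allI impI)
    fix w :: "'a list" assume "length w \<le> n"
    then have "subseq (rev w) (rev u) = subseq (rev w) (rev v)"
      using * unfolding same_subseqs_def by simp
    then show "subseq w u = subseq w v" by (metis subseq_rev rev_rev_ident)
  qed
qed

section \<open>Congruences of finite index and Green's relations\<close>

locale word_congruence =
  fixes \<rho> :: "'a list \<Rightarrow> 'a list \<Rightarrow> bool"
  assumes refl: "\<rho> u u"
    and sym: "\<rho> u v \<Longrightarrow> \<rho> v u"
    and trans [trans]: "\<rho> u v \<Longrightarrow> \<rho> v w \<Longrightarrow> \<rho> u w"
    and compat: "\<rho> u v \<Longrightarrow> \<rho> (x @ u @ y) (x @ v @ y)"
begin

lemma compat_left: "\<rho> u v \<Longrightarrow> \<rho> (x @ u) (x @ v)"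
  using compat[of u v x "[]"] by simp

lemma compat_right: "\<rho> u v \<Longrightarrow> \<rho> (u @ y) (v @ y)"
  using compat[of u v "[]" y] by simp

lemma compat_append: "\<rho> u v \<Longrightarrow> \<rho> u' v' \<Longrightarrow> \<rho> (u @ u') (v @ v')"
  using compat_left[of u' v' u] compat_right[of u v v'] trans by blast

definition cls :: "'a list \<Rightarrow> 'a list set" where "cls u = {v. \<rho> u v}"

lemma cls_eq: "cls u = cls v \<longleftrightarrow> \<rho> u v"
  unfolding cls_def using refl sym trans by blast

text \<open>This is \<R>-equivalence of \<open>p @ w\<close> and \<open>p\<close> in the quotient:
  that \<open>p @ w\<close> lies in the right ideal of \<open>p\<close> is automatic, so one witness
  suffices.\<close>

definition R_stable :: "'a list \<Rightarrow> 'a list \<Rightarrow> bool" where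
  "R_stable p w \<longleftrightarrow> (\<exists>s. \<rho> (p @ w @ s) p)"

definition L_stable :: "'a list \<Rightarrow> 'a list \<Rightarrow> bool" where
  "L_stable w q \<longleftrightarrow> (\<exists>s. \<rho> (s @ w @ q) q)"

lemma R_stable_Nil: "R_stable p []" and L_stable_Nil: "L_stable [] q"
  unfolding R_stable_def L_stable_def using refl by (auto intro: exI[of _ "[]"])

lemma R_stable_append: "R_stable p (u @ v) \<longleftrightarrow> R_stable p u \<and> R_stable (p @ u) v"
proof
  assume "R_stable p (u @ v)"
  then obtain s where s: "\<rho> (p @ u @ v @ s) p" unfolding R_stable_def by auto
  have "\<rho> ((p @ u) @ v @ (s @ u)) (p @ u)" using compat_right[OF s, of u] by simp
  with s show "R_stable p u \<and> R_stable (p @ u) v" unfolding R_stable_def by blast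
next
  assume "R_stable p u \<and> R_stable (p @ u) v"
  then obtain s t where s: "\<rho> (p @ u @ s) p" and t: "\<rho> ((p @ u) @ v @ t) (p @ u)"
    unfolding R_stable_def by auto
  have "\<rho> (p @ (u @ v) @ (t @ s)) (p @ u @ s)" using compat_right[OF t, of s] by simp
  with s show "R_stable p (u @ v)" unfolding R_stable_def using trans by blast
qed

lemma L_stable_append: "L_stable (u @ v) q \<longleftrightarrow> L_stable v q \<and> L_stable u (v @ q)"
proof
  assume "L_stable (u @ v) q"
  then obtain s where s: "\<rho> (s @ u @ v @ q) q" unfolding L_stable_def by auto
  have "\<rho> ((v @ s) @ u @ (v @ q)) (v @ q)" using compat_left[OF s, of v] by simp
  with s show "L_stable v q \<and> L_stable u (v @ q)"
    unfolding L_stable_def by (metis append.assoc)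
next
  assume "L_stable v q \<and> L_stable u (v @ q)"
  then obtain s t where s: "\<rho> (s @ v @ q) q" and t: "\<rho> (t @ u @ v @ q) (v @ q)"
    unfolding L_stable_def by auto
  have "\<rho> ((s @ t) @ (u @ v) @ q) (s @ v @ q)" using compat_left[OF t, of s] by simp
  with s show "L_stable (u @ v) q" unfolding L_stable_def using trans by blast
qed

lemma R_stable_cong: "\<rho> p p' \<Longrightarrow> R_stable p w \<Longrightarrow> R_stable p' w"
proof -
  assume *: "\<rho> p p'" "R_stable p w"
  then obtain s where "\<rho> (p @ w @ s) p" unfolding R_stable_def by blast
  with compat_right[OF *(1), of "w @ s"] *(1) show "R_stable p' w"
    unfolding R_stable_def using sym trans by blast
qed

lemma L_stable_cong: "\<rho> q q' \<Longrightarrow> L_stable w q \<Longrightarrow> L_stable w q'"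
proof -
  assume *: "\<rho> q q'" "L_stable w q"
  then obtain s where "\<rho> (s @ w @ q) q" unfolding L_stable_def by blast
  with compat_left[OF *(1), of "s @ w"] *(1) show "L_stable w q'"
    unfolding L_stable_def using sym trans by (metis append.assoc)
qed

end

text \<open>
  In the quotient of words by \<open>\<rho>\<close>, whether multiplying by \<open>w\<close> stays within an \<open>\<R>\<close>-class or an
  \<open>\<L>\<close>-class depends on the letters of \<open>w\<close> only; this is the property of \<open>DA\<close> that is used.
\<close>

locale DA_congruence = word_congruence +
  assumes finite_index: "finite (range cls)"
    and R_stable_mono: "R_stable p w \<Longrightarrow> set x \<subseteq> set w \<Longrightarrow> R_stable p x"
    and L_stable_mono: "L_stable w q \<Longrightarrow> set x \<subseteq> set w \<Longrightarrow> L_stable x q"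
begin

lemma R_stable_sub:
  "R_stable p w \<Longrightarrow> set z \<subseteq> set w \<Longrightarrow> set x \<subseteq> set w \<Longrightarrow> R_stable (p @ z) x"
  using R_stable_mono[of p w "z @ x"] R_stable_append by auto

lemma L_stable_sub:
  "L_stable w q \<Longrightarrow> set z \<subseteq> set w \<Longrightarrow> set x \<subseteq> set w \<Longrightarrow> L_stable x (z @ q)"
  using L_stable_mono[of w q "x @ z"] L_stable_append by auto

text \<open>Going back to \<open>q\<close> between the two factors makes \<open>u @ t @ v\<close>
  stable, and \<open>t\<close> may be dropped because only letters matter.\<close>

lemma L_stable_union:
  assumes "L_stable u q" "L_stable v q" shows "L_stable (u @ v) q"
proof -
  from assms obtain s t where s: "\<rho> (s @ u @ q) q" and t: "\<rho> (t @ v @ q) q"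
    unfolding L_stable_def by blast
  have "\<rho> (s @ (u @ t @ v) @ q) q"
    using trans[OF compat_left[OF t, of "s @ u", simplified] s] by simp
  then have "L_stable (u @ t @ v) q" unfolding L_stable_def by blast
  then show ?thesis by (rule L_stable_mono) auto
qed

section \<open>Drops of \<R>-classes and \<L>-classes\<close>

lemma R_unstable_split:
  assumes "\<not> R_stable p u"
  obtains t a u1 where "u = t @ a # u1" "R_stable p t" "\<not> R_stable p (t @ [a])"
  using assms
proof (induction u arbitrary: thesis rule: rev_induct)
  case Nil
  then show ?case using R_stable_Nil by simp
next
  case (snoc a u)
  show ?case
  proof (cases "R_stable p u")
    case False
    from snoc.IH[OF _ False] obtain t c u1
      where "u = t @ c # u1" "R_stable p t" "\<not> R_stable p (t @ [c])" by blast
    then show ?thesis using snoc.prems(1)[of t c "u1 @ [a]"] by simp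
  qed (use snoc.prems(1)[of u a "[]"] snoc.prems(2) in simp)
qed

lemma L_unstable_split:
  assumes "\<not> L_stable v q"
  obtains v0 b t where "v = v0 @ b # t" "L_stable t q" "\<not> L_stable (b # t) q"
  using assms
proof (induction v arbitrary: thesis)
  case Nil
  then show ?case using L_stable_Nil by simp
next
  case (Cons b v)
  show ?case
  proof (cases "L_stable v q")
    case True
    then show ?thesis using Cons.prems(1)[of "[]" b v] Cons.prems(2) by simp
  next
    case False
    from Cons.IH[OF _ False] obtain v0 c t
      where "v = v0 @ c # t" "L_stable t q" "\<not> L_stable (c # t) q" by blast
    then show ?thesis using Cons.prems(1)[of "b # v0" c t] by simp
  qed
qed

text \<open>The size of the right ideal generated by \<open>p\<close> in the quotient. It decreases
  strictly whenever the \<R>-class drops, and thus bounds the number of drops.\<close>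

definition R_height :: "'a list \<Rightarrow> nat" where
  "R_height p = card (range (\<lambda>s. cls (p @ s)))"

definition L_height :: "'a list \<Rightarrow> nat" where
  "L_height q = card (range (\<lambda>s. cls (s @ q)))"

lemma R_height_le: "R_height p \<le> card (range cls)" and L_height_le: "L_height q \<le> card (range cls)"
  unfolding R_height_def L_height_def by (auto intro!: card_mono finite_index)

lemma R_height_pos: "R_height p > 0"
proof -
  have "finite (range (\<lambda>s. cls (p @ s)))" by (rule finite_subset[OF _ finite_index]) blast
  then show ?thesis unfolding R_height_def card_gt_0_iff by blast
qed

lemma L_height_pos: "L_height q > 0"
proof -
  have "finite (range (\<lambda>s. cls (s @ q)))" by (rule finite_subset[OF _ finite_index]) blast
  then show ?thesis unfolding L_height_def card_gt_0_iff by blast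
qed

lemma R_height_less:
  assumes "\<not> R_stable p w" shows "R_height (p @ w) < R_height p"
  unfolding R_height_def
proof (rule psubset_card_mono)
  show "finite (range (\<lambda>s. cls (p @ s)))" by (rule finite_subset[OF _ finite_index]) blast
  have "cls p \<in> range (\<lambda>s. cls (p @ s))" by (rule range_eqI[of _ _ "[]"]) simp
  moreover have "cls p \<notin> range (\<lambda>s. cls ((p @ w) @ s))"
  proof
    assume "cls p \<in> range (\<lambda>s. cls ((p @ w) @ s))"
    then obtain s where "\<rho> p ((p @ w) @ s)" unfolding image_iff cls_eq by blast
    then show False using assms sym unfolding R_stable_def append.assoc by blast
  qed
  moreover have "range (\<lambda>s. cls ((p @ w) @ s)) \<subseteq> range (\<lambda>s. cls (p @ s))"
    unfolding append.assoc by blast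
  ultimately show "range (\<lambda>s. cls ((p @ w) @ s)) \<subset> range (\<lambda>s. cls (p @ s))"
    by blast
qed

lemma L_height_less:
  assumes "\<not> L_stable w q" shows "L_height (w @ q) < L_height q"
  unfolding L_height_def
proof (rule psubset_card_mono)
  show "finite (range (\<lambda>s. cls (s @ q)))" by (rule finite_subset[OF _ finite_index]) blast
  have "cls q \<in> range (\<lambda>s. cls (s @ q))" by (rule range_eqI[of _ _ "[]"]) simp
  moreover have "cls q \<notin> range (\<lambda>s. cls (s @ w @ q))"
  proof
    assume "cls q \<in> range (\<lambda>s. cls (s @ w @ q))"
    then obtain s where "\<rho> q (s @ w @ q)" unfolding image_iff cls_eq by blast
    then show False using assms sym unfolding L_stable_def by blast
  qed
  moreover have "range (\<lambda>s. cls (s @ w @ q)) \<subseteq> range (\<lambda>s. cls (s @ q))"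
    unfolding append.assoc[symmetric] by blast
  ultimately show "range (\<lambda>s. cls (s @ w @ q)) \<subset> range (\<lambda>s. cls (s @ q))"
    by blast
qed

text \<open>
  A common factorization of \<open>u\<close> and \<open>v\<close> at \<open>j\<close> letters \<open>b\<close> found greedily from the right, with
  blocks related by \<open>C\<close>.  The word \<open>q\<close> is the context to the right of \<open>v\<close>.
\<close>

inductive right_fac :: "('a list \<Rightarrow> 'a list \<Rightarrow> bool) \<Rightarrow> ('a list \<Rightarrow> 'a list \<Rightarrow> bool) \<Rightarrow> nat \<Rightarrow>
    'a list \<Rightarrow> 'a list \<Rightarrow> 'a list \<Rightarrow> bool" for C D where
  base: "C t t' \<Longrightarrow> D t t' \<Longrightarrow> L_stable t q \<Longrightarrow> L_stable t' q \<Longrightarrow> right_fac C D 0 q t t'"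
| step: "right_fac C D j (b # t' @ q) u v \<Longrightarrow> b \<notin> set t \<Longrightarrow> b \<notin> set t' \<Longrightarrow> C t t' \<Longrightarrow>
    D (u @ b # t) (v @ b # t') \<Longrightarrow> L_stable t q \<Longrightarrow> L_stable t' q \<Longrightarrow>
    right_fac C D (Suc j) q (u @ b # t) (v @ b # t')"

lemma right_fac_mono:
  assumes "right_fac C D j q u v" "\<And>u v. C u v \<Longrightarrow> C' u v" "\<And>u v. D u v \<Longrightarrow> D' u v"
  shows "right_fac C' D' j q u v"
  using assms(1)
proof induction
  case (base t t' q)
  then show ?case by (intro right_fac.base assms(2,3))
next
  case (step j b t' q u v t)
  show ?case
    by (rule right_fac.step[OF step.IH step.hyps(2,3) assms(2)[OF step.hyps(4)]
        assms(3)[OF step.hyps(5)] step.hyps(6,7)])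
qed

lemma right_fac_D: "right_fac C D j q u v \<Longrightarrow> D u v"
  by (erule right_fac.cases) simp_all

text \<open>A letter at which the \<L>-class drops in \<open>v\<close> is absent from the stable
  block to its right, so it is a last occurrence; its partner in \<open>u\<close> is the last
  occurrence there, which exists because the alphabets agree. Each cut lowers
  \<open>L_height\<close> and costs one unit, so \<open>l\<close> pays for all cuts and
  \<open>k\<close> remains for the blocks.\<close>

lemma L_rel_right_fac:
  assumes "L_height q \<le> l" "0 < k" "L_rel (Suc m) (k + l) u v"
  shows "\<exists>j\<le>l. right_fac (R_rel m k) (same_subseqs k) j q u v"
  using assms(1,3)
proof (induction l arbitrary: q u v)
  case 0
  then show ?case using L_height_pos[of q] by simp
next
  case (Suc l)
  have D: "same_subseqs k u v"
    using L_rel_same_subseqs[OF Suc.prems(2)] by (rule same_subseqs_mono) simp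
  show ?case
  proof (cases "L_stable v q")
    case True
    moreover have "L_stable u q" using L_stable_mono[OF True] L_rel_set[OF Suc.prems(2)] by auto
    moreover have "R_rel m k u v" by (rule R_rel_mono[OF L_rel_R_rel[OF Suc.prems(2)]]) simp
    ultimately have "right_fac (R_rel m k) (same_subseqs k) 0 q u v"
      using D by (intro right_fac.base)
    then show ?thesis by blast
  next
    case False
    obtain v0 b t' where v: "v = v0 @ b # t'" "L_stable t' q" "\<not> L_stable (b # t') q"
      by (rule L_unstable_split[OF False])
    have bt': "b \<notin> set t'" using L_stable_mono[OF v(2), of "b # t'"] v(3) by auto
    have "b \<in> set u" using L_rel_set[OF Suc.prems(2)] v by auto
    then obtain u0 t where u: "u = u0 @ b # t" "b \<notin> set t" by (meson split_list_last)
    have L: "L_rel (Suc m) (Suc (k + l)) (u0 @ b # t) (v0 @ b # t')"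
      using Suc.prems(2) u v by simp
    note cut = L_rel_cut[OF L u(2) bt']
    have "L_height (b # t' @ q) \<le> l"
      using L_height_less[OF v(3)] Suc.prems(1) by simp
    from Suc.IH[OF this cut(1)] obtain j where
      j: "j \<le> l" "right_fac (R_rel m k) (same_subseqs k) j (b # t' @ q) u0 v0" by auto
    have "R_rel m k t t'" by (rule R_rel_mono[OF L_rel_R_rel[OF cut(2)]]) simp
    moreover have "L_stable t q" using L_stable_mono[OF v(2)] L_rel_set[OF cut(2)] by auto
    ultimately have "right_fac (R_rel m k) (same_subseqs k) (Suc j) q u v"
      unfolding u(1) v(1) using D[unfolded u(1) v(1)] u(2) v(2) bt' by (intro right_fac.step[OF j(2)])
    then show ?thesis using j(1) by (intro exI[of _ "Suc j"]) simp
  qed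
qed

text \<open>Because the alphabets agree, the first \<open>a\<close> lies in corresponding places of
  both words: left of the cut letter \<open>b\<close>, at \<open>b\<close>, or inside the rightmost
  block. At most one block is broken and the number of cuts does not grow. The suffix keeps
  \<open>D'\<close> for later splits; the prefix is exchanged at once and therefore carries the
  trivial condition.\<close>

lemma right_fac_split:
  assumes "right_fac C D j q u v" "u = y @ a # u1" "v = y' @ a # v1" "a \<notin> set y" "a \<notin> set y'"
    and C: "\<And>t r t' r' a. C (t @ a # r) (t' @ a # r') \<Longrightarrow> a \<notin> set t \<Longrightarrow> a \<notin> set t' \<Longrightarrow> C' t t' \<and> C' r r'"
    and D: "\<And>t r t' r' a. D (t @ a # r) (t' @ a # r') \<Longrightarrow> a \<notin> set t \<Longrightarrow> a \<notin> set t' \<Longrightarrow> D' r r'"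
    and CC': "\<And>t t'. C t t' \<Longrightarrow> C' t t'"
    and D_set: "\<And>t t'. D t t' \<Longrightarrow> set t = set t'"
  shows "(\<exists>i\<le>j. right_fac C' (\<lambda>_ _. True) i (a # v1 @ q) y y') \<and> (\<exists>i\<le>j. right_fac C' D' i q u1 v1)"
  using assms(1-5)
proof (induction arbitrary: y u1 y' v1)
  case (base t t' q)
  have CD: "C' y y'" "C' u1 v1" "D' u1 v1" using base C D by auto
  have set: "set t = set t'" using D_set base by blast
  have "L_stable u1 q" "L_stable v1 q"
    by (rule L_stable_mono[OF base.hyps(4)]; use set base.prems in auto)+
  moreover have "L_stable y' ((a # v1) @ q)" "L_stable y ((a # v1) @ q)"
    by (rule L_stable_sub[OF base.hyps(4)]; use set base.prems in auto)+
  ultimately have "right_fac C' (\<lambda>_ _. True) 0 (a # v1 @ q) y y'" "right_fac C' D' 0 q u1 v1"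
    using CD right_fac.base[of C' _ _ "\<lambda>_ _. True"] right_fac.base[of C' _ _ D'] by auto
  then show ?case by blast
next
  case (step j b t' q u v t)
  note IH = step.IH[OF _ _ step.prems(3,4)]
  have set: "set (u @ b # t) = set (v @ b # t')" by (rule D_set[OF step.hyps(5)])
  have set': "set u = set v" by (rule D_set[OF right_fac_D[OF step.hyps(1)]])
  have mono: "right_fac C' (\<lambda>_ _. True) j (b # t' @ q) u v"
    by (rule right_fac_mono[OF step.hyps(1)]) (simp_all add: CC')
  have D': "D' u1 v1"
    using D[of y a u1 y' v1] step.hyps(5) step.prems by simp
  from step.prems(1,3) show ?case
  proof (cases rule: first_split_append)
    case (left p)
    note p = this
    from step.prems(2,4) show ?thesis
    proof (cases rule: first_split_append)
      case (left p')
      from IH[OF p(1) left(1)]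
      obtain i i' where i: "i \<le> j" "right_fac C' (\<lambda>_ _. True) i (a # p' @ b # t' @ q) y y'"
        and i': "i' \<le> j" "right_fac C' D' i' (b # t' @ q) p p'"
        by auto
      have "right_fac C' D' (Suc i') q u1 v1"
        using right_fac.step[OF i'(2) step.hyps(2,3) CC'[OF step.hyps(4)] _ step.hyps(6,7)] D'
        unfolding p left by blast
      moreover have "right_fac C' (\<lambda>_ _. True) i (a # v1 @ q) y y'" using i left by simp
      ultimately show ?thesis using le_SucI[OF i(1)] i'(1) Suc_le_mono by blast
    next
      case (right p')
      have "a \<in> set u" using p by simp
      then show ?thesis using right set' by simp
    qed
  next
    case (right p)
    note p = this
    have "a \<notin> set v" using set' p by simp
    with step.prems(2,4) obtain p' where p': "b # t' = p' @ a # v1" "y' = v @ p'"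
      by (elim first_split_append) auto
    show ?thesis
    proof (cases p)
      case Nil
      then have "p' = []" using p p' step.prems(4) by (cases p') auto
      with Nil have *: "a = b" "y = u" "y' = v" "u1 = t" "v1 = t'" using p p' by auto
      have "right_fac C' D' 0 q t t'"
        using CC'[OF step.hyps(4)] D' * step.hyps(6,7) by (intro right_fac.base) auto
      moreover have "right_fac C' (\<lambda>_ _. True) j (a # v1 @ q) y y'" using mono * by simp
      moreover have "j \<le> Suc j" by simp
      ultimately show ?thesis unfolding * by blast
    next
      case (Cons _ r)
      with p have r: "p = b # r" "t = r @ a # u1" by auto
      with p have "a \<noteq> b" "a \<notin> set r" using step.prems(3) by auto
      with p' obtain r' where r': "p' = b # r'" "t' = r' @ a # v1" by (cases p') auto
      have "a \<notin> set r'" using step.prems(4) p' r' by auto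
      have "C' r r'" "C' u1 v1"
        using C[of r a u1 r' v1] step.hyps(4) r r' \<open>a \<notin> set r\<close> \<open>a \<notin> set r'\<close> by auto
      \<comment> \<open>The alphabets of \<open>t\<close> and \<open>t'\<close> are not known to
        agree here, so stability is stated for \<open>t @ t'\<close>, which covers the letters of
        both.\<close>
      have L: "L_stable (t @ t') q" by (rule L_stable_union[OF step.hyps(6,7)])
      have "L_stable u1 q" "L_stable v1 q" by (rule L_stable_mono[OF L]; use r r' in auto)+
      then have 1: "right_fac C' D' 0 q u1 v1"
        using \<open>C' u1 v1\<close> D' by (intro right_fac.base)
      have "L_stable r ((a # v1) @ q)" "L_stable r' ((a # v1) @ q)"
        by (rule L_stable_sub[OF L]; use r r' in auto)+
      moreover have "right_fac C' (\<lambda>_ _. True) j (b # r' @ (a # v1 @ q)) u v"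
        using mono r' by simp
      ultimately have "right_fac C' (\<lambda>_ _. True) (Suc j) (a # v1 @ q) (u @ b # r) (v @ b # r')"
        using \<open>C' r r'\<close> step.hyps(2,3) r r' by (intro right_fac.step) auto
      then have "right_fac C' (\<lambda>_ _. True) (Suc j) (a # v1 @ q) y y'"
        using p p' r r' by simp
      then show ?thesis using 1 by blast
    qed
  qed
qed

text \<open>The rightmost block is exchanged first; the remaining words then stand in the context
  \<open>b # t' @ q\<close> that the factorization prescribes. All blocks consist of letters of
  \<open>y\<close> and \<open>y'\<close>, so \<open>R_stable p (y @ y')\<close> gives stability on
  their left. Each of the \<open>j\<close> cuts costs one unit of \<open>L_rel\<close>.\<close>

lemma right_fac_replace:
  assumes P: "\<And>w w' p q. R_rel m k w w' \<Longrightarrow> L_rel m k w w' \<Longrightarrow> R_stable p w \<Longrightarrow> R_stable p w' \<Longrightarrow>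
      L_stable w q \<Longrightarrow> L_stable w' q \<Longrightarrow> \<rho> (p @ w @ q) (p @ w' @ q)"
    and "right_fac (R_rel m k) D j q y y'" "L_rel m (k + j) y y'" "R_stable p (y @ y')"
  shows "\<rho> (p @ y @ q) (p @ y' @ q)"
  using assms(2-4)
proof induction
  case (base t t' q)
  have "R_stable p t" "R_stable p t'" by (rule R_stable_mono[OF base.prems(2)]; simp)+
  then show ?case using base by (intro P) auto
next
  case (step j b t' q u v t)
  have L: "L_rel m (Suc (k + j)) (u @ b # t) (v @ b # t')" using step.prems(1) by simp
  note cut = L_rel_cut[OF L step.hyps(2,3)]
  have "\<rho> ((p @ u @ [b]) @ t @ q) ((p @ u @ [b]) @ t' @ q)"
  proof (rule P)
    show "L_rel m k t t'" using cut(2) unfolding L_rel_def by (rule R_rel_mono) simp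
    show "R_stable (p @ u @ [b]) t" "R_stable (p @ u @ [b]) t'"
      by (rule R_stable_sub[OF step.prems(2)]; force)+
  qed (use step.hyps in auto)
  moreover have "\<rho> (p @ u @ (b # t' @ q)) (p @ v @ (b # t' @ q))"
    by (rule step.IH[OF cut(1)], rule R_stable_mono[OF step.prems(2)]) auto
  ultimately show ?case
    using trans[of "p @ u @ b # t @ q" "p @ u @ b # t' @ q" "p @ v @ b # t' @ q"] by simp
qed

text \<open>Induction on the bound \<open>i\<close> of \<open>R_height p\<close>; each step passes
  one letter of \<open>u\<close> at which the \<R>-class of the prefix drops. In
  \<open>k + h + i\<close>, the summand \<open>i\<close> pays for the cuts at these letters,
  \<open>h\<close> for the at most \<open>h\<close> cuts made by \<open>right_fac_replace\<close>,
  and \<open>k\<close> is what \<open>P\<close> demands.\<close>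

lemma R_L_rel_imp_in_context:
  assumes P: "\<And>w w' p q. R_rel m k w w' \<Longrightarrow> L_rel m k w w' \<Longrightarrow> R_stable p w \<Longrightarrow> R_stable p w' \<Longrightarrow>
      L_stable w q \<Longrightarrow> L_stable w' q \<Longrightarrow> \<rho> (p @ w @ q) (p @ w' @ q)"
    and "R_height p \<le> i" "R_rel (Suc m) (k + h + i) u v"
    and "right_fac (R_rel m (k + i)) (same_subseqs (Suc i)) j q u v" "j \<le> h"
  shows "\<rho> (p @ u @ q) (p @ v @ q)"
  using assms(2-5)
proof (induction i arbitrary: p u v j)
  case 0
  then show ?case using R_height_pos[of p] by simp
next
  case (Suc i)
  have replace: "\<rho> (p @ y @ q) (p @ y' @ q)"
    if "right_fac (R_rel m l) D j q y y'" "k \<le> l" "R_rel (Suc m) (k + h + i) y y'" "R_stable p y" "j \<le> h"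
    for l D j q y y'
  proof (rule right_fac_replace[OF P])
    show "right_fac (R_rel m k) D j q y y'"
      by (rule right_fac_mono[OF that(1)]) (auto intro: R_rel_mono[OF _ that(2)])
    have "L_rel m (k + h + i) y y'" by (rule R_rel_L_rel[OF that(3)])
    then show "L_rel m (k + j) y y'" unfolding L_rel_def by (rule R_rel_mono) (use that(5) in simp)
    show "R_stable p (y @ y')" using R_stable_mono[OF that(4)] R_rel_set[OF that(3)] by simp
  qed
  show ?case
  proof (cases "R_stable p u")
    case True
    have "R_rel (Suc m) (k + h + i) u v" by (rule R_rel_mono[OF Suc.prems(2)]) simp
    with replace[OF Suc.prems(3)] True Suc.prems(4) show ?thesis by simp
  next
    case False
    then obtain y a u1 where u: "u = y @ a # u1" "R_stable p y" "\<not> R_stable p (y @ [a])"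
      by (rule R_unstable_split)
    have ay: "a \<notin> set y" using R_stable_mono[OF u(2), of "y @ [a]"] u(3) by auto
    have "a \<in> set v" using R_rel_set[OF Suc.prems(2)] u(1) by auto
    then obtain y' v1 where v: "v = y' @ a # v1" "a \<notin> set y'" by (meson split_list_first)
    have "R_rel (Suc m) (Suc (k + h + i)) (y @ a # u1) (y' @ a # v1)"
      using Suc.prems(2) u(1) v(1) by simp
    note cut = R_rel_cut[OF this ay v(2)]
    have split: "(\<exists>l\<le>j. right_fac (R_rel m (k + i)) (\<lambda>_ _. True) l (a # v1 @ q) y y') \<and>
      (\<exists>l\<le>j. right_fac (R_rel m (k + i)) (same_subseqs (Suc i)) l q u1 v1)"
    proof (rule right_fac_split[OF Suc.prems(3) u(1) v(1) ay v(2)])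
      show "R_rel m (k + i) t t' \<and> R_rel m (k + i) r r'"
        if "R_rel m (k + Suc i) (t @ c # r) (t' @ c # r')" "c \<notin> set t" "c \<notin> set t'" for t r t' r' c
        using R_rel_cut[of m "k + i" t c r t' r'] that by simp
      show "R_rel m (k + i) t t'" if "R_rel m (k + Suc i) t t'" for t t'
        by (rule R_rel_mono[OF that]) simp
    qed (fact same_subseqs_cut same_subseqs_set)+
    then obtain l l' where l: "l \<le> j" "right_fac (R_rel m (k + i)) (\<lambda>_ _. True) l (a # v1 @ q) y y'"
      and l': "l' \<le> j" "right_fac (R_rel m (k + i)) (same_subseqs (Suc i)) l' q u1 v1" by blast
    \<comment> \<open>The chain passes through \<open>p @ y @ a # v1 @ q\<close>: the suffix is
      exchanged behind the prefix \<open>y\<close> of \<open>u\<close>, and \<open>y\<close> in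
      front of the suffix \<open>v1\<close> of \<open>v\<close>.\<close>
    have "\<rho> (p @ y @ (a # v1 @ q)) (p @ y' @ (a # v1 @ q))"
      by (rule replace[OF l(2) _ cut(1) u(2)]) (use l(1) Suc.prems(4) in auto)
    moreover have "\<rho> ((p @ y @ [a]) @ u1 @ q) ((p @ y @ [a]) @ v1 @ q)"
      by (rule Suc.IH[OF _ cut(2) l'(2)])
        (use R_height_less[OF u(3)] Suc.prems(1,4) l'(1) in auto)
    ultimately show ?thesis
      using trans[of "p @ y @ a # u1 @ q" "p @ y @ a # v1 @ q" "p @ y' @ a # v1 @ q"] u(1) v(1) by simp
  qed
qed

lemma R_L_rel_imp:
  assumes P: "\<And>w w' p q. R_rel m k w w' \<Longrightarrow> L_rel m k w w' \<Longrightarrow> R_stable p w \<Longrightarrow> R_stable p w' \<Longrightarrow>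
      L_stable w q \<Longrightarrow> L_stable w' q \<Longrightarrow> \<rho> (p @ w @ q) (p @ w' @ q)"
  shows "\<exists>n. \<forall>u v. R_rel (Suc m) n u v \<longrightarrow> L_rel (Suc m) n u v \<longrightarrow> \<rho> u v"
proof (intro exI allI impI)
  \<comment> \<open>The index bounds both heights. In the parameter of \<open>L_rel\<close>, one
    \<open>h\<close> pays for the cuts at \<L>-drops and the other for splitting at \<R>-drops; the
    successor provides \<open>same_subseqs (Suc h)\<close> also when \<open>k = 0\<close>.\<close>
  define h where "h = card (range cls)"
  fix u v :: "'a list" assume R: "R_rel (Suc m) (Suc (k + h + h)) u v" and L: "L_rel (Suc m) (Suc (k + h + h)) u v"
  have "L_height [] \<le> h" "R_height [] \<le> h" unfolding h_def by (rule L_height_le R_height_le)+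
  from L_rel_right_fac[OF this(1), of "Suc (k + h)" m u v] L
  obtain j where j: "j \<le> h" "right_fac (R_rel m (Suc (k + h))) (same_subseqs (Suc (k + h))) j [] u v"
    by auto
  have "right_fac (R_rel m (k + h)) (same_subseqs (Suc h)) j [] u v"
    by (rule right_fac_mono[OF j(2)]) (auto elim: R_rel_mono same_subseqs_mono)
  moreover have "R_rel (Suc m) (k + h + h) u v" by (rule R_rel_mono[OF R]) simp
  ultimately have "\<rho> ([] @ u @ []) ([] @ v @ [])"
    using \<open>R_height [] \<le> h\<close> j(1) by (intro R_L_rel_imp_in_context[OF P])
  then show "\<rho> u v" by simp
qed

end

section \<open>The identities of W on words\<close>

definition word_pow :: "nat \<Rightarrow> 'a list \<Rightarrow> 'a list" where
  "word_pow n w = concat (replicate n w)"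

lemma word_pow_0 [simp]: "word_pow 0 w = []"
  and word_pow_Suc: "word_pow (Suc n) w = w @ word_pow n w"
  by (simp_all add: word_pow_def)

lemma word_pow_add: "word_pow (m + n) w = word_pow m w @ word_pow n w"
  by (simp add: word_pow_def replicate_add)

lemma word_pow_mult: "word_pow m (word_pow n w) = word_pow (m * n) w"
  by (induction m) (simp_all add: word_pow_Suc word_pow_add)

lemma word_pow_shift: "word_pow n (u @ v) @ u = u @ word_pow n (v @ u)"
  by (induction n) (simp_all add: word_pow_Suc)

lemma word_pow_Suc2: "word_pow (Suc n) w = word_pow n w @ w"
  using word_pow_shift[of n w "[]"] by (simp add: word_pow_Suc)

lemma set_word_pow: "0 < n \<Longrightarrow> set (word_pow n w) = set w"
  by (simp add: word_pow_def)

text \<open>For an \<open>N\<close> such that all \<open>N\<close>-th powers are idempotent modulo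
  the congruence, \<open>N\<close>-th powers represent omega-powers, and identities of omega-terms
  become relations between words.\<close>

primrec word_ext :: "nat \<Rightarrow> ('v \<Rightarrow> 'a list) \<Rightarrow> 'v omega_term \<Rightarrow> 'a list" where
  "word_ext N \<sigma> TOne = []"
| "word_ext N \<sigma> (TVar x) = \<sigma> x"
| "word_ext N \<sigma> (u \<star> v) = word_ext N \<sigma> u @ word_ext N \<sigma> v"
| "word_ext N \<sigma> (TOmega u) = word_pow N (word_ext N \<sigma> u)"

abbreviation W_lhs :: "nat \<Rightarrow> variable omega_term" where
  "W_lhs m \<equiv> e_prod m \<star> zt \<star> f_prod m"

abbreviation W_rhs :: "nat \<Rightarrow> variable omega_term" where
  "W_rhs m \<equiv> e_prod m \<star> f_prod m"

primrec term_vars :: "'v omega_term \<Rightarrow> 'v set" where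
  "term_vars TOne = {}"
| "term_vars (TVar x) = {x}"
| "term_vars (u \<star> v) = term_vars u \<union> term_vars v"
| "term_vars (TOmega u) = term_vars u"

lemma word_ext_cong:
  "(\<And>x. x \<in> term_vars t \<Longrightarrow> \<sigma> x = \<tau> x) \<Longrightarrow> word_ext N \<sigma> t = word_ext N \<tau> t"
  by (induction t) auto

lemma term_vars_e_f_prod:
  "term_vars (e_prod m) \<subseteq> {Var_z} \<union> Var_x ` {..<m} \<union> Var_y ` {..<m} \<and>
   term_vars (f_prod m) \<subseteq> {Var_z} \<union> Var_x ` {..<m} \<union> Var_y ` {..<m}"
proof (induction m)
  case (Suc m)
  then show ?case by (cases m) auto
qed simp

lemma e_prod_Suc: "1 \<le> m \<Longrightarrow> e_prod (Suc m) = TOmega (W_lhs m \<star> xt m) \<star> e_prod m"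
  and f_prod_Suc: "1 \<le> m \<Longrightarrow> f_prod (Suc m) = f_prod m \<star> TOmega (yt m \<star> e_prod m \<star> zt \<star> f_prod m)"
  by (cases m; simp)+

text \<open>From level 2 on, \<open>z\<close> also occurs inside the omega-powers and hence on the
  right side; at level 1 the sides are \<open>z\<close> and \<open>1\<close>.\<close>

lemma set_word_ext_W:
  assumes "0 < N" "2 \<le> m"
  shows "set (word_ext N \<sigma> (W_lhs m)) = set (word_ext N \<sigma> (W_rhs m))"
proof -
  obtain k where "m = Suc k" "1 \<le> k" using assms(2) by (cases m) auto
  then show ?thesis using assms(1) by (auto simp: e_prod_Suc f_prod_Suc set_word_pow simp del: e_prod.simps f_prod.simps)
qed

section \<open>Absorption and letter-dependence derived from the identities\<close>

context word_congruence
begin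

definition satisfies_W :: "nat \<Rightarrow> nat \<Rightarrow> bool" where
  "satisfies_W N m \<longleftrightarrow> (\<forall>\<sigma>. \<rho> (word_ext N \<sigma> (W_lhs m)) (word_ext N \<sigma> (W_rhs m)))"

lemma R_fix_pow: "\<rho> (p @ w) p \<Longrightarrow> \<rho> (p @ word_pow n w) p"
proof (induction n)
  case (Suc n)
  have "\<rho> (p @ word_pow (Suc n) w) (p @ word_pow n w)"
    using compat_right[OF Suc.prems, of "word_pow n w"] by (simp add: word_pow_Suc)
  then show ?case using Suc trans by blast
qed (simp add: refl)

lemma L_fix_pow: "\<rho> (w @ q) q \<Longrightarrow> \<rho> (word_pow n w @ q) q"
proof (induction n)
  case (Suc n)
  have "\<rho> (word_pow (Suc n) w @ q) (word_pow n w @ q)"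
    using compat_left[OF Suc.prems, of "word_pow n w"] by (simp add: word_pow_Suc2)
  then show ?case using Suc trans by blast
qed (simp add: refl)

text \<open>With \<open>U\<close> the left side at level \<open>m\<close>, let
  \<open>p U s = p\<close> and \<open>t U q = q\<close>. The variables \<open>x_m\<close> and
  \<open>y_m\<close> do not occur at level \<open>m\<close>, so they may be sent to \<open>s\<close>
  and \<open>t\<close>. The new omega-powers become \<open>(U s)^N\<close> and
  \<open>(t U)^N\<close>, which are absorbed by \<open>p\<close> and by \<open>q\<close>.\<close>

lemma satisfies_W_Suc:
  assumes W: "satisfies_W N (Suc m)" and m: "1 \<le> m"
    and "R_stable p (word_ext N \<sigma> (W_lhs m))" "L_stable (word_ext N \<sigma> (W_lhs m)) q"
  shows "\<rho> (p @ word_ext N \<sigma> (W_lhs m) @ q) (p @ word_ext N \<sigma> (W_rhs m) @ q)"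
proof -
  define U where "U = word_ext N \<sigma> (W_lhs m)"
  define V where "V = word_ext N \<sigma> (W_rhs m)"
  obtain s t where s: "\<rho> (p @ (U @ s)) p" and t: "\<rho> ((t @ U) @ q) q"
    using assms(3,4) unfolding R_stable_def L_stable_def U_def by auto
  define \<tau> where "\<tau> = \<sigma>(Var_x m := s, Var_y m := t)"
  have ef: "word_ext N \<tau> (e_prod m) = word_ext N \<sigma> (e_prod m)"
    "word_ext N \<tau> (f_prod m) = word_ext N \<sigma> (f_prod m)"
    by (rule word_ext_cong; use term_vars_e_f_prod[of m] in \<open>auto simp: \<tau>_def\<close>)+
  have z: "\<tau> Var_z = \<sigma> Var_z" "\<tau> (Var_x m) = s" "\<tau> (Var_y m) = t" by (auto simp: \<tau>_def)
  have "\<rho> (word_ext N \<tau> (W_lhs (Suc m))) (word_ext N \<tau> (W_rhs (Suc m)))"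
    using W unfolding satisfies_W_def by blast
  then have "\<rho> (word_pow N (U @ s) @ U @ word_pow N (t @ U)) (word_pow N (U @ s) @ V @ word_pow N (t @ U))"
    unfolding e_prod_Suc[OF m] f_prod_Suc[OF m] word_ext.simps ef z U_def V_def by simp
  then have 1: "\<rho> (p @ (word_pow N (U @ s) @ U @ word_pow N (t @ U)) @ q)
      (p @ (word_pow N (U @ s) @ V @ word_pow N (t @ U)) @ q)"
    by (rule compat)
  have 2: "\<rho> (p @ (word_pow N (U @ s) @ w @ word_pow N (t @ U)) @ q) (p @ w @ q)" for w :: "'a list"
    using compat_append[OF R_fix_pow[OF s, of N] compat_left[OF L_fix_pow[OF t, of N], of w]] by simp
  have "\<rho> (p @ U @ q) (p @ V @ q)" by (rule trans[OF sym[OF 2[of U]] trans[OF 1 2[of V]]])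
  then show ?thesis unfolding U_def V_def .
qed

text \<open>With only two values left, each step of the recursion again produces powers of
  \<open>Z @ Y\<close> and of \<open>Y @ Z\<close>, as \<open>word_pow_shift\<close> moves the
  single \<open>Z\<close> or \<open>Y\<close> through a power. From level 2 on the exponents are
  positive, which the stability arguments rely on.\<close>

lemma word_ext_e_f_prod_pow:
  assumes "0 < N" "1 \<le> i"
  shows "\<exists>k k'. word_ext N (\<lambda>x. if x = Var_z then Z else Y) (e_prod i) = word_pow k (Z @ Y) \<and>
    word_ext N (\<lambda>x. if x = Var_z then Z else Y) (f_prod i) = word_pow k' (Y @ Z) \<and>
    (2 \<le> i \<longrightarrow> 0 < k \<and> 0 < k')"
  using assms(2)
proof (induction i rule: nat_induct_at_least)
  case base
  then show ?case by (intro exI[of _ 0]) simp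
next
  case (Suc i)
  let ?e = "word_ext N (\<lambda>x. if x = Var_z then Z else Y)"
  obtain k k' where k: "?e (e_prod i) = word_pow k (Z @ Y)" "?e (f_prod i) = word_pow k' (Y @ Z)"
    using Suc.IH by blast
  have 1: "word_pow k (Z @ Y) @ Z @ word_pow k' (Y @ Z) @ Y = word_pow (k + Suc k') (Z @ Y)"
    unfolding word_pow_add word_pow_Suc using word_pow_shift[of k' Y Z] by simp
  have 2: "Y @ word_pow k (Z @ Y) @ Z @ word_pow k' (Y @ Z) = word_pow (Suc k + k') (Y @ Z)"
    unfolding word_pow_add word_pow_Suc using word_pow_shift[of k Z Y] by simp
  have "?e (e_prod (Suc i)) = word_pow (N * (k + Suc k') + k) (Z @ Y)"
    using k 1 unfolding e_prod_Suc[OF Suc.hyps] word_pow_add word_pow_mult[symmetric] by simp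
  moreover have "?e (f_prod (Suc i)) = word_pow (k' + N * (Suc k + k')) (Y @ Z)"
    using k 2 unfolding f_prod_Suc[OF Suc.hyps] word_pow_add word_pow_mult[symmetric] by simp
  moreover have "0 < N * (k + Suc k') + k" "0 < k' + N * (Suc k + k')" using assms(1) by auto
  ultimately show ?case by blast
qed

lemma satisfies_W_pow:
  assumes "satisfies_W N m" "0 < N" "2 \<le> m"
  obtains k k' where "0 < k" "0 < k'"
    "\<rho> (word_pow k (Z @ Y) @ Z @ word_pow k' (Y @ Z)) (word_pow k (Z @ Y) @ word_pow k' (Y @ Z))"
proof -
  let ?\<sigma> = "\<lambda>x. if x = Var_z then Z else Y"
  have "1 \<le> m" using assms(3) by simp
  from word_ext_e_f_prod_pow[OF assms(2) this, of Z Y] assms(3) obtain k k' where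
    k: "word_ext N ?\<sigma> (e_prod m) = word_pow k (Z @ Y)" "word_ext N ?\<sigma> (f_prod m) = word_pow k' (Y @ Z)"
    "0 < k" "0 < k'" by blast
  have "\<rho> (word_ext N ?\<sigma> (W_lhs m)) (word_ext N ?\<sigma> (W_rhs m))"
    using assms(1) unfolding satisfies_W_def by blast
  then show ?thesis using that[OF k(3,4)] k(1,2) by simp
qed

text \<open>Let \<open>p Z Y s = p\<close>. Powers of \<open>Z Y s\<close> may be inserted after
  \<open>p\<close>, and the two-variable identity for \<open>Z\<close> and \<open>Y s\<close> then
  erases the isolated \<open>Z\<close>: \<open>p Z = p (Y s Z)^k'\<close>. As \<open>k' > 0\<close>,
  multiplication by \<open>Y s\<close> gives \<open>p = p Y ...\<close>.\<close>

lemma R_stable_suffix: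
  assumes W: "satisfies_W N m" "0 < N" "2 \<le> m" and "R_stable p (Z @ Y)"
  shows "R_stable p Y"
proof -
  obtain s where s: "\<rho> (p @ Z @ Y @ s) p" using assms(4) unfolding R_stable_def by auto
  obtain k k' where k: "0 < k'" "\<rho> (word_pow k (Z @ Y @ s) @ Z @ word_pow k' ((Y @ s) @ Z))
      (word_pow k (Z @ Y @ s) @ word_pow k' ((Y @ s) @ Z))"
    by (rule satisfies_W_pow[OF W, of Z "Y @ s"]) simp
  obtain k'' where k'': "k' = Suc k''" using k(1) by (cases k') auto
  have "\<rho> (p @ word_pow (k + k') (Z @ Y @ s) @ Z) (p @ Z)"
    using compat_right[OF R_fix_pow[OF s, of "k + k'"], of Z] by simp
  moreover have "p @ word_pow (k + k') (Z @ Y @ s) @ Z =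
      p @ word_pow k (Z @ Y @ s) @ Z @ word_pow k' ((Y @ s) @ Z)"
    using word_pow_shift[of k' Z "Y @ s"] by (simp add: word_pow_add)
  ultimately have "\<rho> (p @ Z) (p @ word_pow k (Z @ Y @ s) @ Z @ word_pow k' ((Y @ s) @ Z))"
    using sym by metis
  also have "\<rho> \<dots> (p @ word_pow k (Z @ Y @ s) @ word_pow k' ((Y @ s) @ Z))"
    by (rule compat_left[OF k(2)])
  also have "\<rho> \<dots> (p @ word_pow k' ((Y @ s) @ Z))"
    using compat_right[OF R_fix_pow[OF s, of k], of "word_pow k' ((Y @ s) @ Z)"] by simp
  finally have "\<rho> (p @ Z) (p @ Y @ s @ Z @ word_pow k'' ((Y @ s) @ Z))"
    using k'' by (simp add: word_pow_Suc)
  from compat_right[OF this, of "Y @ s"] s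
  have "\<rho> p (p @ Y @ (s @ Z @ word_pow k'' ((Y @ s) @ Z) @ Y @ s))"
    using trans[OF sym[OF s]] by simp
  then show ?thesis unfolding R_stable_def using sym by blast
qed

lemma L_stable_prefix:
  assumes W: "satisfies_W N m" "0 < N" "2 \<le> m" and "L_stable (Y @ Z) q"
  shows "L_stable Y q"
proof -
  obtain s where s: "\<rho> (((s @ Y) @ Z) @ q) q" using assms(4) unfolding L_stable_def by auto
  obtain k k' where k: "0 < k" "\<rho> (word_pow k (Z @ s @ Y) @ Z @ word_pow k' ((s @ Y) @ Z))
      (word_pow k (Z @ s @ Y) @ word_pow k' ((s @ Y) @ Z))"
    by (rule satisfies_W_pow[OF W, of Z "s @ Y"]) simp
  obtain k'' where k'': "k = Suc k''" using k(1) by (cases k) auto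
  have "\<rho> (Z @ word_pow (k + k') ((s @ Y) @ Z) @ q) (Z @ q)"
    by (rule compat_left[OF L_fix_pow[OF s]])
  moreover have "Z @ word_pow (k + k') ((s @ Y) @ Z) @ q =
      (word_pow k (Z @ s @ Y) @ Z @ word_pow k' ((s @ Y) @ Z)) @ q"
    using word_pow_shift[of k Z "s @ Y"] by (simp add: word_pow_add flip: append_assoc)
  ultimately have "\<rho> (Z @ q) ((word_pow k (Z @ s @ Y) @ Z @ word_pow k' ((s @ Y) @ Z)) @ q)"
    using sym by metis
  also have "\<rho> \<dots> ((word_pow k (Z @ s @ Y) @ word_pow k' ((s @ Y) @ Z)) @ q)"
    by (rule compat_right[OF k(2)])
  also have "\<rho> \<dots> (word_pow k (Z @ s @ Y) @ q)"
    using compat_left[OF L_fix_pow[OF s, of k'], of "word_pow k (Z @ s @ Y)"] by simp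
  finally have "\<rho> (Z @ q) ((word_pow k'' (Z @ s @ Y) @ Z @ s) @ Y @ q)"
    using k'' by (simp add: word_pow_Suc2)
  from compat_left[OF this, of "s @ Y"]
  have "\<rho> q ((s @ Y @ word_pow k'' (Z @ s @ Y) @ Z @ s) @ Y @ q)"
    using trans[OF sym[OF s]] by simp
  then show ?thesis unfolding L_stable_def using sym by blast
qed

text \<open>By \<open>R_stable_suffix\<close> and prefix closure, every letter \<open>a\<close> of
  \<open>w\<close> is stable at \<open>p\<close>. If \<open>s\<close> leads back from
  \<open>p a\<close> to \<open>p\<close>, then \<open>s w\<close> is stable at \<open>p a\<close>,
  and so is its suffix \<open>w\<close>; hence the next letter of \<open>x\<close> can be treated at
  \<open>p a\<close> in the same way.\<close>

lemma R_stable_letters: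
  assumes W: "satisfies_W N m" "0 < N" "2 \<le> m"
  shows "R_stable p w \<Longrightarrow> set x \<subseteq> set w \<Longrightarrow> R_stable p x"
proof (induction x arbitrary: p)
  case Nil
  then show ?case using R_stable_Nil by simp
next
  case (Cons a x)
  then obtain w1 w2 where w: "w = w1 @ a # w2" by (metis list.set_intros(1) split_list subsetD)
  have "R_stable p ([a] @ w2)" using R_stable_suffix[OF W, of p w1 "a # w2"] Cons.prems(1) w by simp
  then have a: "R_stable p [a]" unfolding R_stable_append by blast
  then obtain s where s: "\<rho> (p @ [a] @ s) p" unfolding R_stable_def by blast
  have "R_stable (p @ [a] @ s) w" by (rule R_stable_cong[OF sym[OF s] Cons.prems(1)])
  moreover have "R_stable (p @ [a]) s"
    unfolding R_stable_def using compat_right[OF s, of "[a]"] by auto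
  ultimately have "R_stable (p @ [a]) (s @ w)" unfolding R_stable_append by simp
  then have "R_stable (p @ [a]) w" by (rule R_stable_suffix[OF W])
  then have "R_stable (p @ [a]) x" using Cons by simp
  then show ?case using a R_stable_append[of p "[a]" x] by simp
qed

lemma L_stable_letters:
  assumes W: "satisfies_W N m" "0 < N" "2 \<le> m"
  shows "L_stable w q \<Longrightarrow> set x \<subseteq> set w \<Longrightarrow> L_stable x q"
proof (induction x arbitrary: q rule: rev_induct)
  case Nil
  then show ?case using L_stable_Nil by simp
next
  case (snoc a x)
  then obtain w1 w2 where w: "w = (w1 @ [a]) @ w2"
    by (metis append.assoc append_Cons append_Nil in_set_conv_decomp le_sup_iff list.set_intros(1) set_append split_list subsetD)
  have "L_stable (w1 @ [a]) q" using L_stable_prefix[OF W, of "w1 @ [a]" w2] snoc.prems(1) w by simp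
  then have a: "L_stable [a] q" unfolding L_stable_append by blast
  then obtain s where s: "\<rho> (s @ [a] @ q) q" unfolding L_stable_def by blast
  have "L_stable w (s @ [a] @ q)" by (rule L_stable_cong[OF sym[OF s] snoc.prems(1)])
  moreover have "L_stable s ([a] @ q)"
    unfolding L_stable_def using compat_left[OF s, of "[a]"] by (auto intro: exI[of _ "[a]"])
  ultimately have "L_stable (w @ s) ([a] @ q)" unfolding L_stable_append by simp
  then have "L_stable w ([a] @ q)" by (rule L_stable_prefix[OF W])
  then have "L_stable x ([a] @ q)" using snoc by simp
  then show ?case using a L_stable_append[of x "[a]" q] by simp
qed

end

section \<open>Descent from one level of the identities to the preceding one\<close>

locale W_congruence = word_congruence +
  fixes N m :: nat
  assumes finite_cls: "finite (range cls)"
    and N_pos: "0 < N"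
    and pow_idem: "\<rho> (word_pow N w @ word_pow N w) (word_pow N w)"
    and m_pos: "1 \<le> m"
    and satisfies_W: "satisfies_W N (Suc m)"
begin

sublocale DA_congruence
proof
  \<comment> \<open>The locale fixes the identity of level \<open>Suc m\<close> with
    \<open>m \<ge> 1\<close>, which puts it in the range where the two-variable identity has
    positive exponents.\<close>
  have m: "2 \<le> Suc m" using m_pos by simp
  show "R_stable p w \<Longrightarrow> set x \<subseteq> set w \<Longrightarrow> R_stable p x" for p w x
    by (rule R_stable_letters[OF satisfies_W N_pos m])
  show "L_stable w q \<Longrightarrow> set x \<subseteq> set w \<Longrightarrow> L_stable x q" for q w x
    by (rule L_stable_letters[OF satisfies_W N_pos m])
qed (fact finite_cls)

text \<open>A simultaneous form of \<open>sim_K\<close> and \<open>sim_D\<close>, with arbitrary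
  contexts \<open>p\<close> and \<open>q\<close> instead of idempotents. The disjunction makes
  symmetry immediate; that stability in fact passes between related words is the content of
  \<open>ctx_rel_R_stable\<close> and its dual.\<close>

definition ctx_rel :: "'a list \<Rightarrow> 'a list \<Rightarrow> bool" where
  "ctx_rel u v \<longleftrightarrow> (\<forall>p q. (R_stable p u \<and> L_stable u q) \<or> (R_stable p v \<and> L_stable v q) \<longrightarrow>
     \<rho> (p @ u @ q) (p @ v @ q))"

lemma ctx_rel_sym: "ctx_rel u v \<Longrightarrow> ctx_rel v u"
  unfolding ctx_rel_def using sym by blast

text \<open>The relation says something only about pairs of contexts, so a right context has to be
  produced from the left one. If \<open>p u s = p\<close>, the idempotent power \<open>q\<close> of
  \<open>s u\<close> will do: \<open>u q\<close> is \<L>-equivalent to \<open>q\<close>, hence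
  \<open>p u q = p v q\<close>, and \<open>p v q s = p u q s = p (u s)^(N + 1) = p\<close>.\<close>

lemma ctx_rel_R_stable:
  assumes uv: "ctx_rel u v" and "R_stable p u"
  shows "R_stable p v"
proof -
  obtain s where s: "\<rho> (p @ (u @ s)) p" using assms(2) unfolding R_stable_def by auto
  obtain M where N: "N = Suc M" using N_pos by (cases N) auto
  define q where "q = word_pow N (s @ u)"
  have "\<rho> ((q @ word_pow M (s @ u) @ s) @ u @ q) q"
  proof -
    have "(word_pow M (s @ u) @ s) @ u @ q = q @ q" unfolding q_def N by (simp add: word_pow_Suc2)
    then have "(q @ word_pow M (s @ u) @ s) @ u @ q = q @ (q @ q)" by simp
    then show ?thesis
      using trans[OF compat_left[OF pow_idem] pow_idem] unfolding q_def by metis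
  qed
  then have "L_stable u q" unfolding L_stable_def by blast
  then have "\<rho> (p @ u @ q) (p @ v @ q)" using uv assms(2) unfolding ctx_rel_def by blast
  then have 1: "\<rho> (p @ v @ (q @ s)) (p @ u @ q @ s)" using compat_right[of _ _ s] sym by fastforce
  have "p @ u @ q @ s = p @ word_pow (Suc N) (u @ s)"
    unfolding q_def using word_pow_shift[of N u s] by (simp add: word_pow_Suc2)
  then have "\<rho> (p @ u @ q @ s) p" using R_fix_pow[OF s] by metis
  with 1 show ?thesis unfolding R_stable_def using trans by blast
qed

lemma ctx_rel_L_stable:
  assumes uv: "ctx_rel u v" and "L_stable u q"
  shows "L_stable v q"
proof -
  obtain s where s: "\<rho> ((s @ u) @ q) q" using assms(2) unfolding L_stable_def by auto
  obtain M where N: "N = Suc M" using N_pos by (cases N) auto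
  define p where "p = word_pow N (u @ s)"
  have "\<rho> (p @ u @ (s @ word_pow M (u @ s) @ p)) p"
  proof -
    have "p @ u @ (s @ word_pow M (u @ s) @ p) = p @ (p @ p)" unfolding p_def N by (simp add: word_pow_Suc)
    then show ?thesis
      using trans[OF compat_left[OF pow_idem] pow_idem] unfolding p_def by metis
  qed
  then have "R_stable p u" unfolding R_stable_def by blast
  then have "\<rho> (p @ u @ q) (p @ v @ q)" using uv assms(2) unfolding ctx_rel_def by blast
  then have 1: "\<rho> ((s @ p) @ v @ q) (s @ p @ u @ q)" using compat_left[of _ _ s] sym by fastforce
  have "s @ p @ u @ q = word_pow (Suc N) (s @ u) @ q"
    unfolding p_def using word_pow_shift[of N s u] word_pow_shift[of N u s] by (simp add: word_pow_Suc)
  then have "\<rho> (s @ p @ u @ q) q" using L_fix_pow[OF s] by metis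
  with 1 show ?thesis unfolding L_stable_def using trans by blast
qed

text \<open>The equalities are chained through \<open>v\<close>, for which stability must first be
  carried over from \<open>u\<close> or from \<open>w\<close>.\<close>

lemma ctx_rel_trans:
  assumes uv: "ctx_rel u v" and vw: "ctx_rel v w"
  shows "ctx_rel u w"
  unfolding ctx_rel_def
proof (intro allI impI)
  fix p q assume "(R_stable p u \<and> L_stable u q) \<or> (R_stable p w \<and> L_stable w q)"
  then have "R_stable p v \<and> L_stable v q"
    using ctx_rel_R_stable ctx_rel_L_stable uv ctx_rel_sym[OF vw] by blast
  then have "\<rho> (p @ u @ q) (p @ v @ q)" "\<rho> (p @ v @ q) (p @ w @ q)"
    using uv vw unfolding ctx_rel_def by blast+
  then show "\<rho> (p @ u @ q) (p @ w @ q)" using trans by blast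
qed

lemma ctx_rel_compat:
  assumes "ctx_rel u v" shows "ctx_rel (x @ u @ y) (x @ v @ y)"
  unfolding ctx_rel_def
proof (intro allI impI)
  fix p q
  assume *: "(R_stable p (x @ u @ y) \<and> L_stable (x @ u @ y) q) \<or> (R_stable p (x @ v @ y) \<and> L_stable (x @ v @ y) q)"
  have "R_stable (p @ x) w \<and> L_stable w (y @ q)" if "R_stable p (x @ w @ y) \<and> L_stable (x @ w @ y) q" for w
    using that by (simp add: R_stable_append L_stable_append)
  with * assms have "\<rho> ((p @ x) @ u @ (y @ q)) ((p @ x) @ v @ (y @ q))"
    unfolding ctx_rel_def by blast
  then show "\<rho> (p @ (x @ u @ y) @ q) (p @ (x @ v @ y) @ q)" by simp
qed

lemma ctx_rel_of: "\<rho> u v \<Longrightarrow> ctx_rel u v"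
  unfolding ctx_rel_def using compat by blast

text \<open>\<open>satisfies_W_Suc\<close> requires the left side of the identity to be stable. If
  it is the right side that is stable, the equal alphabets at level at least 2 transfer this. Finite
  index is inherited because \<rho> is contained in \<open>ctx_rel\<close>.\<close>

lemma ctx_rel_W_congruence:
  assumes "m = Suc k" "1 \<le> k"
  shows "W_congruence ctx_rel N k"
proof -
  interpret c: word_congruence ctx_rel
    by standard (use ctx_rel_of refl ctx_rel_sym ctx_rel_trans ctx_rel_compat in blast)+
  show ?thesis
  proof unfold_locales
    have "c.cls u = {v. \<exists>x\<in>cls u. ctx_rel x v}" for u
      unfolding c.cls_def cls_def using ctx_rel_of refl ctx_rel_trans by blast
    then have "range c.cls = (\<lambda>S. {v. \<exists>x\<in>S. ctx_rel x v}) ` range cls"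
      unfolding image_image by simp
    then show "finite (range c.cls)" using finite_cls by simp
    show "ctx_rel (word_pow N w @ word_pow N w) (word_pow N w)" for w
      by (rule ctx_rel_of[OF pow_idem])
    show "c.satisfies_W N (Suc k)"
      unfolding c.satisfies_W_def
    proof
      fix \<sigma> :: "variable \<Rightarrow> 'a list"
      let ?U = "word_ext N \<sigma> (W_lhs (Suc k))" and ?V = "word_ext N \<sigma> (W_rhs (Suc k))"
      have set: "set ?U = set ?V" by (rule set_word_ext_W[OF N_pos]) (use assms in simp)
      have W: "satisfies_W N (Suc (Suc k))" using satisfies_W assms by simp
      show "ctx_rel ?U ?V"
        unfolding ctx_rel_def
      proof (intro allI impI)
        fix p q assume "(R_stable p ?U \<and> L_stable ?U q) \<or> (R_stable p ?V \<and> L_stable ?V q)"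
        then have "R_stable p ?U" "L_stable ?U q"
          using R_stable_mono[of p ?V ?U] L_stable_mono[of ?V q ?U] set by blast+
        then show "\<rho> (p @ ?U @ q) (p @ ?V @ q)"
          by (intro satisfies_W_Suc[OF W]) simp
      qed
    qed
  qed (use N_pos assms in auto)
qed

end

theorem W_congruence_R_L_rel:
  "W_congruence \<rho> N m \<Longrightarrow> \<exists>n. \<forall>u v. R_rel m n u v \<longrightarrow> L_rel m n u v \<longrightarrow> \<rho> u v"
proof (induction m arbitrary: \<rho>)
  case 0
  then interpret W_congruence \<rho> N 0 .
  show ?case using m_pos by simp
next
  case (Suc m)
  then interpret W_congruence \<rho> N "Suc m" by simp
  show ?case
  proof (cases m)
    case 0
    \<comment> \<open>At level 1 the sides of the identity are \<open>z\<close> and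
      \<open>1\<close>, so every block stable on both sides can be deleted. Any two such blocks are
      therefore interchangeable, and the trivial relation \<open>R_rel 0 0\<close> on blocks
      suffices.\<close>
    have "\<rho> (p @ w @ q) (p @ q)" if "R_stable p w" "L_stable w q" for p w q
      using satisfies_W_Suc[of N 1 p "\<lambda>_. w" q] satisfies_W 0 that by (simp add: numeral_2_eq_2)
    then have "\<rho> (p @ w @ q) (p @ w' @ q)"
      if "R_stable p w" "L_stable w q" "R_stable p w'" "L_stable w' q" for p w w' q
      using trans[OF _ sym] that by blast
    then show ?thesis unfolding 0 by (intro R_L_rel_imp[of 0 0])
  next
    case (Suc k)
    then have "W_congruence ctx_rel N m" by (intro ctx_rel_W_congruence) auto
    then obtain n where n: "\<And>u v. R_rel m n u v \<Longrightarrow> L_rel m n u v \<Longrightarrow> ctx_rel u v"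
      using Suc.IH by blast
    show ?thesis
      by (rule R_L_rel_imp[of m n]) (use n in \<open>auto simp: ctx_rel_def\<close>)
  qed
qed

section \<open>Identities in finite monoids\<close>

lemma monoid_homsI:
  assumes "\<And>x. x \<in> carrier M \<Longrightarrow> h x \<in> carrier N"
    "\<And>x y. x \<in> carrier M \<Longrightarrow> y \<in> carrier M \<Longrightarrow> h (x \<otimes>\<^bsub>M\<^esub> y) = h x \<otimes>\<^bsub>N\<^esub> h y"
    "h \<one>\<^bsub>M\<^esub> = \<one>\<^bsub>N\<^esub>"
  shows "h \<in> monoid_homs M N"
  using assms unfolding monoid_homs_def hom_def by auto

lemma monoid_homsD:
  assumes "h \<in> monoid_homs M N"
  shows "x \<in> carrier M \<Longrightarrow> h x \<in> carrier N"
    "x \<in> carrier M \<Longrightarrow> y \<in> carrier M \<Longrightarrow> h (x \<otimes>\<^bsub>M\<^esub> y) = h x \<otimes>\<^bsub>N\<^esub> h y"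
    "h \<one>\<^bsub>M\<^esub> = \<one>\<^bsub>N\<^esub>"
  using assms unfolding monoid_homs_def hom_def by auto

lemma monoid_homs_compose:
  "h \<in> monoid_homs M N \<Longrightarrow> k \<in> monoid_homs N P \<Longrightarrow> (\<lambda>x. k (h x)) \<in> monoid_homs M P"
  by (auto intro!: monoid_homsI simp: monoid_homsD)

lemma monoid_homs_pow:
  assumes "h \<in> monoid_homs M N" "monoid M" "x \<in> carrier M"
  shows "h (x [^]\<^bsub>M\<^esub> (k::nat)) = h x [^]\<^bsub>N\<^esub> k"
  using assms by (induction k) (auto simp: monoid.nat_pow_0 nat_pow_def monoid_homsD monoid.nat_pow_closed[unfolded nat_pow_def])

lemma monoid_homs_idempotent:
  "h \<in> monoid_homs M N \<Longrightarrow> idempotent M e \<Longrightarrow> idempotent N (h e)"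
  unfolding idempotent_def by (metis monoid_homsD(1,2))

lemma (in monoid) idempotent_pow:
  assumes "idempotent G e" "0 < (k::nat)" shows "e [^] k = e"
  using assms(2)
proof (induction k)
  case (Suc k)
  show ?case
  proof (cases "k = 0")
    case True
    then show ?thesis using assms(1) by (simp add: idempotent_def)
  next
    case False
    then show ?thesis using Suc assms(1) by (simp add: idempotent_def)
  qed
qed simp

lemma (in monoid) exists_idempotent_pow:
  assumes fin: "finite (carrier G)" and x: "x \<in> carrier G"
  shows "\<exists>k>0. idempotent G (x [^] (k::nat))"
proof -
  have "\<not> inj (\<lambda>k::nat. x [^] k)"
  proof
    assume "inj (\<lambda>k::nat. x [^] k)"
    moreover have "finite (range (\<lambda>k::nat. x [^] k))" by (rule finite_subset[OF _ fin]) (use x in auto)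
    ultimately show False using finite_imageD infinite_UNIV_nat by blast
  qed
  then obtain i0 j0 :: nat where ij0: "i0 \<noteq> j0" "x [^] i0 = x [^] j0" unfolding inj_def by blast
  obtain i d :: nat where d: "0 < d" "x [^] i = x [^] (i + d)"
  proof (cases "i0 < j0")
    case True
    then show ?thesis using that[of "j0 - i0" i0] ij0(2) by simp
  next
    case False
    then show ?thesis using that[of "i0 - j0" j0] ij0 by simp
  qed
  have 1: "x [^] (i + l) = x [^] (i + d * t + l)" for l t
  proof (induction t)
    case (Suc t)
    have "x [^] (i + d * Suc t + l) = x [^] (i + d) \<otimes> x [^] (d * t + l)"
      using x by (simp add: nat_pow_mult algebra_simps)
    also have "\<dots> = x [^] (i + d * t + l)"
      using x d(2)[symmetric] by (simp add: nat_pow_mult algebra_simps)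
    finally show ?case using Suc by simp
  qed simp
  \<comment> \<open>A multiple of the period \<open>d\<close> that is at least \<open>i\<close>, so
    that doubling it only adds whole periods.\<close>
  let ?k = "d * (i + 1)"
  have "i \<le> ?k" using d(1) by (cases d) auto
  have "x [^] ?k \<otimes> x [^] ?k = x [^] (?k + ?k)" using x by (simp add: nat_pow_mult)
  also have "?k + ?k = i + d * (i + 1) + (?k - i)" using \<open>i \<le> ?k\<close> by simp
  also have "x [^] \<dots> = x [^] ?k" using 1[of "?k - i" "i + 1"] \<open>i \<le> ?k\<close> by simp
  finally have "idempotent G (x [^] ?k)" using x by (simp add: idempotent_def)
  moreover have "0 < ?k" using d(1) by simp
  ultimately show ?thesis by blast
qed

lemma (in monoid) exists_exponent:
  assumes fin: "finite (carrier G)"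
  obtains N :: nat where "0 < N" "\<And>x. x \<in> carrier G \<Longrightarrow> idempotent G (x [^] N)"
proof -
  obtain k :: "'a \<Rightarrow> nat" where k: "\<And>x. x \<in> carrier G \<Longrightarrow> 0 < k x \<and> idempotent G (x [^] k x)"
    using exists_idempotent_pow[OF fin] by metis
  define N where "N = (\<Prod>x\<in>carrier G. k x)"
  have N: "0 < N" unfolding N_def by (rule prod_pos) (use k in auto)
  have "idempotent G (x [^] N)" if "x \<in> carrier G" for x
  proof -
    have "k x dvd N" unfolding N_def using fin that by (rule dvd_prodI)
    then obtain l where l: "N = k x * l" by (elim dvdE)
    then have "0 < l" using N by (cases l) auto
    have "x [^] N = (x [^] k x) [^] l" using that l by (simp add: nat_pow_pow)
    also have "\<dots> = x [^] k x" using idempotent_pow k[OF that] \<open>0 < l\<close> by blast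
    finally show ?thesis using k[OF that] by simp
  qed
  with N show ?thesis by (rule that)
qed

section \<open>Omega-powers and their behaviour under homomorphisms\<close>

lemma (in monoid) omega_power_eq:
  assumes x: "x \<in> carrier G" and k: "0 < (k::nat)" "idempotent G (x [^] k)"
  shows "omega_power G x = x [^] k"
  unfolding omega_power_def
proof (rule the_equality)
  show "idempotent G (x [^] k) \<and> (\<exists>l::nat>0. x [^] k = x [^] l)" using k by blast
next
  fix e assume e: "idempotent G e \<and> (\<exists>l::nat>0. e = x [^] l)"
  then obtain l :: nat where l: "0 < l" "e = x [^] l" by blast
  have "e = e [^] k" using idempotent_pow e k(1) by simp
  also have "\<dots> = (x [^] k) [^] l" using x l by (simp add: nat_pow_pow mult.commute)
  also have "\<dots> = x [^] k" using idempotent_pow k(2) l(1) by simp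
  finally show "e = x [^] k" .
qed

lemma (in monoid) omega_power_idempotent:
  assumes "finite (carrier G)" "x \<in> carrier G"
  shows "idempotent G (omega_power G x)"
  using exists_idempotent_pow[OF assms] omega_power_eq[OF assms(2)] by metis

lemma (in monoid) omega_power_closed:
  "finite (carrier G) \<Longrightarrow> x \<in> carrier G \<Longrightarrow> omega_power G x \<in> carrier G"
  using omega_power_idempotent by (simp add: idempotent_def)

lemma omega_power_hom:
  assumes h: "h \<in> monoid_homs M N" and M: "monoid M" "finite (carrier M)" and N: "monoid N"
    and x: "x \<in> carrier M"
  shows "omega_power N (h x) = h (omega_power M x)"
proof -
  obtain k :: nat where k: "0 < k" "idempotent M (x [^]\<^bsub>M\<^esub> k)"
    using monoid.exists_idempotent_pow[OF M x] by blast
  have "h (x [^]\<^bsub>M\<^esub> k) = h x [^]\<^bsub>N\<^esub> k" by (rule monoid_homs_pow[OF h M(1) x])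
  then show ?thesis
    using monoid.omega_power_eq[OF M(1) x k] monoid.omega_power_eq[OF N monoid_homsD(1)[OF h x] k(1)]
      monoid_homs_idempotent[OF h k(2)] by simp
qed

section \<open>Evaluation of words and omega-terms\<close>

lemma free_monoid_simps [simp]:
  "carrier free_monoid = UNIV" "x \<otimes>\<^bsub>free_monoid\<^esub> y = x @ y" "\<one>\<^bsub>free_monoid\<^esub> = []"
  by (simp_all add: free_monoid_def)

lemma free_homD:
  assumes "\<phi> \<in> monoid_homs free_monoid M"
  shows "\<phi> w \<in> carrier M" "\<phi> (u @ v) = \<phi> u \<otimes>\<^bsub>M\<^esub> \<phi> v" "\<phi> [] = \<one>\<^bsub>M\<^esub>"
  using monoid_homsD[OF assms] by auto

lemma omega_ext_closed:
  assumes "\<phi> \<in> monoid_homs free_monoid M" "monoid M" "finite (carrier M)"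
  shows "omega_ext M \<phi> t \<in> carrier M"
  using assms
  by (induction t) (auto simp: free_homD monoid.omega_power_closed monoid.m_closed monoid.one_closed)

lemma omega_ext_hom:
  assumes h: "h \<in> monoid_homs M N" and M: "monoid M" "finite (carrier M)" and N: "monoid N"
    and \<phi>: "\<phi> \<in> monoid_homs free_monoid M"
  shows "omega_ext N (\<lambda>w. h (\<phi> w)) t = h (omega_ext M \<phi> t)"
  by (induction t) (simp_all add: monoid_homsD[OF h] omega_ext_closed[OF \<phi> M] omega_power_hom[OF h M N])

definition word_eval :: "('a, 'c) monoid_scheme \<Rightarrow> ('v \<Rightarrow> 'a) \<Rightarrow> 'v list \<Rightarrow> 'a" where
  "word_eval M \<sigma> w = foldr (\<lambda>x y. \<sigma> x \<otimes>\<^bsub>M\<^esub> y) w \<one>\<^bsub>M\<^esub>"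

lemma word_eval_simps [simp]:
  "word_eval M \<sigma> [] = \<one>\<^bsub>M\<^esub>" "word_eval M \<sigma> (x # w) = \<sigma> x \<otimes>\<^bsub>M\<^esub> word_eval M \<sigma> w"
  by (simp_all add: word_eval_def)

lemma word_eval_hom:
  assumes "monoid M" "\<And>x. \<sigma> x \<in> carrier M"
  shows "word_eval M \<sigma> \<in> monoid_homs free_monoid M"
proof -
  interpret monoid M by fact
  have c: "word_eval M \<sigma> w \<in> carrier M" for w by (induction w) (auto simp: assms)
  have "word_eval M \<sigma> (u @ v) = word_eval M \<sigma> u \<otimes>\<^bsub>M\<^esub> word_eval M \<sigma> v" for u v
    by (induction u) (auto simp: assms c m_assoc)
  then show ?thesis using c by (auto intro!: monoid_homsI)
qed

lemma free_hom_eq_word_eval: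
  assumes "monoid M" "\<phi> \<in> monoid_homs free_monoid M"
  shows "\<phi> w = word_eval M (\<lambda>x. \<phi> [x]) w"
proof (induction w)
  case (Cons x w)
  then show ?case using free_homD(2)[OF assms(2), of "[x]" w] by simp
qed (simp add: free_homD[OF assms(2)])

lemma satisfies_iff:
  fixes M :: "('a, 'b) monoid_scheme" and u v :: "'c omega_term"
  assumes "monoid M"
  shows "satisfies M u v \<longleftrightarrow> (\<forall>\<sigma>. range \<sigma> \<subseteq> carrier M \<longrightarrow>
    omega_ext M (word_eval M \<sigma>) u = omega_ext M (word_eval M \<sigma>) v)"
proof (intro iffI allI impI)
  fix \<sigma> :: "'c \<Rightarrow> 'a"
  assume sat: "satisfies M u v" and "range \<sigma> \<subseteq> carrier M"
  then have "word_eval M \<sigma> \<in> monoid_homs free_monoid M" by (intro word_eval_hom[OF assms]) auto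
  with sat show "omega_ext M (word_eval M \<sigma>) u = omega_ext M (word_eval M \<sigma>) v"
    unfolding satisfies_def by (rule bspec)
next
  assume *: "\<forall>\<sigma>. range \<sigma> \<subseteq> carrier M \<longrightarrow>
    omega_ext M (word_eval M \<sigma>) u = omega_ext M (word_eval M \<sigma>) v"
  show "satisfies M u v"
    unfolding satisfies_def
  proof
    fix \<phi> :: "'c list \<Rightarrow> 'a" assume \<phi>: "\<phi> \<in> monoid_homs free_monoid M"
    have eq: "word_eval M (\<lambda>x. \<phi> [x]) = \<phi>"
      by (rule ext) (rule free_hom_eq_word_eval[OF assms \<phi>, symmetric])
    have "range (\<lambda>x. \<phi> [x]) \<subseteq> carrier M" using free_homD(1)[OF \<phi>] by auto
    from *[rule_format, OF this] show "omega_ext M \<phi> u = omega_ext M \<phi> v" unfolding eq .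
  qed
qed

lemma finite_monoidsD: "M \<in> finite_monoids \<Longrightarrow> monoid M" "M \<in> finite_monoids \<Longrightarrow> finite (carrier M)"
  by (simp_all add: finite_monoids_def)

text \<open>Separated from \<open>variety\<close> so that it can be carried up the hierarchy by
  induction. It shows that a quotient belongs to a class as soon as a known member maps onto
  it.\<close>

definition hom_closed :: "nat monoid set \<Rightarrow> bool" where
  "hom_closed V \<longleftrightarrow> (\<forall>M\<in>V. \<forall>N\<in>finite_monoids. \<forall>h\<in>monoid_homs M N.
     h ` carrier M = carrier N \<longrightarrow> N \<in> V)"

lemma hom_closed_equational_class: "hom_closed (equational_class u v)"
  unfolding hom_closed_def
proof (intro ballI impI)
  fix M N h
  assume M: "M \<in> equational_class u v" and N: "N \<in> finite_monoids" and h: "h \<in> monoid_homs M N"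
    and surj: "h ` carrier M = carrier N"
  have M': "monoid M" "finite (carrier M)" "satisfies M u v"
    using M by (auto simp: equational_class_def finite_monoids_def)
  have "satisfies N u v"
    unfolding satisfies_iff[OF finite_monoidsD(1)[OF N]]
  proof (intro allI impI)
    fix \<tau> :: "'a \<Rightarrow> nat" assume "range \<tau> \<subseteq> carrier N"
    then have \<tau>: "\<tau> x \<in> h ` carrier M" for x using surj by auto
    define \<sigma> where "\<sigma> x = inv_into (carrier M) h (\<tau> x)" for x
    have \<sigma>: "\<sigma> x \<in> carrier M" "h (\<sigma> x) = \<tau> x" for x
      unfolding \<sigma>_def using inv_into_into[OF \<tau>] f_inv_into_f[OF \<tau>] by auto
    have hom: "word_eval M \<sigma> \<in> monoid_homs free_monoid M" by (rule word_eval_hom[OF M'(1) \<sigma>(1)])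
    have "h (word_eval M \<sigma> w) = word_eval N \<tau> w" for w
      by (induction w) (simp_all add: monoid_homsD[OF h] \<sigma> free_homD(1)[OF hom])
    then have *: "(\<lambda>w. h (word_eval M \<sigma> w)) = word_eval N \<tau>" by (rule ext)
    have "omega_ext M (word_eval M \<sigma>) u = omega_ext M (word_eval M \<sigma>) v"
      using M'(3) hom unfolding satisfies_def by blast
    then show "omega_ext N (word_eval N \<tau>) u = omega_ext N (word_eval N \<tau>) v"
      using omega_ext_hom[OF h M'(1,2) finite_monoidsD(1)[OF N] hom] unfolding * by metis
  qed
  then show "N \<in> equational_class u v" using N by (simp add: equational_class_def)
qed

text \<open>Homomorphisms commute with the evaluation of omega-terms, so two different values in
  \<open>M\<close> would stay different in some member of the class. Inclusions and projections
  separate points, which treats submonoids and products alike.\<close>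

lemma satisfies_separating:
  fixes u v :: "'v omega_term"
  assumes M: "monoid M" "finite (carrier M)"
    and sep: "\<And>x y. x \<in> carrier M \<Longrightarrow> y \<in> carrier M \<Longrightarrow>
      (\<And>N h. N \<in> equational_class u v \<Longrightarrow> h \<in> monoid_homs M N \<Longrightarrow> h x = h y) \<Longrightarrow> x = y"
  shows "satisfies M u v"
  unfolding satisfies_def
proof
  fix \<phi> :: "'v list \<Rightarrow> 'a" assume \<phi>: "\<phi> \<in> monoid_homs free_monoid M"
  show "omega_ext M \<phi> u = omega_ext M \<phi> v"
  proof (rule sep)
    fix N h assume N: "N \<in> equational_class u v" and h: "h \<in> monoid_homs M N"
    have "monoid N" and "satisfies N u v" using N by (auto simp: equational_class_def finite_monoids_def)
    moreover have "(\<lambda>w. h (\<phi> w)) \<in> monoid_homs free_monoid N" by (rule monoid_homs_compose[OF \<phi> h])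
    ultimately show "h (omega_ext M \<phi> u) = h (omega_ext M \<phi> v)"
      unfolding satisfies_def using omega_ext_hom[OF h M \<open>monoid N\<close> \<phi>, of u]
        omega_ext_hom[OF h M \<open>monoid N\<close> \<phi>, of v] by simp
  qed (rule omega_ext_closed[OF \<phi> M])+
qed

text \<open>\<open>\<cong>\<close> is based on \<open>hom\<close>, which says nothing about units;
  surjectivity forces the unit to be preserved, because an element mapped to the unit of
  \<open>N\<close> is fixed by multiplication with the unit of \<open>P\<close>.\<close>

lemma iso_inverse_monoid_hom:
  assumes "P \<cong> N" "monoid N" "monoid P"
  obtains h k where "h \<in> monoid_homs P N" "k \<in> monoid_homs N P" "bij_betw h (carrier P) (carrier N)"
    "\<And>x. x \<in> carrier P \<Longrightarrow> k (h x) = x" "\<And>y. y \<in> carrier N \<Longrightarrow> h (k y) = y"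
proof -
  interpret N: monoid N by fact
  interpret P: monoid P by fact
  obtain h where h: "h \<in> hom P N" "bij_betw h (carrier P) (carrier N)"
    using assms(1) unfolding is_iso_def iso_def by blast
  note hc = hom_in_carrier[OF h(1)] hom_mult[OF h(1)]
  obtain y where "y \<in> carrier P" "h y = \<one>\<^bsub>N\<^esub>"
    using h(2) N.one_closed by (metis bij_betw_imp_surj_on imageE)
  then have one: "h \<one>\<^bsub>P\<^esub> = \<one>\<^bsub>N\<^esub>"
    using hc(2)[of "\<one>\<^bsub>P\<^esub>" y] hc(1)[of "\<one>\<^bsub>P\<^esub>"] by simp
  define k where "k = inv_into (carrier P) h"
  have kc: "k y \<in> carrier P" if "y \<in> carrier N" for y
    unfolding k_def using that h(2) by (metis bij_betw_imp_surj_on inv_into_into)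
  have kh: "k (h x) = x" if "x \<in> carrier P" for x
    unfolding k_def using that h(2) by (metis bij_betw_inv_into_left)
  have hk: "h (k y) = y" if "y \<in> carrier N" for y
    unfolding k_def using that h(2) by (metis bij_betw_inv_into_right)
  have "k (x \<otimes>\<^bsub>N\<^esub> y) = k x \<otimes>\<^bsub>P\<^esub> k y" if "x \<in> carrier N" "y \<in> carrier N" for x y
    using kh[of "k x \<otimes>\<^bsub>P\<^esub> k y"] hc(2)[of "k x" "k y"] kc that hk by simp
  then have "k \<in> monoid_homs N P"
    using kc kh[of "\<one>\<^bsub>P\<^esub>"] one by (intro monoid_homsI) auto
  moreover have "h \<in> monoid_homs P N" using hc one by (intro monoid_homsI) auto
  ultimately show ?thesis using h(2) kh hk that by blast
qed

lemma product_group_monoid: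
  assumes "\<And>i. i \<in> I \<Longrightarrow> monoid (G i)" shows "monoid (product_group I G)"
  by (rule monoidI) (auto simp: assms monoid.m_closed monoid.one_closed monoid.m_assoc monoid.l_one monoid.r_one
      PiE_iff extensional_def fun_eq_iff intro!: restrict_ext)

lemma variety_equational_class: "variety (equational_class u v)"
  unfolding variety_def
proof (intro conjI ballI allI impI)
  show "equational_class u v \<subseteq> finite_monoids" by (auto simp: equational_class_def)
next
  fix M H assume M: "M \<in> equational_class u v" and H: "submonoid H M"
  have "M \<in> finite_monoids" using M by (simp add: equational_class_def)
  then have fm: "monoid (M\<lparr>carrier := H\<rparr>)" "finite H"
    using H by (auto simp: finite_monoids_def submonoid.submonoid_is_monoid
        intro: finite_subset[OF submonoid.subset])
  have "(\<lambda>x. x) \<in> monoid_homs (M\<lparr>carrier := H\<rparr>) M"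
    using submonoid.subset[OF H] by (intro monoid_homsI) auto
  then have "satisfies (M\<lparr>carrier := H\<rparr>) u v"
    using fm M by (intro satisfies_separating) auto
  then show "M\<lparr>carrier := H\<rparr> \<in> equational_class u v"
    using fm by (simp add: equational_class_def finite_monoids_def)
next
  fix M N h assume "M \<in> equational_class u v" "N \<in> finite_monoids" "h \<in> monoid_homs M N"
    "h ` carrier M = carrier N"
  then show "N \<in> equational_class u v" using hom_closed_equational_class unfolding hom_closed_def by blast
next
  fix I :: "nat set" and G N
  assume G: "\<forall>i\<in>I. G i \<in> equational_class u v" and N: "N \<in> finite_monoids" and iso: "product_group I G \<cong> N"
  have Gm: "monoid (G i)" if "i \<in> I" for i
    using G that by (auto simp: equational_class_def finite_monoids_def)
  have P: "monoid (product_group I G)" by (rule product_group_monoid[OF Gm])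
  obtain h k where h: "h \<in> monoid_homs (product_group I G) N" and k: "k \<in> monoid_homs N (product_group I G)"
    and hk: "\<And>y. y \<in> carrier N \<Longrightarrow> h (k y) = y"
    using iso_inverse_monoid_hom[OF iso finite_monoidsD(1)[OF N] P] by metis
  have "satisfies N u v"
  proof (rule satisfies_separating)
    fix x y assume xy: "x \<in> carrier N" "y \<in> carrier N"
      and eq: "\<And>M h. M \<in> equational_class u v \<Longrightarrow> h \<in> monoid_homs N M \<Longrightarrow> h x = h y"
    have "k x i = k y i" if "i \<in> I" for i
    proof (rule eq[of "G i" "\<lambda>z. k z i"])
      show "(\<lambda>z. k z i) \<in> monoid_homs N (G i)"
        using that monoid_homsD[OF k] by (intro monoid_homsI) (auto simp: PiE_iff)
    qed (use G that in blast)
    moreover have "k x \<in> carrier (product_group I G)" "k y \<in> carrier (product_group I G)"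
      using monoid_homsD(1)[OF k] xy by auto
    ultimately have "k x = k y" by (auto simp: PiE_iff intro: extensionalityI)
    then show "x = y" using hk xy by metis
  qed (use N in \<open>auto simp: finite_monoids_def\<close>)
  then show "N \<in> equational_class u v" using N by (simp add: equational_class_def)
qed

section \<open>Quotients and the relation K\<close>

lemma class_mult:
  assumes r: "equiv (carrier M) r"
    and compat: "\<And>a a' b b'. (a, a') \<in> r \<Longrightarrow> (b, b') \<in> r \<Longrightarrow> (a \<otimes>\<^bsub>M\<^esub> b, a' \<otimes>\<^bsub>M\<^esub> b') \<in> r"
    and xy: "x \<in> carrier M" "y \<in> carrier M"
  shows "r `` {x} \<otimes>\<^bsub>quotient_monoid M r\<^esub> r `` {y} = r `` {x \<otimes>\<^bsub>M\<^esub> y}"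
proof -
  have "r `` {a \<otimes>\<^bsub>M\<^esub> b} = r `` {x \<otimes>\<^bsub>M\<^esub> y}" if "a \<in> r `` {x}" "b \<in> r `` {y}" for a b
    using equiv_class_eq[OF r compat[of x a y b]] that by auto
  then have "(\<Union>a\<in>r `` {x}. \<Union>b\<in>r `` {y}. r `` {a \<otimes>\<^bsub>M\<^esub> b}) =
      (\<Union>a\<in>r `` {x}. \<Union>b\<in>r `` {y}. r `` {x \<otimes>\<^bsub>M\<^esub> y})"
    by (intro SUP_cong HOL.refl)
  moreover have "r `` {x} \<noteq> {}" "r `` {y} \<noteq> {}" using equiv_class_self[OF r] xy by blast+
  ultimately show ?thesis by (simp add: quotient_monoid_def)
qed

lemma quotient_monoid:
  assumes M: "monoid M" and r: "equiv (carrier M) r"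
    and compat: "\<And>a a' b b'. (a, a') \<in> r \<Longrightarrow> (b, b') \<in> r \<Longrightarrow> (a \<otimes>\<^bsub>M\<^esub> b, a' \<otimes>\<^bsub>M\<^esub> b') \<in> r"
  shows "monoid (quotient_monoid M r)"
    and "(\<lambda>x. r `` {x}) \<in> monoid_homs M (quotient_monoid M r)"
    and "(\<lambda>x. r `` {x}) ` carrier M = carrier (quotient_monoid M r)"
proof -
  interpret M: monoid M by fact
  note mult = class_mult[OF r compat]
  show c: "(\<lambda>x. r `` {x}) ` carrier M = carrier (quotient_monoid M r)"
    by (auto simp: quotient_monoid_def quotient_def)
  have one: "\<one>\<^bsub>quotient_monoid M r\<^esub> = r `` {\<one>\<^bsub>M\<^esub>}" by (simp add: quotient_monoid_def)
  show "(\<lambda>x. r `` {x}) \<in> monoid_homs M (quotient_monoid M r)"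
    using c mult one by (intro monoid_homsI) auto
  show "monoid (quotient_monoid M r)"
  proof (rule monoidI; (unfold c[symmetric] one)?)
    fix x y z :: "'a set"
    assume "x \<in> (\<lambda>x. r `` {x}) ` carrier M" "y \<in> (\<lambda>x. r `` {x}) ` carrier M" "z \<in> (\<lambda>x. r `` {x}) ` carrier M"
    then show "x \<otimes>\<^bsub>quotient_monoid M r\<^esub> y \<otimes>\<^bsub>quotient_monoid M r\<^esub> z =
        x \<otimes>\<^bsub>quotient_monoid M r\<^esub> (y \<otimes>\<^bsub>quotient_monoid M r\<^esub> z)"
      by (auto simp: mult M.m_assoc)
  qed (auto simp: mult)
qed

lemma image_image_eq: "f ` A = B \<Longrightarrow> g ` B = C \<Longrightarrow> (\<lambda>x. g (f x)) ` A = C"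
  by auto

lemma finite_monoid_nat_copy:
  assumes "monoid Q" "finite (carrier Q)"
  obtains N where "N \<in> finite_monoids" "Q \<cong> N"
proof -
  interpret Q: monoid Q by fact
  obtain f :: "'a \<Rightarrow> nat" where f: "inj_on f (carrier Q)"
    using finite_imp_inj_to_nat_seg[OF assms(2)] by blast
  define g where "g = inv_into (carrier Q) f"
  have gf [simp]: "g (f x) = x" if "x \<in> carrier Q" for x
    using f that by (simp add: g_def)
  define N where "N = \<lparr>carrier = f ` carrier Q, monoid.mult = (\<lambda>x y. f (g x \<otimes>\<^bsub>Q\<^esub> g y)), one = f \<one>\<^bsub>Q\<^esub>\<rparr>"
  have N [simp]: "carrier N = f ` carrier Q" "x \<otimes>\<^bsub>N\<^esub> y = f (g x \<otimes>\<^bsub>Q\<^esub> g y)" "\<one>\<^bsub>N\<^esub> = f \<one>\<^bsub>Q\<^esub>" for x y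
    by (simp_all add: N_def)
  have "monoid N" by (rule monoidI) (auto simp: Q.m_assoc)
  moreover have "f \<in> iso Q N" unfolding iso_def hom_def using f by (auto simp: bij_betw_def)
  then have "Q \<cong> N" unfolding is_iso_def by blast
  ultimately show ?thesis using that[of N] assms(2) by (simp add: finite_monoids_def)
qed

lemma hom_factor:
  assumes M: "monoid M" and h: "h \<in> monoid_homs M N" "h ` carrier M = carrier N"
    and g: "g \<in> monoid_homs M P"
    and ker: "\<And>x y. x \<in> carrier M \<Longrightarrow> y \<in> carrier M \<Longrightarrow> h x = h y \<Longrightarrow> g x = g y"
  obtains k where "k \<in> monoid_homs N P" "\<And>x. x \<in> carrier M \<Longrightarrow> k (h x) = g x"
proof -
  interpret M: monoid M by fact
  define k where "k y = g (inv_into (carrier M) h y)" for y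
  have kh: "k (h x) = g x" if "x \<in> carrier M" for x
    unfolding k_def using that by (intro ker) (auto intro: inv_into_into f_inv_into_f)
  have "k \<in> monoid_homs N P"
  proof (rule monoid_homsI)
    fix x y assume "x \<in> carrier N" "y \<in> carrier N"
    then obtain a b where "a \<in> carrier M" "b \<in> carrier M" "x = h a" "y = h b" using h(2) by blast
    then show "k (x \<otimes>\<^bsub>N\<^esub> y) = k x \<otimes>\<^bsub>P\<^esub> k y"
      using kh[of "a \<otimes>\<^bsub>M\<^esub> b"] by (simp add: monoid_homsD[OF h(1)] monoid_homsD[OF g] kh)
  next
    fix x assume "x \<in> carrier N"
    then obtain a where "a \<in> carrier M" "x = h a" using h(2) by blast
    then show "k x \<in> carrier P" by (simp add: kh monoid_homsD[OF g])
  next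
    show "k \<one>\<^bsub>N\<^esub> = \<one>\<^bsub>P\<^esub>"
      using kh[of "\<one>\<^bsub>M\<^esub>"] by (simp add: monoid_homsD[OF h(1)] monoid_homsD[OF g])
  qed
  then show ?thesis using kh that by blast
qed

lemma belongs_to_hom_image:
  assumes V: "hom_closed V" and N: "N \<in> V" "V \<subseteq> finite_monoids"
    and Q: "monoid Q" and h: "h \<in> monoid_homs N Q" "h ` carrier N = carrier Q"
  shows "belongs_to Q V"
proof -
  have "finite (carrier Q)" using N h(2) finite_monoidsD(2) by (metis finite_imageI subsetD)
  then obtain P where P: "P \<in> finite_monoids" "Q \<cong> P" using finite_monoid_nat_copy Q by blast
  obtain g k where g: "g \<in> monoid_homs Q P" "bij_betw g (carrier Q) (carrier P)"
    using iso_inverse_monoid_hom[OF P(2) finite_monoidsD(1)[OF P(1)] Q] by metis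
  have "(\<lambda>x. g (h x)) \<in> monoid_homs N P" "(\<lambda>x. g (h x)) ` carrier N = carrier P"
    by (rule monoid_homs_compose[OF h(1) g(1)] image_image_eq[OF h(2) bij_betw_imp_surj_on[OF g(2)]])+
  then have "P \<in> V" using V N(1) P(1) unfolding hom_closed_def by blast
  then show ?thesis using P(2) unfolding belongs_to_def by blast
qed

section \<open>The congruence \<open>sim_K\<close> and its behaviour under homomorphisms\<close>

lemma green_R_idempotent:
  assumes "monoid M" "idempotent M e" "x \<in> carrier M"
  shows "green_R M (e \<otimes>\<^bsub>M\<^esub> x) e \<longleftrightarrow> (\<exists>s\<in>carrier M. e \<otimes>\<^bsub>M\<^esub> x \<otimes>\<^bsub>M\<^esub> s = e)"
proof -
  interpret monoid M by fact
  have e: "e \<in> carrier M" "e \<otimes>\<^bsub>M\<^esub> e = e" using assms(2) by (auto simp: idempotent_def)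
  show ?thesis
  proof
    assume "green_R M (e \<otimes>\<^bsub>M\<^esub> x) e"
    then have "e \<otimes>\<^bsub>M\<^esub> e \<in> (e \<otimes>\<^bsub>M\<^esub> x) <#\<^bsub>M\<^esub> carrier M"
      using e unfolding green_R_def l_coset_def by blast
    then show "\<exists>s\<in>carrier M. e \<otimes>\<^bsub>M\<^esub> x \<otimes>\<^bsub>M\<^esub> s = e"
      using e unfolding l_coset_def by force
  next
    assume "\<exists>s\<in>carrier M. e \<otimes>\<^bsub>M\<^esub> x \<otimes>\<^bsub>M\<^esub> s = e"
    then obtain s where s: "s \<in> carrier M" "e \<otimes>\<^bsub>M\<^esub> x \<otimes>\<^bsub>M\<^esub> s = e" by blast
    have 1: "e \<otimes>\<^bsub>M\<^esub> x \<otimes>\<^bsub>M\<^esub> h = e \<otimes>\<^bsub>M\<^esub> (x \<otimes>\<^bsub>M\<^esub> h)" if "h \<in> carrier M" for h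
      using e assms(3) that by (simp add: m_assoc)
    have 2: "e \<otimes>\<^bsub>M\<^esub> h = e \<otimes>\<^bsub>M\<^esub> x \<otimes>\<^bsub>M\<^esub> (s \<otimes>\<^bsub>M\<^esub> h)" if "h \<in> carrier M" for h
    proof -
      have "e \<otimes>\<^bsub>M\<^esub> x \<otimes>\<^bsub>M\<^esub> (s \<otimes>\<^bsub>M\<^esub> h) = e \<otimes>\<^bsub>M\<^esub> x \<otimes>\<^bsub>M\<^esub> s \<otimes>\<^bsub>M\<^esub> h"
        using e s(1) assms(3) that by (simp add: m_assoc)
      then show ?thesis using s(2) by simp
    qed
    show "green_R M (e \<otimes>\<^bsub>M\<^esub> x) e"
      unfolding green_R_def l_coset_def
    proof (intro equalityI subsetI)
      fix y assume "y \<in> (\<Union>h\<in>carrier M. {e \<otimes>\<^bsub>M\<^esub> x \<otimes>\<^bsub>M\<^esub> h})"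
      then obtain h where "h \<in> carrier M" "y = e \<otimes>\<^bsub>M\<^esub> x \<otimes>\<^bsub>M\<^esub> h" by blast
      then show "y \<in> (\<Union>h\<in>carrier M. {e \<otimes>\<^bsub>M\<^esub> h})" using 1 assms(3) m_closed by blast
    next
      fix y assume "y \<in> (\<Union>h\<in>carrier M. {e \<otimes>\<^bsub>M\<^esub> h})"
      then obtain h where "h \<in> carrier M" "y = e \<otimes>\<^bsub>M\<^esub> h" by blast
      then show "y \<in> (\<Union>h\<in>carrier M. {e \<otimes>\<^bsub>M\<^esub> x \<otimes>\<^bsub>M\<^esub> h})" using 2 s(1) m_closed by blast
    qed
  qed
qed

lemma sim_KI:
  assumes "monoid M" "x \<in> carrier M" "y \<in> carrier M"
    and "\<And>e s. idempotent M e \<Longrightarrow> s \<in> carrier M \<Longrightarrow>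
      e \<otimes>\<^bsub>M\<^esub> x \<otimes>\<^bsub>M\<^esub> s = e \<or> e \<otimes>\<^bsub>M\<^esub> y \<otimes>\<^bsub>M\<^esub> s = e \<Longrightarrow> e \<otimes>\<^bsub>M\<^esub> x = e \<otimes>\<^bsub>M\<^esub> y"
  shows "(x, y) \<in> sim_K M"
  unfolding sim_K_def using assms green_R_idempotent[OF assms(1)] by blast

lemma sim_KD:
  assumes "monoid M" "(x, y) \<in> sim_K M" "idempotent M e" "s \<in> carrier M"
    and "e \<otimes>\<^bsub>M\<^esub> x \<otimes>\<^bsub>M\<^esub> s = e \<or> e \<otimes>\<^bsub>M\<^esub> y \<otimes>\<^bsub>M\<^esub> s = e"
  shows "e \<otimes>\<^bsub>M\<^esub> x = e \<otimes>\<^bsub>M\<^esub> y"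
  using assms green_R_idempotent[OF assms(1,3)] unfolding sim_K_def by blast

lemma sim_K_eq:
  "(x, y) \<in> sim_K M \<Longrightarrow> idempotent M e \<Longrightarrow>
    green_R M (e \<otimes>\<^bsub>M\<^esub> x) e \<or> green_R M (e \<otimes>\<^bsub>M\<^esub> y) e \<Longrightarrow> e \<otimes>\<^bsub>M\<^esub> x = e \<otimes>\<^bsub>M\<^esub> y"
  unfolding sim_K_def by blast

lemma equiv_sim_K: "equiv (carrier M) (sim_K M)"
proof (rule equivI)
  show "refl_on (carrier M) (sim_K M)" by (auto simp: refl_on_def sim_K_def)
  show "sym (sim_K M)"
  proof (rule symI)
    fix x y assume xy: "(x, y) \<in> sim_K M"
    have "e \<otimes>\<^bsub>M\<^esub> y = e \<otimes>\<^bsub>M\<^esub> x"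
      if "idempotent M e" "green_R M (e \<otimes>\<^bsub>M\<^esub> y) e \<or> green_R M (e \<otimes>\<^bsub>M\<^esub> x) e" for e
    proof -
      have "e \<otimes>\<^bsub>M\<^esub> x = e \<otimes>\<^bsub>M\<^esub> y" using xy that unfolding sim_K_def by blast
      then show ?thesis by simp
    qed
    then show "(y, x) \<in> sim_K M" using xy unfolding sim_K_def by blast
  qed
  show "trans (sim_K M)"
  proof (rule transI)
    fix x y z assume xy: "(x, y) \<in> sim_K M" and yz: "(y, z) \<in> sim_K M"
    have "e \<otimes>\<^bsub>M\<^esub> x = e \<otimes>\<^bsub>M\<^esub> z"
      if "idempotent M e" "green_R M (e \<otimes>\<^bsub>M\<^esub> x) e \<or> green_R M (e \<otimes>\<^bsub>M\<^esub> z) e" for e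
    proof -
      from that(2) show ?thesis
      proof
        assume *: "green_R M (e \<otimes>\<^bsub>M\<^esub> x) e"
        have 1: "e \<otimes>\<^bsub>M\<^esub> x = e \<otimes>\<^bsub>M\<^esub> y"
          by (rule sim_K_eq[OF xy that(1) disjI1[OF *]])
        also have "\<dots> = e \<otimes>\<^bsub>M\<^esub> z"
          by (rule sim_K_eq[OF yz that(1) disjI1[OF *[unfolded 1]]])
        finally show ?thesis .
      next
        assume *: "green_R M (e \<otimes>\<^bsub>M\<^esub> z) e"
        have 1: "e \<otimes>\<^bsub>M\<^esub> y = e \<otimes>\<^bsub>M\<^esub> z"
          by (rule sim_K_eq[OF yz that(1) disjI2[OF *]])
        have "e \<otimes>\<^bsub>M\<^esub> x = e \<otimes>\<^bsub>M\<^esub> y"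
          by (rule sim_K_eq[OF xy that(1) disjI2[OF *[folded 1]]])
        then show ?thesis unfolding 1 .
      qed
    qed
    then show "(x, z) \<in> sim_K M" using xy yz unfolding sim_K_def by blast
  qed
qed (auto simp: sim_K_def)

lemma sim_K_sym: "(x, y) \<in> sim_K M \<Longrightarrow> (y, x) \<in> sim_K M"
  using equiv_sim_K by (meson equivE symD)

lemma sim_K_mult_right:
  assumes M: "monoid M" and xy: "(x, y) \<in> sim_K M" and w: "w \<in> carrier M"
  shows "(x \<otimes>\<^bsub>M\<^esub> w, y \<otimes>\<^bsub>M\<^esub> w) \<in> sim_K M"
proof -
  interpret monoid M by fact
  have c: "x \<in> carrier M" "y \<in> carrier M" using xy by (auto simp: sim_K_def)
  show ?thesis
  proof (rule sim_KI[OF M])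
    fix e s assume e: "idempotent M e" and s: "s \<in> carrier M"
      and *: "e \<otimes>\<^bsub>M\<^esub> (x \<otimes>\<^bsub>M\<^esub> w) \<otimes>\<^bsub>M\<^esub> s = e \<or> e \<otimes>\<^bsub>M\<^esub> (y \<otimes>\<^bsub>M\<^esub> w) \<otimes>\<^bsub>M\<^esub> s = e"
    have ec: "e \<in> carrier M" using e by (simp add: idempotent_def)
    have "e \<otimes>\<^bsub>M\<^esub> x = e \<otimes>\<^bsub>M\<^esub> y"
      by (rule sim_KD[OF M xy e, of "w \<otimes>\<^bsub>M\<^esub> s"]) (use * c w s ec in \<open>auto simp: m_assoc\<close>)
    then show "e \<otimes>\<^bsub>M\<^esub> (x \<otimes>\<^bsub>M\<^esub> w) = e \<otimes>\<^bsub>M\<^esub> (y \<otimes>\<^bsub>M\<^esub> w)"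
      using c w ec by (simp add: m_assoc[symmetric])
  qed (use c w in auto)
qed

text \<open>On the right, \<open>w\<close> can be moved into the witness \<open>s\<close>; on the
  left an idempotent next to \<open>x\<close> is needed. If \<open>e w x s = e\<close>, then
  \<open>g = x s e w\<close> is idempotent and \<open>g x s e w = g\<close>, whence
  \<open>g x = g y\<close>. Multiplication by \<open>e w\<close> turns this into
  \<open>e w x = e w y\<close>.\<close>

lemma sim_K_mult_left:
  assumes M: "monoid M" and xy: "(x, y) \<in> sim_K M" and w: "w \<in> carrier M"
  shows "(w \<otimes>\<^bsub>M\<^esub> x, w \<otimes>\<^bsub>M\<^esub> y) \<in> sim_K M"
proof -
  interpret monoid M by fact
  have one: "e \<otimes>\<^bsub>M\<^esub> (w \<otimes>\<^bsub>M\<^esub> x) = e \<otimes>\<^bsub>M\<^esub> (w \<otimes>\<^bsub>M\<^esub> y)"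
    if xy: "(x, y) \<in> sim_K M" and e: "idempotent M e" and s: "s \<in> carrier M"
      and eq: "e \<otimes>\<^bsub>M\<^esub> (w \<otimes>\<^bsub>M\<^esub> x) \<otimes>\<^bsub>M\<^esub> s = e" for x y e s
  proof -
    have c: "x \<in> carrier M" "y \<in> carrier M" using xy by (auto simp: sim_K_def)
    have ec: "e \<in> carrier M" "e \<otimes>\<^bsub>M\<^esub> e = e" using e by (auto simp: idempotent_def)
    have eq': "e \<otimes>\<^bsub>M\<^esub> (w \<otimes>\<^bsub>M\<^esub> (x \<otimes>\<^bsub>M\<^esub> (s \<otimes>\<^bsub>M\<^esub> z))) = e \<otimes>\<^bsub>M\<^esub> z" if "z \<in> carrier M" for z
      using arg_cong[OF eq, of "\<lambda>y. y \<otimes>\<^bsub>M\<^esub> z"] c w s ec that by (simp add: m_assoc)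
    have ee: "e \<otimes>\<^bsub>M\<^esub> (e \<otimes>\<^bsub>M\<^esub> z) = e \<otimes>\<^bsub>M\<^esub> z" if "z \<in> carrier M" for z
      using ec that by (simp add: m_assoc[symmetric])
    define g where "g = x \<otimes>\<^bsub>M\<^esub> (s \<otimes>\<^bsub>M\<^esub> (e \<otimes>\<^bsub>M\<^esub> w))"
    have gc: "g \<in> carrier M" using c s ec w by (simp add: g_def)
    have "g \<otimes>\<^bsub>M\<^esub> g = g" unfolding g_def using c s ec w eq' ee by (simp add: m_assoc)
    then have g: "idempotent M g" using gc by (simp add: idempotent_def)
    have "g \<otimes>\<^bsub>M\<^esub> x \<otimes>\<^bsub>M\<^esub> (s \<otimes>\<^bsub>M\<^esub> (e \<otimes>\<^bsub>M\<^esub> w)) = g"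
      unfolding g_def using c s ec w eq' ee by (simp add: m_assoc)
    then have "g \<otimes>\<^bsub>M\<^esub> x = g \<otimes>\<^bsub>M\<^esub> y" using s ec w by (intro sim_KD[OF M xy g _ disjI1]) auto
    then have "e \<otimes>\<^bsub>M\<^esub> (w \<otimes>\<^bsub>M\<^esub> (g \<otimes>\<^bsub>M\<^esub> x)) = e \<otimes>\<^bsub>M\<^esub> (w \<otimes>\<^bsub>M\<^esub> (g \<otimes>\<^bsub>M\<^esub> y))" by simp
    then show ?thesis unfolding g_def using c s ec w eq' ee by (simp add: m_assoc)
  qed
  have c: "x \<in> carrier M" "y \<in> carrier M" using xy by (auto simp: sim_K_def)
  show ?thesis
  proof (rule sim_KI[OF M])
    fix e s assume "idempotent M e" "s \<in> carrier M"
      "e \<otimes>\<^bsub>M\<^esub> (w \<otimes>\<^bsub>M\<^esub> x) \<otimes>\<^bsub>M\<^esub> s = e \<or> e \<otimes>\<^bsub>M\<^esub> (w \<otimes>\<^bsub>M\<^esub> y) \<otimes>\<^bsub>M\<^esub> s = e"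
    then show "e \<otimes>\<^bsub>M\<^esub> (w \<otimes>\<^bsub>M\<^esub> x) = e \<otimes>\<^bsub>M\<^esub> (w \<otimes>\<^bsub>M\<^esub> y)"
      using one[OF xy, of e s] one[OF sim_K_sym[OF xy], of e s] by (elim disjE) simp_all
  qed (use c w in auto)
qed

lemma sim_K_compat:
  assumes M: "monoid M" and "(a, a') \<in> sim_K M" "(b, b') \<in> sim_K M"
  shows "(a \<otimes>\<^bsub>M\<^esub> b, a' \<otimes>\<^bsub>M\<^esub> b') \<in> sim_K M"
proof -
  have "b \<in> carrier M" "a' \<in> carrier M" using assms by (auto simp: sim_K_def)
  then have "(a \<otimes>\<^bsub>M\<^esub> b, a' \<otimes>\<^bsub>M\<^esub> b) \<in> sim_K M" "(a' \<otimes>\<^bsub>M\<^esub> b, a' \<otimes>\<^bsub>M\<^esub> b') \<in> sim_K M"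
    using sim_K_mult_right[OF M assms(2)] sim_K_mult_left[OF M assms(3)] by auto
  then show ?thesis using equiv_sim_K by (meson equivE transD)
qed

lemma quotient_sim_K:
  assumes "monoid M"
  shows "monoid (quotient_monoid M (sim_K M))"
    and "(\<lambda>x. sim_K M `` {x}) \<in> monoid_homs M (quotient_monoid M (sim_K M))"
    and "(\<lambda>x. sim_K M `` {x}) ` carrier M = carrier (quotient_monoid M (sim_K M))"
  by (rule quotient_monoid[OF assms equiv_sim_K]; rule sim_K_compat[OF assms]; assumption)+

text \<open>
  Among the idempotents lying over an idempotent of the image, one that generates a right ideal
  of minimal size is used to lift the condition \<open>e x \<R> e\<close>.
\<close>

lemma sim_K_hom_one_sided:
  assumes M: "monoid M" "finite (carrier M)" and N: "monoid N"
    and h: "h \<in> monoid_homs M N" "h ` carrier M = carrier N" and xy: "(x, y) \<in> sim_K M"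
    and e: "idempotent N e" and s: "s \<in> carrier N" "e \<otimes>\<^bsub>N\<^esub> h x \<otimes>\<^bsub>N\<^esub> s = e"
  shows "e \<otimes>\<^bsub>N\<^esub> h x = e \<otimes>\<^bsub>N\<^esub> h y"
proof -
  interpret M: monoid M by fact
  interpret N: monoid N by fact
  have c: "x \<in> carrier M" "y \<in> carrier M" using xy by (auto simp: sim_K_def)
  have ec: "e \<in> carrier N" "e \<otimes>\<^bsub>N\<^esub> e = e" using e by (auto simp: idempotent_def)
  define T where "T = {f. idempotent M f \<and> h f = e}"
  define ideal where "ideal f = (\<lambda>z. f \<otimes>\<^bsub>M\<^esub> z) ` carrier M" for f
  have omega: "omega_power M a \<in> T" if "a \<in> carrier M" "h a = e" for a
  proof -
    have "omega_power N e = e"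
      using N.omega_power_eq[OF ec(1), of 1] e ec(1) by simp
    then show ?thesis
      using omega_power_hom[OF h(1) M N that(1)] that M.omega_power_idempotent[OF M(2) that(1)]
      by (simp add: T_def)
  qed
  obtain a where "a \<in> carrier M" "h a = e" using ec(1) unfolding h(2)[symmetric] by blast
  then have "T \<noteq> {}" using omega by blast
  then obtain f where f: "f \<in> T" "\<And>g. g \<in> T \<Longrightarrow> card (ideal f) \<le> card (ideal g)"
    using ex_has_least_nat[of "\<lambda>f. f \<in> T" _ "\<lambda>f. card (ideal f)"] by blast
  have fc: "idempotent M f" "f \<in> carrier M" "f \<otimes>\<^bsub>M\<^esub> f = f" "h f = e"
    using f(1) by (auto simp: T_def idempotent_def)
  obtain t where t: "t \<in> carrier M" "h t = s" using s(1) unfolding h(2)[symmetric] by blast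
  define a where "a = f \<otimes>\<^bsub>M\<^esub> x \<otimes>\<^bsub>M\<^esub> t"
  have ac: "a \<in> carrier M" using fc c t by (simp add: a_def)
  have "h a = e" using s(2) fc c t by (simp add: a_def monoid_homsD[OF h(1)])
  then have g: "omega_power M a \<in> T" using omega ac by blast
  obtain k :: nat where k: "0 < k" "idempotent M (a [^]\<^bsub>M\<^esub> k)" using M.exists_idempotent_pow[OF M(2) ac] by blast
  obtain l where l: "k = Suc l" using k(1) by (cases k) auto
  have "omega_power M a = a [^]\<^bsub>M\<^esub> k" by (rule M.omega_power_eq[OF ac k])
  also have "\<dots> = a \<otimes>\<^bsub>M\<^esub> a [^]\<^bsub>M\<^esub> l" unfolding l by (rule M.nat_pow_Suc2[OF ac])
  also have "\<dots> = f \<otimes>\<^bsub>M\<^esub> x \<otimes>\<^bsub>M\<^esub> (t \<otimes>\<^bsub>M\<^esub> a [^]\<^bsub>M\<^esub> l)"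
    using fc c t ac by (simp add: a_def M.m_assoc)
  finally have ga: "omega_power M a = f \<otimes>\<^bsub>M\<^esub> x \<otimes>\<^bsub>M\<^esub> (t \<otimes>\<^bsub>M\<^esub> a [^]\<^bsub>M\<^esub> l)" .
  define q where "q = t \<otimes>\<^bsub>M\<^esub> a [^]\<^bsub>M\<^esub> l"
  have q: "q \<in> carrier M" using t ac by (simp add: q_def)
  have ga: "omega_power M a = f \<otimes>\<^bsub>M\<^esub> (x \<otimes>\<^bsub>M\<^esub> q)"
    using ga fc c q by (simp add: q_def[symmetric] M.m_assoc)
  have "ideal (omega_power M a) \<subseteq> ideal f"
  proof
    fix z assume "z \<in> ideal (omega_power M a)"
    then obtain z' where "z' \<in> carrier M" "z = f \<otimes>\<^bsub>M\<^esub> (x \<otimes>\<^bsub>M\<^esub> q) \<otimes>\<^bsub>M\<^esub> z'"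
      unfolding ideal_def ga by blast
    then have "z = f \<otimes>\<^bsub>M\<^esub> (x \<otimes>\<^bsub>M\<^esub> q \<otimes>\<^bsub>M\<^esub> z')" "x \<otimes>\<^bsub>M\<^esub> q \<otimes>\<^bsub>M\<^esub> z' \<in> carrier M"
      using fc c q by (simp_all add: M.m_assoc)
    then show "z \<in> ideal f" unfolding ideal_def by blast
  qed
  moreover have "finite (ideal f)" unfolding ideal_def using M(2) by simp
  ultimately have "ideal (omega_power M a) = ideal f"
    using f(2)[OF g] by (metis card_subset_eq card_mono le_antisym)
  moreover have "f \<in> ideal f" unfolding ideal_def using fc by (metis imageI)
  ultimately have "f \<in> ideal (omega_power M a)" by simp
  then obtain z where "z \<in> carrier M" "f = omega_power M a \<otimes>\<^bsub>M\<^esub> z" unfolding ideal_def by blast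
  then have "f \<otimes>\<^bsub>M\<^esub> x \<otimes>\<^bsub>M\<^esub> (q \<otimes>\<^bsub>M\<^esub> z) = f" "q \<otimes>\<^bsub>M\<^esub> z \<in> carrier M"
    unfolding ga using fc c q by (simp_all add: M.m_assoc)
  then have "f \<otimes>\<^bsub>M\<^esub> x = f \<otimes>\<^bsub>M\<^esub> y" using sim_KD[OF M(1) xy fc(1)] by blast
  then have "h (f \<otimes>\<^bsub>M\<^esub> x) = h (f \<otimes>\<^bsub>M\<^esub> y)" by simp
  then show ?thesis using fc c by (simp add: monoid_homsD[OF h(1)])
qed

lemma sim_K_hom:
  assumes M: "monoid M" "finite (carrier M)" and N: "monoid N"
    and h: "h \<in> monoid_homs M N" "h ` carrier M = carrier N" and xy: "(x, y) \<in> sim_K M"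
  shows "(h x, h y) \<in> sim_K N"
proof (rule sim_KI[OF N])
  have c: "x \<in> carrier M" "y \<in> carrier M" using xy by (auto simp: sim_K_def)
  then show "h x \<in> carrier N" "h y \<in> carrier N" using monoid_homsD(1)[OF h(1)] by auto
  fix e s assume "idempotent N e" "s \<in> carrier N"
    "e \<otimes>\<^bsub>N\<^esub> h x \<otimes>\<^bsub>N\<^esub> s = e \<or> e \<otimes>\<^bsub>N\<^esub> h y \<otimes>\<^bsub>N\<^esub> s = e"
  then show "e \<otimes>\<^bsub>N\<^esub> h x = e \<otimes>\<^bsub>N\<^esub> h y"
    using sim_K_hom_one_sided[OF M N h xy] sim_K_hom_one_sided[OF M N h sim_K_sym[OF xy]] by metis
qed

text \<open>By \<open>sim_K_hom\<close>, a surjection from \<open>M\<close> to \<open>N\<close>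
  induces one between the quotients by \<open>sim_K\<close>, so that of \<open>N\<close> is an image
  of a member of \<open>V\<close>.\<close>

lemma hom_closed_K_malcev:
  assumes V: "hom_closed V" "V \<subseteq> finite_monoids"
  shows "hom_closed (K_malcev V)"
  unfolding hom_closed_def
proof (intro ballI impI)
  fix M N h
  assume M: "M \<in> K_malcev V" and N: "N \<in> finite_monoids" and h: "h \<in> monoid_homs M N"
    and surj: "h ` carrier M = carrier N"
  have M': "monoid M" "finite (carrier M)" using M by (auto simp: K_malcev_def finite_monoids_def)
  note N' = finite_monoidsD(1)[OF N]
  note qM = quotient_sim_K[OF M'(1)] and qN = quotient_sim_K[OF N']
  obtain P where P: "P \<in> V" "quotient_monoid M (sim_K M) \<cong> P"
    using M unfolding K_malcev_def belongs_to_def by blast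
  have P': "monoid P" using P(1) V(2) finite_monoidsD(1) by blast
  obtain k where k: "k \<in> monoid_homs (quotient_monoid M (sim_K M)) P"
    "bij_betw k (carrier (quotient_monoid M (sim_K M))) (carrier P)"
    using iso_inverse_monoid_hom[OF P(2) P' qM(1)] by metis
  let ?p = "\<lambda>x. k (sim_K M `` {x})" and ?q = "\<lambda>x. sim_K N `` {h x}"
  have p: "?p \<in> monoid_homs M P" "?p ` carrier M = carrier P"
    using monoid_homs_compose[OF qM(2) k(1)] image_image_eq[OF qM(3) bij_betw_imp_surj_on[OF k(2)]]
    by this+
  have q: "?q \<in> monoid_homs M (quotient_monoid N (sim_K N))"
    "?q ` carrier M = carrier (quotient_monoid N (sim_K N))"
    by (rule monoid_homs_compose[OF h qN(2)] image_image_eq[OF surj qN(3)])+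
  have ker: "?q x = ?q y" if "x \<in> carrier M" "y \<in> carrier M" "?p x = ?p y" for x y
  proof -
    have "sim_K M `` {x} = sim_K M `` {y}"
      using that k(2) qM(3) unfolding bij_betw_def inj_on_def by blast
    then have "(x, y) \<in> sim_K M" using eq_equiv_class_iff[OF equiv_sim_K that(1,2)] by simp
    then show ?thesis
      using equiv_class_eq[OF equiv_sim_K sim_K_hom[OF M' N' h surj]] by blast
  qed
  obtain l where l: "l \<in> monoid_homs P (quotient_monoid N (sim_K N))" "\<And>x. x \<in> carrier M \<Longrightarrow> l (?p x) = ?q x"
    using hom_factor[OF M'(1) p q(1) ker] by blast
  have "l ` carrier P = carrier (quotient_monoid N (sim_K N))"
    unfolding p(2)[symmetric] q(2)[symmetric] image_image by (rule image_cong[OF HOL.refl l(2)])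
  then have "belongs_to (quotient_monoid N (sim_K N)) V"
    by (rule belongs_to_hom_image[OF V(1) P(1) V(2) qN(1) l(1)])
  then show "N \<in> K_malcev V" using N by (simp add: K_malcev_def)
qed

section \<open>Presentations by words\<close>

text \<open>Reversal exchanges \<open>sim_K\<close> with \<open>sim_D\<close> and the two
  hierarchies, so that facts about \<open>L_level\<close> follow from those about
  \<open>R_level\<close>.\<close>

definition opposite :: "('a, 'c) monoid_scheme \<Rightarrow> ('a, 'c) monoid_scheme" where
  "opposite M = M\<lparr>monoid.mult := \<lambda>x y. y \<otimes>\<^bsub>M\<^esub> x\<rparr>"

lemma opposite_simps [simp]:
  "carrier (opposite M) = carrier M" "x \<otimes>\<^bsub>opposite M\<^esub> y = y \<otimes>\<^bsub>M\<^esub> x"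
  "\<one>\<^bsub>opposite M\<^esub> = \<one>\<^bsub>M\<^esub>" "opposite (opposite M) = M"
  by (simp_all add: opposite_def)

lemma monoid_opposite: "monoid M \<Longrightarrow> monoid (opposite M)"
  by (rule monoidI) (simp_all add: monoid.m_closed monoid.one_closed monoid.m_assoc monoid.l_one monoid.r_one)

lemma monoid_opposite_iff: "monoid (opposite M) \<longleftrightarrow> monoid M"
  using monoid_opposite[of M] monoid_opposite[of "opposite M"] by auto

lemma finite_monoids_opposite: "opposite M \<in> finite_monoids \<longleftrightarrow> M \<in> finite_monoids"
  by (simp add: finite_monoids_def monoid_opposite_iff)

lemma monoid_homs_opposite: "h \<in> monoid_homs (opposite M) (opposite N) \<longleftrightarrow> h \<in> monoid_homs M N"
  unfolding monoid_homs_def hom_def by auto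

lemma idempotent_opposite: "idempotent (opposite M) = idempotent M"
  by (simp add: idempotent_def fun_eq_iff)

lemma omega_power_opposite:
  assumes M: "monoid M" "finite (carrier M)" and x: "x \<in> carrier M"
  shows "omega_power (opposite M) x = omega_power M x"
proof -
  interpret M: monoid M by fact
  interpret O: monoid "opposite M" by (rule monoid_opposite[OF M(1)])
  have pow: "x [^]\<^bsub>opposite M\<^esub> (k::nat) = x [^]\<^bsub>M\<^esub> k" for k
    using x M.nat_pow_Suc2[OF x] by (induction k) simp_all
  obtain k :: nat where k: "0 < k" "idempotent M (x [^]\<^bsub>M\<^esub> k)"
    using M.exists_idempotent_pow[OF M(2) x] by blast
  then show ?thesis
    using M.omega_power_eq[OF x k] O.omega_power_eq[of x k] x by (simp add: pow idempotent_opposite)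
qed

lemma sim_D_opposite: "sim_D M = sim_K (opposite M)"
  unfolding sim_D_def sim_K_def green_L_def green_R_def idempotent_opposite r_coset_def l_coset_def
  by simp

lemma quotient_monoid_opposite: "quotient_monoid (opposite M) r = opposite (quotient_monoid M r)"
proof -
  have "(\<Union>a\<in>A. \<Union>b\<in>B. r `` {b \<otimes>\<^bsub>M\<^esub> a}) = (\<Union>a\<in>B. \<Union>b\<in>A. r `` {a \<otimes>\<^bsub>M\<^esub> b})" for A B
    by (rule SUP_commute)
  then show ?thesis by (simp add: quotient_monoid_def opposite_def)
qed

lemma opposite_iso: "opposite P \<cong> opposite Q \<longleftrightarrow> P \<cong> Q"
  unfolding is_iso_def iso_def hom_def by auto

section \<open>Duality of the two hierarchies\<close>

lemma R_level_2_iff: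
  "M \<in> R_level (Suc (Suc 0)) \<longleftrightarrow> M \<in> finite_monoids \<and>
    (\<forall>z\<in>carrier M. \<forall>x\<in>carrier M. omega_power M (z \<otimes>\<^bsub>M\<^esub> x) \<otimes>\<^bsub>M\<^esub> z = omega_power M (z \<otimes>\<^bsub>M\<^esub> x))"
  (is "_ \<longleftrightarrow> _ \<and> ?P")
proof (cases "M \<in> finite_monoids")
  case True
  interpret monoid M by (rule finite_monoidsD(1)[OF True])
  have "satisfies M (TOmega (zt \<star> xt 1) \<star> zt) (TOmega (zt \<star> xt 1)) \<longleftrightarrow> ?P"
    unfolding satisfies_iff[OF monoid_axioms]
  proof (intro iffI ballI allI impI)
    fix z x
    assume *: "\<forall>\<sigma>. range \<sigma> \<subseteq> carrier M \<longrightarrow> omega_ext M (word_eval M \<sigma>) (TOmega (zt \<star> xt 1) \<star> zt) =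
        omega_ext M (word_eval M \<sigma>) (TOmega (zt \<star> xt 1))" and zx: "z \<in> carrier M" "x \<in> carrier M"
    have "range (\<lambda>v. if v = Var_z then z else x) \<subseteq> carrier M" using zx by auto
    from *[rule_format, OF this] show "omega_power M (z \<otimes>\<^bsub>M\<^esub> x) \<otimes>\<^bsub>M\<^esub> z = omega_power M (z \<otimes>\<^bsub>M\<^esub> x)"
      using zx by simp
  next
    fix \<sigma> :: "variable \<Rightarrow> nat" assume *: ?P "range \<sigma> \<subseteq> carrier M"
    then have "\<sigma> v \<in> carrier M" for v by auto
    with *(1) show "omega_ext M (word_eval M \<sigma>) (TOmega (zt \<star> xt 1) \<star> zt) =
        omega_ext M (word_eval M \<sigma>) (TOmega (zt \<star> xt 1))" by simp
  qed
  with True show ?thesis by (simp add: equational_class_def)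
qed (auto simp: equational_class_def)

lemma L_level_2_iff:
  "M \<in> L_level (Suc (Suc 0)) \<longleftrightarrow> M \<in> finite_monoids \<and>
    (\<forall>z\<in>carrier M. \<forall>y\<in>carrier M. z \<otimes>\<^bsub>M\<^esub> omega_power M (y \<otimes>\<^bsub>M\<^esub> z) = omega_power M (y \<otimes>\<^bsub>M\<^esub> z))"
  (is "_ \<longleftrightarrow> _ \<and> ?P")
proof (cases "M \<in> finite_monoids")
  case True
  interpret monoid M by (rule finite_monoidsD(1)[OF True])
  have "satisfies M (zt \<star> TOmega (yt 1 \<star> zt)) (TOmega (yt 1 \<star> zt)) \<longleftrightarrow> ?P"
    unfolding satisfies_iff[OF monoid_axioms]
  proof (intro iffI ballI allI impI)
    fix z y
    assume *: "\<forall>\<sigma>. range \<sigma> \<subseteq> carrier M \<longrightarrow> omega_ext M (word_eval M \<sigma>) (zt \<star> TOmega (yt 1 \<star> zt)) =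
        omega_ext M (word_eval M \<sigma>) (TOmega (yt 1 \<star> zt))" and zy: "z \<in> carrier M" "y \<in> carrier M"
    have "range (\<lambda>v. if v = Var_z then z else y) \<subseteq> carrier M" using zy by auto
    from *[rule_format, OF this] show "z \<otimes>\<^bsub>M\<^esub> omega_power M (y \<otimes>\<^bsub>M\<^esub> z) = omega_power M (y \<otimes>\<^bsub>M\<^esub> z)"
      using zy by simp
  next
    fix \<sigma> :: "variable \<Rightarrow> nat" assume *: ?P "range \<sigma> \<subseteq> carrier M"
    then have "\<sigma> v \<in> carrier M" for v by auto
    with *(1) show "omega_ext M (word_eval M \<sigma>) (zt \<star> TOmega (yt 1 \<star> zt)) =
        omega_ext M (word_eval M \<sigma>) (TOmega (yt 1 \<star> zt))" by simp
  qed
  with True show ?thesis by (simp add: equational_class_def)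
qed (auto simp: equational_class_def)

lemma level_finite_monoids:
  "R_level (Suc (Suc k)) \<subseteq> finite_monoids" "L_level (Suc (Suc k)) \<subseteq> finite_monoids"
  by (cases k; auto simp: equational_class_def K_malcev_def D_malcev_def)+

text \<open>Reversal commutes with forming quotients and turns \<open>sim_D\<close> into
  \<open>sim_K\<close>. As the recursion alternates between the hierarchies, the induction
  hypothesis is used for the opposite monoid.\<close>

lemma L_level_iff_opposite:
  "M \<in> L_level (Suc (Suc k)) \<longleftrightarrow> opposite M \<in> R_level (Suc (Suc k))"
proof (induction k arbitrary: M)
  case 0
  show ?case
  proof (cases "M \<in> finite_monoids")
    case True
    note M = finite_monoidsD[OF True]
    show ?thesis
      unfolding L_level_2_iff R_level_2_iff
      using True by (simp add: finite_monoids_opposite omega_power_opposite[OF M] monoid.m_closed[OF M(1)])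
  next
    case False
    then show ?thesis using level_finite_monoids[of 0] finite_monoids_opposite by blast
  qed
next
  case (Suc k)
  have R_iff: "N \<in> R_level (Suc (Suc k)) \<longleftrightarrow> opposite N \<in> L_level (Suc (Suc k))" for N
    using Suc[of "opposite N"] by simp
  have "belongs_to Q (R_level (Suc (Suc k))) \<longleftrightarrow> belongs_to (opposite Q) (L_level (Suc (Suc k)))" for Q :: "nat set monoid"
  proof
    assume "belongs_to Q (R_level (Suc (Suc k)))"
    then obtain N where "N \<in> R_level (Suc (Suc k))" "Q \<cong> N" unfolding belongs_to_def by blast
    then show "belongs_to (opposite Q) (L_level (Suc (Suc k)))"
      unfolding belongs_to_def R_iff using opposite_iso by blast
  next
    assume "belongs_to (opposite Q) (L_level (Suc (Suc k)))"
    then obtain N where "N \<in> L_level (Suc (Suc k))" "opposite Q \<cong> N" unfolding belongs_to_def by blast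
    then have "opposite N \<in> R_level (Suc (Suc k))" "Q \<cong> opposite N"
      using Suc opposite_iso[of Q "opposite N"] by simp_all
    then show "belongs_to Q (R_level (Suc (Suc k)))" unfolding belongs_to_def by blast
  qed
  then show ?case
    by (simp add: K_malcev_def D_malcev_def finite_monoids_opposite quotient_monoid_opposite sim_D_opposite
        del: R_level.simps(1) L_level.simps(1))
qed

lemma hom_closed_L_level:
  assumes "hom_closed (R_level (Suc (Suc k)))" shows "hom_closed (L_level (Suc (Suc k)))"
  unfolding hom_closed_def
proof (intro ballI impI)
  fix M N h assume "M \<in> L_level (Suc (Suc k))" "N \<in> finite_monoids" "h \<in> monoid_homs M N"
    "h ` carrier M = carrier N"
  then have "opposite M \<in> R_level (Suc (Suc k))" "opposite N \<in> finite_monoids"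
    "h \<in> monoid_homs (opposite M) (opposite N)" "h ` carrier (opposite M) = carrier (opposite N)"
    by (simp_all only: L_level_iff_opposite finite_monoids_opposite monoid_homs_opposite opposite_simps)
  then have "opposite N \<in> R_level (Suc (Suc k))" using assms unfolding hom_closed_def by blast
  then show "N \<in> L_level (Suc (Suc k))" by (simp only: L_level_iff_opposite)
qed

lemma hom_closed_R_level: "hom_closed (R_level (Suc (Suc k)))"
proof (induction k)
  case 0
  show ?case by (simp add: hom_closed_equational_class)
next
  case (Suc k)
  show ?case
    using hom_closed_K_malcev[OF hom_closed_L_level[OF Suc] level_finite_monoids(2)] by simp
qed

section \<open>Quotients of words by relations of finite index\<close>

abbreviation words_over :: "'a set \<Rightarrow> 'a list monoid" where
  "words_over A \<equiv> free_monoid\<lparr>carrier := lists A\<rparr>"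

lemma monoid_words_over: "monoid (words_over A)"
  by (rule monoidI) auto

text \<open>Varieties consist of monoids on sets of naturals, so the quotient of the words over
  \<open>A\<close> by \<open>r\<close> enters through a copy \<open>N\<close> together with its
  canonical map \<open>f\<close>.\<close>

definition presents :: "'a set \<Rightarrow> ('a list \<Rightarrow> 'a list \<Rightarrow> bool) \<Rightarrow> nat monoid \<Rightarrow> ('a list \<Rightarrow> nat) \<Rightarrow> bool" where
  "presents A r N f \<longleftrightarrow> N \<in> finite_monoids \<and> f \<in> monoid_homs (words_over A) N \<and>
     f ` lists A = carrier N \<and> (\<forall>u\<in>lists A. \<forall>v\<in>lists A. f u = f v \<longleftrightarrow> r u v)"

lemma presentsD:
  assumes "presents A r N f"
  shows "N \<in> finite_monoids" "f \<in> monoid_homs (words_over A) N" "f ` lists A = carrier N"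
    "u \<in> lists A \<Longrightarrow> v \<in> lists A \<Longrightarrow> f u = f v \<longleftrightarrow> r u v"
    "u \<in> lists A \<Longrightarrow> v \<in> lists A \<Longrightarrow> f (u @ v) = f u \<otimes>\<^bsub>N\<^esub> f v" "f [] = \<one>\<^bsub>N\<^esub>"
    "u \<in> lists A \<Longrightarrow> f u \<in> carrier N"
  using assms monoid_homsD[of f "words_over A" N] unfolding presents_def by auto

text \<open>A labelling with finitely many values whose kernel is contained in \<open>r\<close>. In
  this form finiteness follows the recursion of \<open>refine\<close>, since labels can be combined
  without mentioning classes.\<close>

definition finite_index :: "'a set \<Rightarrow> ('a list \<Rightarrow> 'a list \<Rightarrow> bool) \<Rightarrow> bool" where
  "finite_index A r \<longleftrightarrow> (\<exists>f :: 'a list \<Rightarrow> nat. finite (f ` lists A) \<and>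
     (\<forall>u\<in>lists A. \<forall>v\<in>lists A. f u = f v \<longrightarrow> r u v))"

lemma finite_indexI:
  fixes f :: "'a list \<Rightarrow> 'b"
  assumes "finite (f ` lists A)" "\<And>u v. u \<in> lists A \<Longrightarrow> v \<in> lists A \<Longrightarrow> f u = f v \<Longrightarrow> r u v"
  shows "finite_index A r"
proof -
  obtain g :: "'b \<Rightarrow> nat" where g: "inj_on g (f ` lists A)"
    using finite_imp_inj_to_nat_seg[OF assms(1)] by blast
  have "finite ((\<lambda>u. g (f u)) ` lists A)" using assms(1) by (simp flip: image_image)
  moreover have "r u v" if "u \<in> lists A" "v \<in> lists A" "g (f u) = g (f v)" for u v
    using assms(2)[OF that(1,2)] inj_onD[OF g that(3)] that(1,2) by blast
  ultimately show ?thesis unfolding finite_index_def by blast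
qed

lemma finite_index_refine:
  assumes A: "finite A" and C: "finite_index A C"
  shows "finite_index A (refine C n)"
proof -
  obtain c :: "'a list \<Rightarrow> nat" where c: "finite (c ` lists A)"
    "\<And>u v. u \<in> lists A \<Longrightarrow> v \<in> lists A \<Longrightarrow> c u = c v \<Longrightarrow> C u v"
    using C unfolding finite_index_def by blast
  show ?thesis
  proof (induction n)
    case 0
    have "(\<lambda>u. (c u, set u)) ` lists A \<subseteq> c ` lists A \<times> Pow A" by auto
    then have "finite ((\<lambda>u. (c u, set u)) ` lists A)"
      by (rule finite_subset) (use A c(1) in simp)
    then show ?case by (rule finite_indexI) (use c(2) in simp)
  next
    case (Suc n)
    obtain d :: "'a list \<Rightarrow> nat" where d: "finite (d ` lists A)"
      "\<And>u v. u \<in> lists A \<Longrightarrow> v \<in> lists A \<Longrightarrow> d u = d v \<Longrightarrow> refine C n u v"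
      using Suc unfolding finite_index_def by blast
    \<comment> \<open>For every letter, the labels of the two parts at its first occurrence. Letters
      outside \<open>A\<close> always receive \<open>None\<close>, so only finitely many functions
      arise.\<close>
    define cut where "cut u a = (if a \<in> set u then Some (c (takeWhile (\<lambda>x. x \<noteq> a) u),
      set (takeWhile (\<lambda>x. x \<noteq> a) u), d (tl (dropWhile (\<lambda>x. x \<noteq> a) u))) else None)" for u a
    have cut: "cut (u0 @ a # u1) a = Some (c u0, set u0, d u1)" if "a \<notin> set u0" for u0 a u1
    proof -
      have "takeWhile (\<lambda>x. x \<noteq> a) (u0 @ a # u1) = u0" "dropWhile (\<lambda>x. x \<noteq> a) (u0 @ a # u1) = a # u1"
        using that by (induction u0) auto
      then show ?thesis by (simp add: cut_def)
    qed
    let ?B = "Some ` (c ` lists A \<times> Pow A \<times> d ` lists A) \<union> {None}"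
    have "cut u \<in> {g. \<forall>a. (a \<in> A \<longrightarrow> g a \<in> ?B) \<and> (a \<notin> A \<longrightarrow> g a = None)}" if u: "u \<in> lists A" for u
    proof -
      have "cut u a \<in> ?B" if "a \<in> set u" for a
      proof -
        obtain u0 u1 where *: "u = u0 @ a # u1" "a \<notin> set u0" using \<open>a \<in> set u\<close> by (meson split_list_first)
        then have "u0 \<in> lists A" "u1 \<in> lists A" using u by auto
        then show ?thesis using cut[OF *(2), of u1] *(1) by auto
      qed
      moreover have none: "cut u a = None" if "a \<notin> set u" for a using that by (simp add: cut_def)
      ultimately have "cut u a \<in> ?B" for a by (cases "a \<in> set u") simp_all
      moreover have "cut u a = None" if "a \<notin> A" for a using none that u by blast
      ultimately show ?thesis by simp
    qed
    then have "cut ` lists A \<subseteq> {g. \<forall>a. (a \<in> A \<longrightarrow> g a \<in> ?B) \<and> (a \<notin> A \<longrightarrow> g a = None)}" by (rule image_subsetI)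
    moreover have "finite {g. \<forall>a. (a \<in> A \<longrightarrow> g a \<in> ?B) \<and> (a \<notin> A \<longrightarrow> g a = None)}"
      by (rule finite_set_of_finite_funs) (use A c(1) d(1) in auto)
    ultimately have "finite (cut ` lists A)" by (rule finite_subset)
    then have "finite (c ` lists A \<times> Pow A \<times> cut ` lists A)" using A c(1) by simp
    moreover have "(\<lambda>u. (c u, set u, cut u)) ` lists A \<subseteq> c ` lists A \<times> Pow A \<times> cut ` lists A" by auto
    ultimately have "finite ((\<lambda>u. (c u, set u, cut u)) ` lists A)" by (rule finite_subset[rotated])
    then show ?case
    proof (rule finite_indexI)
      fix u v assume uv: "u \<in> lists A" "v \<in> lists A" "(c u, set u, cut u) = (c v, set v, cut v)"
      show "refine C (Suc n) u v"
      proof (rule refine_SucI)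
        show "C u v" "set u = set v" using c(2) uv by auto
      next
        fix a u0 u1 v0 v1
        assume *: "u = u0 @ a # u1" "v = v0 @ a # v1" "a \<notin> set u0" "a \<notin> set v0"
        then have "(c u0, set u0, d u1) = (c v0, set v0, d v1)"
          using cut[OF *(3), of u1] cut[OF *(4), of v1] uv(3) by simp
        moreover have "u0 \<in> lists A" "u1 \<in> lists A" "v0 \<in> lists A" "v1 \<in> lists A" using uv * by auto
        ultimately show "C u0 v0 \<and> set u0 = set v0 \<and> refine C n u1 v1" using c(2) d(2) by simp
      qed
    qed
  qed
qed

lemma finite_index_rev:
  assumes "finite_index A r" shows "finite_index A (\<lambda>u v. r (rev u) (rev v))"
proof -
  obtain f :: "'a list \<Rightarrow> nat" where f: "finite (f ` lists A)"
    "\<And>u v. u \<in> lists A \<Longrightarrow> v \<in> lists A \<Longrightarrow> f u = f v \<Longrightarrow> r u v"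
    using assms unfolding finite_index_def by blast
  have "(\<lambda>u. f (rev u)) ` lists A \<subseteq> f ` lists A" by (auto simp: lists_eq_set)
  then have "finite ((\<lambda>u. f (rev u)) ` lists A)" using f(1) by (rule finite_subset)
  then show ?thesis by (rule finite_indexI) (use f(2) in \<open>auto simp: lists_eq_set\<close>)
qed

lemma finite_index_R_rel: "finite A \<Longrightarrow> finite_index A (R_rel m n)"
proof (induction m arbitrary: n)
  case 0
  show ?case by (rule finite_indexI[of "\<lambda>_. ()"]) auto
next
  case (Suc m)
  have "finite_index A (L_rel m n)"
    using finite_index_rev[OF Suc.IH[OF Suc.prems]] by (simp add: L_rel_def[abs_def])
  then show ?case unfolding R_rel_Suc by (rule finite_index_refine[OF Suc.prems])
qed

lemma exists_presentation:
  assumes fin: "finite_index A r"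
    and refl: "\<And>u. r u u" and sym: "\<And>u v. r u v \<Longrightarrow> r v u" and trans: "\<And>u v w. r u v \<Longrightarrow> r v w \<Longrightarrow> r u w"
    and cong: "\<And>x u v y. r u v \<Longrightarrow> r (x @ u @ y) (x @ v @ y)"
  obtains N f where "presents A r N f"
proof -
  define s where "s = {(u, v). u \<in> lists A \<and> v \<in> lists A \<and> r u v}"
  have s: "equiv (carrier (words_over A)) s"
    by (rule equivI) (auto simp: s_def refl_on_def sym_def trans_def intro: refl sym trans)
  have s_iff: "s `` {u} = s `` {v} \<longleftrightarrow> r u v" if "u \<in> lists A" "v \<in> lists A" for u v
    using eq_equiv_class_iff[OF s, of u v] that by (simp add: s_def)
  have comp: "(a \<otimes>\<^bsub>words_over A\<^esub> b, a' \<otimes>\<^bsub>words_over A\<^esub> b') \<in> s" if "(a, a') \<in> s" "(b, b') \<in> s" for a a' b b'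
  proof -
    have "r (a @ b) (a' @ b)" "r (a' @ b) (a' @ b')"
      using cong[of a a' "[]" b] cong[of b b' a' "[]"] that by (auto simp: s_def)
    then have "r (a @ b) (a' @ b')" by (rule trans)
    then show ?thesis using that by (auto simp: s_def)
  qed
  note q = quotient_monoid[OF monoid_words_over s comp]
  let ?Q = "quotient_monoid (words_over A) s"
  obtain f :: "'a list \<Rightarrow> nat" where f: "finite (f ` lists A)"
    "\<And>u v. u \<in> lists A \<Longrightarrow> v \<in> lists A \<Longrightarrow> f u = f v \<Longrightarrow> r u v"
    using fin unfolding finite_index_def by blast
  \<comment> \<open>Each class is that of the representative chosen for its label, so the finitely
    many labels bound the number of classes.\<close>
  have "(\<lambda>u. s `` {u}) ` lists A \<subseteq> (\<lambda>n. s `` {inv_into (lists A) f n}) ` f ` lists A"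
  proof
    fix x assume "x \<in> (\<lambda>u. s `` {u}) ` lists A"
    then obtain u where u: "u \<in> lists A" "x = s `` {u}" by blast
    have "f u \<in> f ` lists A" using u(1) by (rule imageI)
    then have "inv_into (lists A) f (f u) \<in> lists A" "f (inv_into (lists A) f (f u)) = f u"
      by (rule inv_into_into f_inv_into_f)+
    then have "s `` {u} = s `` {inv_into (lists A) f (f u)}" using s_iff f(2) u(1) by simp
    then show "x \<in> (\<lambda>n. s `` {inv_into (lists A) f n}) ` f ` lists A" using u by blast
  qed
  then have "finite ((\<lambda>u. s `` {u}) ` lists A)" using f(1) by (rule finite_subset[OF _ finite_imageI])
  then have "finite (carrier ?Q)" using q(3) by simp
  with q(1) obtain N where N: "N \<in> finite_monoids" "?Q \<cong> N" by (rule finite_monoid_nat_copy)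
  obtain h k where h: "h \<in> monoid_homs ?Q N" "bij_betw h (carrier ?Q) (carrier N)"
    using iso_inverse_monoid_hom[OF N(2) finite_monoidsD(1)[OF N(1)] q(1)] by metis
  have "presents A r N (\<lambda>u. h (s `` {u}))"
    unfolding presents_def
  proof (intro conjI ballI)
    show "(\<lambda>u. h (s `` {u})) \<in> monoid_homs (words_over A) N" by (rule monoid_homs_compose[OF q(2) h(1)])
    show "(\<lambda>u. h (s `` {u})) ` lists A = carrier N"
      using image_image_eq[OF q(3) bij_betw_imp_surj_on[OF h(2)]] by simp
    show "h (s `` {u}) = h (s `` {v}) \<longleftrightarrow> r u v" if "u \<in> lists A" "v \<in> lists A" for u v
    proof -
      have "s `` {u} \<in> carrier ?Q" "s `` {v} \<in> carrier ?Q" using q(3) that by auto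
      then show ?thesis
        using inj_on_eq_iff[OF bij_betw_imp_inj_on[OF h(2)]] s_iff[OF that] by simp
    qed
  qed (rule N(1))
  then show ?thesis by (rule that)
qed

lemma R_rel_presentation:
  assumes "finite A" obtains N f where "presents A (R_rel m n) N f"
  using exists_presentation[OF finite_index_R_rel[OF assms], of m n] R_rel_refl R_rel_sym R_rel_trans R_rel_cong
  by metis

lemma L_rel_presentation:
  assumes "finite A" obtains N f where "presents A (L_rel m n) N f"
proof (rule exists_presentation)
  show "finite_index A (L_rel m n)"
    using finite_index_rev[OF finite_index_R_rel[OF assms]] by (simp add: L_rel_def[abs_def])
  show "L_rel m n u u" for u :: "'a list" unfolding L_rel_def by (rule R_rel_refl)
  show "L_rel m n v u" if "L_rel m n u v" for u v :: "'a list"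
    using that unfolding L_rel_def by (rule R_rel_sym)
  show "L_rel m n u w" if "L_rel m n u v" "L_rel m n v w" for u v w :: "'a list"
    using that unfolding L_rel_def by (rule R_rel_trans)
  show "L_rel m n (x @ u @ y) (x @ v @ y)" if "L_rel m n u v" for x u v y :: "'a list"
    using R_rel_cong[OF that[unfolded L_rel_def], of "rev y" "rev x"] by (simp add: L_rel_def)
qed

text \<open>Every letter has its first occurrence already within \<open>x @ e\<close>, so a cut uses
  up one factor \<open>e\<close> and leaves equal prefixes; \<open>x\<close> collects the remainder
  of the broken factor. After \<open>n\<close> cuts, \<open>n < k\<close> still leaves a factor,
  which makes the alphabets equal.\<close>

lemma refine_pow:
  assumes C: "\<And>u. C u u" "\<And>u v w. C u v \<Longrightarrow> C (w @ u) (w @ v)"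
    and uv: "C u v" "set u \<subseteq> set e" "set v \<subseteq> set e"
  shows "n < k \<Longrightarrow> refine C n (x @ word_pow k e @ u) (x @ word_pow k e @ v)"
proof (induction n arbitrary: k x)
  case 0
  have "C ((x @ word_pow k e) @ u) ((x @ word_pow k e) @ v)" by (rule C(2)[OF uv(1)])
  then show ?case using uv set_word_pow[OF 0, of e] by auto
next
  case (Suc n)
  then obtain l where k: "k = Suc l" "n < l" by (cases k) auto
  show ?case
  proof (rule refine_SucI)
    have "C ((x @ word_pow k e) @ u) ((x @ word_pow k e) @ v)" by (rule C(2)[OF uv(1)])
    then show "C (x @ word_pow k e @ u) (x @ word_pow k e @ v)" by simp
    have "0 < k" using k by simp
    show "set (x @ word_pow k e @ u) = set (x @ word_pow k e @ v)"
      using uv set_word_pow[OF \<open>0 < k\<close>, of e] by auto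
  next
    fix a u0 u1 v0 v1
    assume *: "x @ word_pow k e @ u = u0 @ a # u1" "x @ word_pow k e @ v = v0 @ a # v1"
      "a \<notin> set u0" "a \<notin> set v0"
    have "a \<in> set (x @ word_pow k e @ u)" unfolding *(1) by simp
    then have "a \<in> set (x @ e)" using uv(2) set_word_pow[of k e] k by auto
    then obtain p q where p: "x @ e = p @ a # q" "a \<notin> set p" by (meson split_list_first)
    have "x @ word_pow k e @ w = p @ a # (q @ word_pow l e @ w)" for w
      using p(1) unfolding k(1) word_pow_Suc by (metis append.assoc append_Cons)
    then have "u0 = p" "u1 = q @ word_pow l e @ u" "v0 = p" "v1 = q @ word_pow l e @ v"
      using * first_split_eq[OF *(3) p(2)] first_split_eq[OF *(4) p(2)] by metis+
    then show "C u0 v0 \<and> set u0 = set v0 \<and> refine C n u1 v1"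
      using C(1) Suc.IH[OF k(2)] by simp
  qed
qed

section \<open>The join\<close>

lemma presents_word_pow:
  assumes "presents A r N f" "u \<in> lists A"
  shows "word_pow k u \<in> lists A" "f (word_pow k u) = f u [^]\<^bsub>N\<^esub> k"
proof -
  interpret monoid N by (rule finite_monoidsD(1)[OF presentsD(1)[OF assms(1)]])
  have "word_pow k u \<in> lists A \<and> f (word_pow k u) = f u [^]\<^bsub>N\<^esub> k"
  proof (induction k)
    case 0
    show ?case using presentsD(6)[OF assms(1)] by simp
  next
    case (Suc k)
    then show ?case
      using presentsD(5)[OF assms(1), of "word_pow k u" u] assms(2) by (simp add: word_pow_Suc2)
  qed
  then show "word_pow k u \<in> lists A" "f (word_pow k u) = f u [^]\<^bsub>N\<^esub> k" by auto
qed

lemma presents_R_rel_absorb: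
  assumes N: "presents A (R_rel (Suc m) n) N f"
    and w: "e \<in> lists A" "u \<in> lists A" "v \<in> lists A"
    and "L_rel m n u v" "set u \<subseteq> set e" "set v \<subseteq> set e" "n < k"
  shows "f e [^]\<^bsub>N\<^esub> k \<otimes>\<^bsub>N\<^esub> f u = f e [^]\<^bsub>N\<^esub> k \<otimes>\<^bsub>N\<^esub> f v"
proof -
  have "refine (L_rel m n) n ([] @ word_pow k e @ u) ([] @ word_pow k e @ v)"
  proof (rule refine_pow)
    show "L_rel m n w w" for w :: "'a list" unfolding L_rel_def by (rule R_rel_refl)
    show "L_rel m n (w @ x) (w @ y)" if "L_rel m n x y" for x y w :: "'a list"
      using R_rel_cong[OF that[unfolded L_rel_def], of "[]" "rev w"] by (simp add: L_rel_def)
  qed (use assms in auto)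
  then have "f (word_pow k e @ u) = f (word_pow k e @ v)"
    using presentsD(4)[OF N] presents_word_pow(1)[OF N w(1)] w(2,3) by (simp add: R_rel_Suc)
  then show ?thesis using presentsD(5)[OF N] presents_word_pow[OF N w(1)] w(2,3) by simp
qed

lemma presents_L_rel_opposite:
  assumes N: "presents A (L_rel m n) N f"
  shows "presents A (R_rel m n) (opposite N) (\<lambda>u. f (rev u))"
  unfolding presents_def
proof (intro conjI ballI)
  have rev: "rev u \<in> lists A" if "u \<in> lists A" for u using that by (simp add: lists_eq_set)
  show "opposite N \<in> finite_monoids" using presentsD(1)[OF N] finite_monoids_opposite by blast
  show "(\<lambda>u. f (rev u)) \<in> monoid_homs (words_over A) (opposite N)"
    using presentsD(5-7)[OF N] rev by (intro monoid_homsI) auto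
  have "u \<in> rev ` lists A" if "u \<in> lists A" for u
    using imageI[OF rev[OF that], of rev] by simp
  then have "rev ` lists A = lists A" using rev by blast
  then show "(\<lambda>u. f (rev u)) ` lists A = carrier (opposite N)"
    using presentsD(3)[OF N] by (simp flip: image_image)
  show "f (rev u) = f (rev v) \<longleftrightarrow> R_rel m n u v" if "u \<in> lists A" "v \<in> lists A" for u v
    using presentsD(4)[OF N rev[OF that(1)] rev[OF that(2)]] by (simp add: L_rel_def)
qed

text \<open>The quotient by \<open>L_rel (Suc k) n\<close> lies in the preceding level by induction
  and reversal, and it maps onto the quotient of \<open>N\<close> by \<open>sim_K\<close>: if
  \<open>e u s = e\<close>, then \<open>u\<close> has only letters of a word representing
  \<open>e\<close>, and \<open>e = e^(n + 1)\<close> is a high enough power to absorb the difference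
  between \<open>u\<close> and \<open>v\<close>. At level 2 the same absorption is used with
  \<open>v\<close> empty.\<close>

lemma R_rel_presents_R_level:
  "finite A \<Longrightarrow> presents A (R_rel (Suc k) n) N f \<Longrightarrow> N \<in> R_level (Suc (Suc k))"
proof (induction k arbitrary: n N f)
  case 0
  note N = 0(2)
  interpret monoid N by (rule finite_monoidsD(1)[OF presentsD(1)[OF N]])
  show ?case
    unfolding R_level_2_iff
  proof (intro conjI ballI)
    fix z x assume "z \<in> carrier N" "x \<in> carrier N"
    then obtain Z Y where Z: "Z \<in> lists A" "z = f Z" and Y: "Y \<in> lists A" "x = f Y"
      using presentsD(3)[OF N] by blast
    have y: "z \<otimes>\<^bsub>N\<^esub> x = f (Z @ Y)" "f (Z @ Y) \<in> carrier N" "Z @ Y \<in> lists A"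
      using presentsD(5,7)[OF N] Z Y by auto
    obtain k :: nat where k: "0 < k" "idempotent N (f (Z @ Y) [^]\<^bsub>N\<^esub> k)"
      using exists_idempotent_pow[OF finite_monoidsD(2)[OF presentsD(1)[OF N]] y(2)] by blast
    \<comment> \<open>The exponent has to exceed \<open>n\<close> for the absorption and still yield
      the idempotent, hence the multiple \<open>k * Suc n\<close>.\<close>
    have "f (Z @ Y) [^]\<^bsub>N\<^esub> (k * Suc n) = f (Z @ Y) [^]\<^bsub>N\<^esub> k"
      using idempotent_pow[OF k(2), of "Suc n"] unfolding nat_pow_pow[OF y(2)] by blast
    then have om: "omega_power N (f (Z @ Y)) = f (Z @ Y) [^]\<^bsub>N\<^esub> (k * Suc n)"
      using omega_power_eq[OF y(2) k] by simp
    have "n < k * Suc n" using k(1) by (cases k) auto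
    then have "f (Z @ Y) [^]\<^bsub>N\<^esub> (k * Suc n) \<otimes>\<^bsub>N\<^esub> f Z = f (Z @ Y) [^]\<^bsub>N\<^esub> (k * Suc n) \<otimes>\<^bsub>N\<^esub> f []"
      using Z Y y by (intro presents_R_rel_absorb[OF N]) (auto simp: L_rel_def)
    then show "omega_power N (z \<otimes>\<^bsub>N\<^esub> x) \<otimes>\<^bsub>N\<^esub> z = omega_power N (z \<otimes>\<^bsub>N\<^esub> x)"
      using Z(2) y om presentsD(6)[OF N] by simp
  qed (rule presentsD(1)[OF N])
next
  case (Suc k)
  note N = Suc.prems(2)
  have mN: "monoid N" by (rule finite_monoidsD(1)[OF presentsD(1)[OF N]])
  interpret monoid N by fact
  obtain P g where P: "presents A (L_rel (Suc k) n) P g" using L_rel_presentation[OF Suc.prems(1)] by blast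
  have "opposite P \<in> R_level (Suc (Suc k))"
    by (rule Suc.IH[OF Suc.prems(1) presents_L_rel_opposite[OF P]])
  then have PL: "P \<in> L_level (Suc (Suc k))" unfolding L_level_iff_opposite .
  have half: "e \<otimes>\<^bsub>N\<^esub> f u = e \<otimes>\<^bsub>N\<^esub> f v"
    if *: "u \<in> lists A" "v \<in> lists A" "L_rel (Suc k) n u v" "idempotent N e" "s \<in> carrier N"
      "e \<otimes>\<^bsub>N\<^esub> f u \<otimes>\<^bsub>N\<^esub> s = e" for e s u v
  proof -
    have "e \<in> carrier N" using *(4) by (simp add: idempotent_def)
    then obtain E S where E: "E \<in> lists A" "e = f E" and S: "S \<in> lists A" "s = f S"
      using presentsD(3)[OF N] *(5) by blast
    have "f (E @ u @ S) = f E"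
      using *(6) presentsD(5)[OF N] presentsD(7)[OF N] E S *(1) by (simp add: m_assoc)
    then have "R_rel (Suc (Suc k)) n (E @ u @ S) E" using presentsD(4)[OF N] E S *(1) by simp
    then have "set (E @ u @ S) = set E" by (rule R_rel_set)
    then have "set u \<subseteq> set E" by auto
    moreover have "set u = set v" by (rule L_rel_set[OF *(3)])
    ultimately have "f E [^]\<^bsub>N\<^esub> Suc n \<otimes>\<^bsub>N\<^esub> f u = f E [^]\<^bsub>N\<^esub> Suc n \<otimes>\<^bsub>N\<^esub> f v"
      using E *(1-3) by (intro presents_R_rel_absorb[OF N]) auto
    then show ?thesis using idempotent_pow[OF *(4), of "Suc n"] E(2) by simp
  qed
  have sim: "(f u, f v) \<in> sim_K N" if "u \<in> lists A" "v \<in> lists A" "L_rel (Suc k) n u v" for u v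
  proof (rule sim_KI[OF mN])
    fix e s assume es: "idempotent N e" "s \<in> carrier N"
      "e \<otimes>\<^bsub>N\<^esub> f u \<otimes>\<^bsub>N\<^esub> s = e \<or> e \<otimes>\<^bsub>N\<^esub> f v \<otimes>\<^bsub>N\<^esub> s = e"
    have vu: "L_rel (Suc k) n v u" using that(3) unfolding L_rel_def by (rule R_rel_sym)
    from es(3) show "e \<otimes>\<^bsub>N\<^esub> f u = e \<otimes>\<^bsub>N\<^esub> f v"
      using half[OF that es(1,2)] half[OF that(2,1) vu es(1,2)] by (elim disjE) simp_all
  qed (use presentsD(7)[OF N] that in auto)
  note q = quotient_sim_K[OF mN]
  let ?q = "\<lambda>u. sim_K N `` {f u}"
  have q': "?q \<in> monoid_homs (words_over A) (quotient_monoid N (sim_K N))"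
    "?q ` lists A = carrier (quotient_monoid N (sim_K N))"
    by (rule monoid_homs_compose[OF presentsD(2)[OF N] q(2)] image_image_eq[OF presentsD(3)[OF N] q(3)])+
  have ker: "?q u = ?q v" if "u \<in> carrier (words_over A)" "v \<in> carrier (words_over A)" "g u = g v" for u v
    using equiv_class_eq[OF equiv_sim_K sim[of u v]] presentsD(4)[OF P, of u v] that by simp
  have "g ` carrier (words_over A) = carrier P" using presentsD(3)[OF P] by simp
  then obtain l where l: "l \<in> monoid_homs P (quotient_monoid N (sim_K N))"
    "\<And>u. u \<in> carrier (words_over A) \<Longrightarrow> l (g u) = ?q u"
    using hom_factor[OF monoid_words_over presentsD(2)[OF P] _ q'(1) ker] by blast
  have "l ` carrier P = carrier (quotient_monoid N (sim_K N))"
    unfolding presentsD(3)[OF P, symmetric] q'(2)[symmetric] image_image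
    by (rule image_cong[OF HOL.refl l(2)]) simp
  then have "belongs_to (quotient_monoid N (sim_K N)) (L_level (Suc (Suc k)))"
    by (rule belongs_to_hom_image[OF hom_closed_L_level[OF hom_closed_R_level] PL level_finite_monoids(2) q(1) l(1)])
  then show ?case using presentsD(1)[OF N] by (simp add: K_malcev_def)
qed

lemma L_rel_presents_L_level:
  "finite A \<Longrightarrow> presents A (L_rel (Suc k) n) N f \<Longrightarrow> N \<in> L_level (Suc (Suc k))"
  unfolding L_level_iff_opposite by (rule R_rel_presents_R_level[OF _ presents_L_rel_opposite])

section \<open>The levels satisfy the identities of W\<close>

lemma equational_class_quotient:
  assumes M: "monoid M" "finite (carrier M)" and r: "equiv (carrier M) r"
    and compat: "\<And>a a' b b'. (a, a') \<in> r \<Longrightarrow> (b, b') \<in> r \<Longrightarrow> (a \<otimes>\<^bsub>M\<^esub> b, a' \<otimes>\<^bsub>M\<^esub> b') \<in> r"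
    and belongs: "belongs_to (quotient_monoid M r) (equational_class u v)"
    and \<phi>: "\<phi> \<in> monoid_homs free_monoid M"
  shows "(omega_ext M \<phi> u, omega_ext M \<phi> v) \<in> r"
proof -
  note q = quotient_monoid[OF M(1) r compat]
  obtain P where P: "P \<in> equational_class u v" "quotient_monoid M r \<cong> P"
    using belongs unfolding belongs_to_def by blast
  have P': "monoid P" "satisfies P u v" using P(1) by (auto simp: equational_class_def finite_monoids_def)
  obtain h k where h: "h \<in> monoid_homs (quotient_monoid M r) P"
    "bij_betw h (carrier (quotient_monoid M r)) (carrier P)"
    using iso_inverse_monoid_hom[OF P(2) P'(1) q(1)] by metis
  let ?h = "\<lambda>x. h (r `` {x})"
  have hom: "?h \<in> monoid_homs M P" by (rule monoid_homs_compose[OF q(2) h(1)])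
  have "(\<lambda>w. ?h (\<phi> w)) \<in> monoid_homs free_monoid P" by (rule monoid_homs_compose[OF \<phi> hom])
  then have "omega_ext P (\<lambda>w. ?h (\<phi> w)) u = omega_ext P (\<lambda>w. ?h (\<phi> w)) v"
    using P'(2) unfolding satisfies_def by blast
  then have eq: "?h (omega_ext M \<phi> u) = ?h (omega_ext M \<phi> v)"
    unfolding omega_ext_hom[OF hom M P'(1) \<phi>] .
  have c: "omega_ext M \<phi> u \<in> carrier M" "omega_ext M \<phi> v \<in> carrier M" by (rule omega_ext_closed[OF \<phi> M])+
  then have "r `` {omega_ext M \<phi> u} \<in> carrier (quotient_monoid M r)"
    "r `` {omega_ext M \<phi> v} \<in> carrier (quotient_monoid M r)" using q(3) by auto
  then have "r `` {omega_ext M \<phi> u} = r `` {omega_ext M \<phi> v}"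
    using eq inj_on_eq_iff[OF bij_betw_imp_inj_on[OF h(2)]] by simp
  then show ?thesis using eq_equiv_class_iff[OF r c] by simp
qed

text \<open>With \<open>E = (U x)^omega\<close> and \<open>F = (y U)^omega\<close>, the identity of
  level \<open>Suc m\<close> reads \<open>E U F = E V F\<close>, so it is enough that one of
  \<open>E\<close>, \<open>F\<close> identifies \<open>U\<close> with \<open>V\<close>. The first
  alternative serves the \<R>-levels, the second the \<L>-levels.\<close>

lemma W_levelI:
  assumes M: "M \<in> finite_monoids" and m: "1 \<le> m"
    and *: "\<And>\<phi> U V x y. \<phi> \<in> monoid_homs free_monoid M \<Longrightarrow> U = omega_ext M \<phi> (W_lhs m) \<Longrightarrow>
      V = omega_ext M \<phi> (W_rhs m) \<Longrightarrow> U \<in> carrier M \<Longrightarrow> V \<in> carrier M \<Longrightarrow> x \<in> carrier M \<Longrightarrow> y \<in> carrier M \<Longrightarrow>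
      omega_power M (U \<otimes>\<^bsub>M\<^esub> x) \<otimes>\<^bsub>M\<^esub> U = omega_power M (U \<otimes>\<^bsub>M\<^esub> x) \<otimes>\<^bsub>M\<^esub> V \<or>
      U \<otimes>\<^bsub>M\<^esub> omega_power M (y \<otimes>\<^bsub>M\<^esub> U) = V \<otimes>\<^bsub>M\<^esub> omega_power M (y \<otimes>\<^bsub>M\<^esub> U)"
  shows "M \<in> W_level (Suc m)"
proof -
  note M' = finite_monoidsD[OF M]
  interpret monoid M by (rule M'(1))
  have "satisfies M (W_lhs (Suc m)) (W_rhs (Suc m))"
    unfolding satisfies_def
  proof
    fix \<phi> :: "variable list \<Rightarrow> nat" assume \<phi>: "\<phi> \<in> monoid_homs free_monoid M"
    let ?o = "omega_ext M \<phi>"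
    note c = omega_ext_closed[OF \<phi> M']
    define U where "U = ?o (W_lhs m)"
    define V where "V = ?o (W_rhs m)"
    define x where "x = \<phi> [Var_x m]"
    define y where "y = \<phi> [Var_y m]"
    define E where "E = omega_power M (U \<otimes>\<^bsub>M\<^esub> x)"
    define F where "F = omega_power M (y \<otimes>\<^bsub>M\<^esub> U)"
    have xy: "x \<in> carrier M" "y \<in> carrier M" unfolding x_def y_def by (rule free_homD(1)[OF \<phi>])+
    have z: "\<phi> [Var_z] \<in> carrier M" by (rule free_homD(1)[OF \<phi>])
    have UV: "U \<in> carrier M" "V \<in> carrier M" unfolding U_def V_def by (rule c)+
    have EF: "E \<in> carrier M" "F \<in> carrier M"
      unfolding E_def F_def using UV xy omega_power_closed[OF M'(2)] by auto
    have U: "U = ?o (e_prod m) \<otimes>\<^bsub>M\<^esub> \<phi> [Var_z] \<otimes>\<^bsub>M\<^esub> ?o (f_prod m)"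
      and V: "V = ?o (e_prod m) \<otimes>\<^bsub>M\<^esub> ?o (f_prod m)" by (simp_all add: U_def V_def)
    have "y \<otimes>\<^bsub>M\<^esub> ?o (e_prod m) \<otimes>\<^bsub>M\<^esub> \<phi> [Var_z] \<otimes>\<^bsub>M\<^esub> ?o (f_prod m) = y \<otimes>\<^bsub>M\<^esub> U"
      unfolding U using xy z c by (simp add: m_assoc)
    then have e: "?o (e_prod (Suc m)) = E \<otimes>\<^bsub>M\<^esub> ?o (e_prod m)"
      and f: "?o (f_prod (Suc m)) = ?o (f_prod m) \<otimes>\<^bsub>M\<^esub> F"
      unfolding e_prod_Suc[OF m] f_prod_Suc[OF m] E_def F_def U_def x_def y_def by simp_all
    have 1: "?o (W_lhs (Suc m)) = E \<otimes>\<^bsub>M\<^esub> U \<otimes>\<^bsub>M\<^esub> F"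
      unfolding U omega_ext.simps e f using z c EF by (simp add: m_assoc)
    have 2: "?o (W_rhs (Suc m)) = E \<otimes>\<^bsub>M\<^esub> V \<otimes>\<^bsub>M\<^esub> F"
      unfolding V omega_ext.simps e f using c EF by (simp add: m_assoc)
    from *[OF \<phi> U_def V_def UV xy] have "E \<otimes>\<^bsub>M\<^esub> U = E \<otimes>\<^bsub>M\<^esub> V \<or> U \<otimes>\<^bsub>M\<^esub> F = V \<otimes>\<^bsub>M\<^esub> F"
      unfolding E_def F_def .
    then have "E \<otimes>\<^bsub>M\<^esub> U \<otimes>\<^bsub>M\<^esub> F = E \<otimes>\<^bsub>M\<^esub> V \<otimes>\<^bsub>M\<^esub> F"
      using UV EF by (elim disjE) (simp_all add: m_assoc)
    then show "?o (W_lhs (Suc m)) = ?o (W_rhs (Suc m))" unfolding 1 2 .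
  qed
  then show ?thesis using M by (simp add: W_level_def equational_class_def)
qed

text \<open>The idempotent \<open>(U x)^omega\<close> stays in its \<R>-class when multiplied by
  \<open>U\<close>, since \<open>x\<close> and further factors \<open>U x\<close> lead back to
  it.\<close>

lemma sim_K_omega_power:
  assumes M: "monoid M" "finite (carrier M)" and UV: "(U, V) \<in> sim_K M" and x: "x \<in> carrier M"
  shows "omega_power M (U \<otimes>\<^bsub>M\<^esub> x) \<otimes>\<^bsub>M\<^esub> U = omega_power M (U \<otimes>\<^bsub>M\<^esub> x) \<otimes>\<^bsub>M\<^esub> V"
proof -
  interpret monoid M by fact
  have U: "U \<in> carrier M" using UV by (auto simp: sim_K_def)
  have Ux: "U \<otimes>\<^bsub>M\<^esub> x \<in> carrier M" using U x by simp
  obtain k :: nat where k: "0 < k" "idempotent M ((U \<otimes>\<^bsub>M\<^esub> x) [^]\<^bsub>M\<^esub> k)"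
    using exists_idempotent_pow[OF M(2) Ux] by blast
  let ?e = "(U \<otimes>\<^bsub>M\<^esub> x) [^]\<^bsub>M\<^esub> k"
  obtain l where l: "k = Suc l" using k(1) by (cases k) auto
  have "?e = ?e \<otimes>\<^bsub>M\<^esub> ?e" using k(2) by (simp add: idempotent_def)
  also have "\<dots> = ?e \<otimes>\<^bsub>M\<^esub> (U \<otimes>\<^bsub>M\<^esub> x \<otimes>\<^bsub>M\<^esub> (U \<otimes>\<^bsub>M\<^esub> x) [^]\<^bsub>M\<^esub> l)"
    unfolding l nat_pow_Suc2[OF Ux] ..
  also have "\<dots> = ?e \<otimes>\<^bsub>M\<^esub> U \<otimes>\<^bsub>M\<^esub> (x \<otimes>\<^bsub>M\<^esub> (U \<otimes>\<^bsub>M\<^esub> x) [^]\<^bsub>M\<^esub> l)"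
    using U x Ux by (simp add: m_assoc)
  finally have "?e \<otimes>\<^bsub>M\<^esub> U = ?e \<otimes>\<^bsub>M\<^esub> V"
    using x Ux by (intro sim_KD[OF M(1) UV k(2) _ disjI1[OF HOL.sym]]) auto
  then show ?thesis unfolding omega_power_eq[OF Ux k] .
qed

lemma level_subset_W_level:
  "R_level (Suc (Suc k)) \<subseteq> W_level (Suc (Suc k)) \<and> L_level (Suc (Suc k)) \<subseteq> W_level (Suc (Suc k))"
proof (induction k)
  case 0
  \<comment> \<open>At level 1 the sides are \<open>z\<close> and \<open>1\<close>, so that the two
    alternatives of \<open>W_levelI\<close> become the defining identities of
    \<open>R_level 2\<close> and \<open>L_level 2\<close>.\<close>
  have UV: "omega_ext M \<phi> (W_lhs (Suc 0)) = \<phi> [Var_z]" "omega_ext M \<phi> (W_rhs (Suc 0)) = \<one>\<^bsub>M\<^esub>"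
    if "monoid M" "\<phi> \<in> monoid_homs free_monoid M" for M :: "nat monoid" and \<phi>
    using that free_homD[OF that(2)] by (simp_all add: monoid.l_one monoid.r_one monoid.one_closed)
  have "M \<in> W_level (Suc (Suc 0))" if "M \<in> R_level (Suc (Suc 0)) \<or> M \<in> L_level (Suc (Suc 0))" for M
  proof -
    have M: "M \<in> finite_monoids" using that level_finite_monoids[of 0] by blast
    interpret monoid M by (rule finite_monoidsD(1)[OF M])
    note oc = omega_power_closed[OF finite_monoidsD(2)[OF M]]
    show ?thesis
    proof (rule W_levelI[OF M])
      fix \<phi> U V x y
      assume \<phi>: "\<phi> \<in> monoid_homs free_monoid M" and U: "U = omega_ext M \<phi> (W_lhs (Suc 0))"
        and V: "V = omega_ext M \<phi> (W_rhs (Suc 0))" and c: "U \<in> carrier M" "x \<in> carrier M" "y \<in> carrier M"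
      have "V = \<one>\<^bsub>M\<^esub>" using UV(2)[OF monoid_axioms \<phi>] V by simp
      then show "omega_power M (U \<otimes>\<^bsub>M\<^esub> x) \<otimes>\<^bsub>M\<^esub> U = omega_power M (U \<otimes>\<^bsub>M\<^esub> x) \<otimes>\<^bsub>M\<^esub> V \<or>
          U \<otimes>\<^bsub>M\<^esub> omega_power M (y \<otimes>\<^bsub>M\<^esub> U) = V \<otimes>\<^bsub>M\<^esub> omega_power M (y \<otimes>\<^bsub>M\<^esub> U)"
        using that c oc unfolding R_level_2_iff L_level_2_iff by auto
    qed simp
  qed
  then show ?case by blast
next
  case (Suc k)
  let ?m = "Suc (Suc k)"
  have R: "M \<in> W_level (Suc ?m)" if M: "M \<in> R_level (Suc ?m)" for M
  proof -
    have fm: "M \<in> finite_monoids" using M by (simp add: K_malcev_def)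
    note M' = finite_monoidsD[OF fm]
    have "belongs_to (quotient_monoid M (sim_K M)) (equational_class (W_lhs ?m) (W_rhs ?m))"
      using M Suc unfolding W_level_def belongs_to_def K_malcev_def R_level.simps(2) by blast
    note sim = equational_class_quotient[OF M' equiv_sim_K sim_K_compat[OF M'(1)] this]
    show ?thesis
    proof (rule W_levelI[OF fm])
      fix \<phi> U V x y
      assume "\<phi> \<in> monoid_homs free_monoid M" "U = omega_ext M \<phi> (W_lhs ?m)"
        "V = omega_ext M \<phi> (W_rhs ?m)" and x: "x \<in> carrier M"
      then have "(U, V) \<in> sim_K M" using sim by simp
      from sim_K_omega_power[OF M' this x]
      show "omega_power M (U \<otimes>\<^bsub>M\<^esub> x) \<otimes>\<^bsub>M\<^esub> U = omega_power M (U \<otimes>\<^bsub>M\<^esub> x) \<otimes>\<^bsub>M\<^esub> V \<or>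
          U \<otimes>\<^bsub>M\<^esub> omega_power M (y \<otimes>\<^bsub>M\<^esub> U) = V \<otimes>\<^bsub>M\<^esub> omega_power M (y \<otimes>\<^bsub>M\<^esub> U)" ..
    qed simp
  qed
  have L: "M \<in> W_level (Suc ?m)" if M: "M \<in> L_level (Suc ?m)" for M
  proof -
    have fm: "M \<in> finite_monoids" using M by (simp add: D_malcev_def)
    note M' = finite_monoidsD[OF fm]
    have O: "monoid (opposite M)" "finite (carrier (opposite M))" using M' monoid_opposite by auto
    have bel: "belongs_to (quotient_monoid M (sim_D M)) (equational_class (W_lhs ?m) (W_rhs ?m))"
      using M Suc unfolding W_level_def belongs_to_def D_malcev_def L_level.simps(2) by blast
    have equiv: "equiv (carrier M) (sim_D M)"
      using equiv_sim_K[of "opposite M"] by (simp add: sim_D_opposite)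
    have compat: "(a \<otimes>\<^bsub>M\<^esub> b, a' \<otimes>\<^bsub>M\<^esub> b') \<in> sim_D M" if "(a, a') \<in> sim_D M" "(b, b') \<in> sim_D M" for a a' b b'
      using sim_K_compat[OF O(1), of b b' a a'] that by (simp add: sim_D_opposite)
    note sim = equational_class_quotient[OF M' equiv compat bel]
    show ?thesis
    proof (rule W_levelI[OF fm])
      fix \<phi> U V x y
      assume "\<phi> \<in> monoid_homs free_monoid M" "U = omega_ext M \<phi> (W_lhs ?m)"
        "V = omega_ext M \<phi> (W_rhs ?m)" and U: "U \<in> carrier M" and y: "y \<in> carrier M"
      then have "(U, V) \<in> sim_K (opposite M)" using sim by (simp add: sim_D_opposite)
      from sim_K_omega_power[OF O this, of y] y U
      have "U \<otimes>\<^bsub>M\<^esub> omega_power M (y \<otimes>\<^bsub>M\<^esub> U) = V \<otimes>\<^bsub>M\<^esub> omega_power M (y \<otimes>\<^bsub>M\<^esub> U)"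
        using omega_power_opposite[OF M'] monoid.m_closed[OF M'(1)] by simp
      then show "omega_power M (U \<otimes>\<^bsub>M\<^esub> x) \<otimes>\<^bsub>M\<^esub> U = omega_power M (U \<otimes>\<^bsub>M\<^esub> x) \<otimes>\<^bsub>M\<^esub> V \<or>
          U \<otimes>\<^bsub>M\<^esub> omega_power M (y \<otimes>\<^bsub>M\<^esub> U) = V \<otimes>\<^bsub>M\<^esub> omega_power M (y \<otimes>\<^bsub>M\<^esub> U)" ..
    qed simp
  qed
  from R L show ?case by blast
qed

section \<open>From members of W to word congruences and into every variety above the levels\<close>

lemma word_ext_hom:
  assumes M: "monoid M" and N: "0 < N" "\<And>x. x \<in> carrier M \<Longrightarrow> idempotent M (x [^]\<^bsub>M\<^esub> N)"
    and \<phi>: "\<phi> \<in> monoid_homs free_monoid M"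
  shows "\<phi> (word_ext N \<sigma> t) = omega_ext M (\<lambda>w. \<phi> (concat (map \<sigma> w))) t"
proof -
  have pow: "\<phi> (word_pow k w) = \<phi> w [^]\<^bsub>M\<^esub> k" for k :: nat and w
    by (induction k) (simp_all add: free_homD[OF \<phi>] word_pow_Suc2 monoid.nat_pow_0[OF M] monoid.nat_pow_Suc[OF M])
  show ?thesis
  proof (induction t)
    case (TOmega t)
    have "\<phi> (word_ext N \<sigma> t) \<in> carrier M" by (rule free_homD(1)[OF \<phi>])
    from monoid.omega_power_eq[OF M this N(1) N(2)[OF this]] TOmega show ?case by (simp add: pow)
  qed (simp_all add: free_homD[OF \<phi>])
qed

lemma W_level_W_congruence:
  fixes \<phi> :: "'a list \<Rightarrow> nat"
  assumes M: "M \<in> W_level (Suc m)" and m: "1 \<le> m" and \<phi>: "\<phi> \<in> monoid_homs free_monoid M"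
  obtains N where "W_congruence (\<lambda>u v. \<phi> u = \<phi> v) N m"
proof -
  have fm: "M \<in> finite_monoids" and sat: "satisfies M (W_lhs (Suc m)) (W_rhs (Suc m))"
    using M by (auto simp: W_level_def equational_class_def)
  note M' = finite_monoidsD[OF fm]
  obtain N :: nat where N: "0 < N" "\<And>x. x \<in> carrier M \<Longrightarrow> idempotent M (x [^]\<^bsub>M\<^esub> N)"
    using monoid.exists_exponent[OF M'] by metis
  interpret w: word_congruence "\<lambda>u v. \<phi> u = \<phi> v"
    by standard (auto simp: free_homD[OF \<phi>])
  have "W_congruence (\<lambda>u v. \<phi> u = \<phi> v) N m"
  proof unfold_locales
    have "range w.cls = (\<lambda>x. {v. x = \<phi> v}) ` range \<phi>"
      unfolding w.cls_def image_image by simp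
    moreover have "finite (range \<phi>)"
      by (rule finite_subset[OF _ M'(2)]) (use free_homD(1)[OF \<phi>] in blast)
    ultimately show "finite (range w.cls)" by simp
    show "\<phi> (word_pow N w @ word_pow N w) = \<phi> (word_pow N w)" for w
    proof -
      have "\<phi> (word_pow N w) = omega_power M (\<phi> w)"
        using word_ext_hom[OF M'(1) N \<phi>, of "\<lambda>_ :: unit. w" "TOmega (TVar ())"] by simp
      moreover have "idempotent M (omega_power M (\<phi> w))"
        by (rule monoid.omega_power_idempotent[OF M' free_homD(1)[OF \<phi>]])
      ultimately show ?thesis by (simp add: free_homD(2)[OF \<phi>] idempotent_def)
    qed
    show "w.satisfies_W N (Suc m)"
      unfolding w.satisfies_W_def
    proof
      fix \<sigma> :: "variable \<Rightarrow> 'a list"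
      have "(\<lambda>w. \<phi> (concat (map \<sigma> w))) \<in> monoid_homs free_monoid M"
        by (rule monoid_homsI) (simp_all add: free_homD[OF \<phi>])
      with sat have "omega_ext M (\<lambda>w. \<phi> (concat (map \<sigma> w))) (W_lhs (Suc m)) =
          omega_ext M (\<lambda>w. \<phi> (concat (map \<sigma> w))) (W_rhs (Suc m))"
        unfolding satisfies_def by (rule bspec)
      moreover have "\<phi> (word_ext N \<sigma> t) = omega_ext M (\<lambda>w. \<phi> (concat (map \<sigma> w))) t" for t
        by (rule word_ext_hom[OF M'(1) N(1) _ \<phi>]) (rule N(2))
      ultimately show "\<phi> (word_ext N \<sigma> (W_lhs (Suc m))) = \<phi> (word_ext N \<sigma> (W_rhs (Suc m)))"
        by (simp only:)
    qed
  qed (use N(1) m in auto)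
  then show ?thesis by (rule that)
qed

text \<open>The map of the words into \<open>N1 \<times> N2\<close> has the intersection of
  \<open>r\<close> and \<open>s\<close> as its kernel, so \<open>g\<close> factors through its
  image, a submonoid. The product is replaced by a copy on naturals to be a member of
  \<open>V\<close>.\<close>

lemma variety_presents_both:
  assumes V: "variety V" and N: "presents A r N1 f1" "presents A s N2 f2" "N1 \<in> V" "N2 \<in> V"
    and M: "M \<in> finite_monoids" and g: "g \<in> monoid_homs (words_over A) M" "g ` lists A = carrier M"
    and ker: "\<And>u v. u \<in> lists A \<Longrightarrow> v \<in> lists A \<Longrightarrow> r u v \<Longrightarrow> s u v \<Longrightarrow> g u = g v"
  shows "M \<in> V"
proof -
  define G where "G i = (if i = 0 then N1 else N2)" for i :: nat
  define I where "I = {0, 1 :: nat}"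
  have G: "G i \<in> V" "G i \<in> finite_monoids" for i
    using N presentsD(1) by (auto simp: G_def)
  let ?P = "product_group I G"
  have P: "monoid ?P" by (rule product_group_monoid) (use G(2) finite_monoidsD(1) in blast)
  have "finite (carrier ?P)"
    using finite_PiE[of I "\<lambda>i. carrier (G i)"] finite_monoidsD(2)[OF G(2)] by (simp add: I_def)
  with P obtain N where N': "N \<in> finite_monoids" "?P \<cong> N" by (rule finite_monoid_nat_copy)
  have "finite I" by (simp add: I_def)
  then have NV: "N \<in> V" using V G(1) N' unfolding variety_def by blast
  obtain h k where h: "h \<in> monoid_homs ?P N" "bij_betw h (carrier ?P) (carrier N)"
    using iso_inverse_monoid_hom[OF N'(2) finite_monoidsD(1)[OF N'(1)] P] by metis
  define p where "p u = (\<lambda>i\<in>I. if i = 0 then f1 u else f2 u)" for u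
  have p: "p \<in> monoid_homs (words_over A) ?P"
    using presentsD(5-7)[OF N(1)] presentsD(5-7)[OF N(2)]
    by (intro monoid_homsI) (auto simp: p_def G_def PiE_iff fun_eq_iff)
  let ?q = "\<lambda>u. h (p u)"
  have q: "?q \<in> monoid_homs (words_over A) N" by (rule monoid_homs_compose[OF p h(1)])
  define H where "H = ?q ` lists A"
  have mult: "?q u \<otimes>\<^bsub>N\<^esub> ?q v = ?q (u @ v)" if "u \<in> lists A" "v \<in> lists A" for u v
    using monoid_homsD(2)[OF q, of u v] that by simp
  have one: "?q [] = \<one>\<^bsub>N\<^esub>" using monoid_homsD(3)[OF q] by simp
  have "submonoid H N"
  proof
    show "H \<subseteq> carrier N" using monoid_homsD(1)[OF q] by (auto simp: H_def)
    show "\<one>\<^bsub>N\<^esub> \<in> H" unfolding H_def one[symmetric] by (rule imageI) simp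
    show "x \<otimes>\<^bsub>N\<^esub> y \<in> H" if xy: "x \<in> H" "y \<in> H" for x y
    proof -
      obtain u v where "u \<in> lists A" "v \<in> lists A" "x = ?q u" "y = ?q v" using xy unfolding H_def by blast
      then show ?thesis using mult[of u v] unfolding H_def by (intro image_eqI[of _ _ "u @ v"]) auto
    qed
  qed
  then have HV: "N\<lparr>carrier := H\<rparr> \<in> V" using V NV unfolding variety_def by blast
  have qH: "?q \<in> monoid_homs (words_over A) (N\<lparr>carrier := H\<rparr>)"
    by (rule monoid_homsI) (simp_all add: H_def mult one)
  have surj: "?q ` carrier (words_over A) = carrier (N\<lparr>carrier := H\<rparr>)" by (simp add: H_def)
  have kerq: "g u = g v" if "u \<in> carrier (words_over A)" "v \<in> carrier (words_over A)" "?q u = ?q v" for u v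
  proof -
    have uv: "u \<in> lists A" "v \<in> lists A" using that by auto
    have "p u = p v"
      using that(3) inj_on_eq_iff[OF bij_betw_imp_inj_on[OF h(2)]] monoid_homsD(1)[OF p] that(1,2) by blast
    then have "p u 0 = p v 0" "p u 1 = p v 1" by simp_all
    then have "f1 u = f1 v" "f2 u = f2 v" by (simp_all add: p_def I_def)
    then have "r u v" "s u v" using presentsD(4)[OF N(1) uv] presentsD(4)[OF N(2) uv] by simp_all
    then show ?thesis by (rule ker[OF uv])
  qed
  obtain l where l: "l \<in> monoid_homs (N\<lparr>carrier := H\<rparr>) M" "\<And>u. u \<in> carrier (words_over A) \<Longrightarrow> l (?q u) = g u"
    using hom_factor[OF monoid_words_over qH surj g(1) kerq] by blast
  have "l ` carrier (N\<lparr>carrier := H\<rparr>) = carrier M"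
    unfolding surj[symmetric] image_image g(2)[symmetric] by (rule image_cong) (use l(2) in auto)
  then show ?thesis using V HV M l(1) unfolding variety_def by blast
qed

lemma W_level_subset_variety:
  assumes m: "1 \<le> m" and V: "variety V" and RL: "R_level (Suc m) \<subseteq> V" "L_level (Suc m) \<subseteq> V"
  shows "W_level (Suc m) \<subseteq> V"
proof
  fix M assume M: "M \<in> W_level (Suc m)"
  then have fm: "M \<in> finite_monoids" by (simp add: W_level_def equational_class_def)
  note M' = finite_monoidsD[OF fm]
  interpret monoid M by (rule M'(1))
  \<comment> \<open>The elements of \<open>M\<close> serve as letters. The type of letters has
    further naturals, which are sent to the unit to make \<phi> total on words; the presentations
    use the finite alphabet \<open>carrier M\<close>.\<close>
  define \<phi> where "\<phi> = word_eval M (\<lambda>i. if i \<in> carrier M then i else \<one>\<^bsub>M\<^esub>)"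
  have \<phi>: "\<phi> \<in> monoid_homs free_monoid M" unfolding \<phi>_def by (rule word_eval_hom[OF M'(1)]) simp
  obtain N where "W_congruence (\<lambda>u v. \<phi> u = \<phi> v) N m" using W_level_W_congruence[OF M m \<phi>] by blast
  from W_congruence_R_L_rel[OF this] obtain n where
    n: "\<And>u v. R_rel m n u v \<Longrightarrow> L_rel m n u v \<Longrightarrow> \<phi> u = \<phi> v" by blast
  let ?A = "carrier M"
  obtain N1 f1 where N1: "presents ?A (R_rel m n) N1 f1" using R_rel_presentation[OF M'(2)] by blast
  obtain N2 f2 where N2: "presents ?A (L_rel m n) N2 f2" using L_rel_presentation[OF M'(2)] by blast
  obtain k where k: "m = Suc k" using m by (cases m) auto
  have "N1 \<in> V" "N2 \<in> V"
    using R_rel_presents_R_level[OF M'(2) N1[unfolded k]] L_rel_presents_L_level[OF M'(2) N2[unfolded k]]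
      RL unfolding k by blast+
  then show "M \<in> V"
  proof (rule variety_presents_both[OF V N1 N2 _ _ fm])
    show "\<phi> \<in> monoid_homs (words_over ?A) M"
      using free_homD[OF \<phi>] by (intro monoid_homsI) simp_all
    show "\<phi> ` lists ?A = carrier M"
    proof
      show "\<phi> ` lists ?A \<subseteq> carrier M" using free_homD(1)[OF \<phi>] by blast
      have "x = \<phi> [x]" if "x \<in> carrier M" for x using that by (simp add: \<phi>_def)
      then show "carrier M \<subseteq> \<phi> ` lists ?A" by (intro subsetI image_eqI) auto
    qed
  qed (use n in blast)
qed

theorem theorem1:
  fixes m :: nat
  assumes "m \<ge> 2"
  shows "variety_join (R_level m) (L_level m) = W_level m"
proof -
  obtain k where m: "m = Suc (Suc k)" using assms by (metis add_2_eq_Suc le_Suc_ex)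
  show ?thesis
  proof
    show "variety_join (R_level m) (L_level m) \<subseteq> W_level m"
      unfolding variety_join_def m using level_subset_W_level[of k] variety_equational_class
      by (intro hull_minimal) (auto simp: W_level_def)
    have "variety (variety_join (R_level m) (L_level m))"
      unfolding m by (rule variety_variety_join[OF level_finite_monoids])
    moreover have "R_level m \<union> L_level m \<subseteq> variety_join (R_level m) (L_level m)"
      unfolding variety_join_def by (rule hull_subset)
    ultimately show "W_level m \<subseteq> variety_join (R_level m) (L_level m)"
      using W_level_subset_variety[of "Suc k"] unfolding m by simp
  qed
qed

end
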